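(* Let $d\ge2$, $s\in(0,1)$ and $\gamma\in(-d,0]$ with $\gamma+2s\in(0,1]$, and let $\Omega\subset\mathbb{R}^d$ be a bounded $C^1$ domain. Let $T\in(0,+\infty)$ and let $f\ge0$ be a classical solution of the non-cutoff Boltzmann equation $(\partial_t+v\cdot\nabla_x)f=Q(f,f)$ in $[0,T]\times\Omega\times\mathbb{R}^d$ with in-flow boundary condition, with initial datum $f_{\mathrm{in}}\ge0$ and boundary datum $f_b\ge0$. Assume there are positive constants $m_0,M_0,E_0,H_0$ such that for almost every $(t,x)\in(0,T)\times\Omega$, $m_0\le\int f(t,x,v)\,dv\le M_0$, $\int f(t,x,v)|v|^2dv\le E_0$, $\int f(t,x,v)\ln f(t,x,v)\,dv\le H_0$. Let $\hat q>d+2$ and assume there exist $a_0,a_b>0$ such that $$f_{\mathrm{in}}(x,v)\ge a_0\langle v\rangle^{-\hat q}\quad\forall(x,v)\in\Omega\times\mathbb{R}^d,\qquad f_b(t,x,v)\ge a_b\langle v\rangle^{-\hat q}\quad\forall(t,x,v)\in[0,T]\times\partial\Omega\times\mathbb{R}^d.$$ Then there exist $a_1>0$ and $\beta>0$ such that $$f(t,x,v)\ge a_1e^{-\beta t}\langle v\rangle^{-\hat q}\qquad\forall(t,x,v)\in[0,T]\times\Omega\times\mathbb{R}^d.$$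
   Context: $\langle v\rangle=(1+|v|^2)^{1/2}$. The in-flow boundary condition means $f(t,x,v)=f_b(t,x,v)$ for $x\in\partial\Omega$ and $v\cdot n(x)<0$, with $n$ the outward unit normal, and $f(0,x,v)=f_{\mathrm{in}}(x,v)$. A classical solution is a function regular enough (in particular continuous up to $t=0$ and up to the boundary) for the equation, the initial condition and the boundary condition to hold pointwise. Collision operator: $Q(f,f)(v)=\iint_{\mathbb{S}^{d-1}\times\mathbb{R}^d}(f(v_*')f(v')-f(v_* )f(v))B\,d\sigma\,dv_*$ with $v'=\frac{v+v_*}{2}+\frac{|v-v_*|}{2}\sigma$, $v_*'=\frac{v+v_*}{2}-\frac{|v-v_*|}{2}\sigma$, $B=|v-v_*|^\gamma b(\cos\theta)$, $\cos\theta=\frac{v-v_*}{|v-v_*|}\cdot\sigma$, $b(\cos\theta)=|\sin(\theta/2)|^{-(d-1)-2s}|\cos(\theta/2)|^{\gamma+2s+1}\tilde b(\cos\theta)$, where $\tilde b$ is measurable with $0<\tilde b_-\le\tilde b\le\tilde b_+$. Equivalently (Carleman form) $Q(f,f)(v)=\int[f(v')K_f(v,v')-f(v)K_f(v',v)]dv'$ with $K_f(v,v')=2^{d-1}|v'-v|^{-(d+2s)}\int_{w\perp v'-v}f(v+w)|w|^{\gamma+2s+1}\tilde b(\cos\theta)\,dw$, $\cos\theta=\frac{|w|^2-|v-v'|^2}{|w|^2+|v-v'|^2}$. *)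

theory Defs
  imports "HOL-Analysis.Analysis"
begin

definition japanese :: "real^'n \<Rightarrow> real" where
  "japanese v = sqrt (1 + (norm v)\<^sup>2)"

text \<open>
  Surface measure on the unit sphere of $R^d$, as a measure whose space is the sphere itself.
  By polar coordinates, the part of the unit ball lying over a Borel set \<open>A\<close> of directions has
  volume \<open>|A| / d\<close>, so the surface measure is \<open>d\<close> times the image of Lebesgue measure
  on the punctured unit ball under the radial projection \<open>x \<mapsto> x / |x|\<close>.
\<close>
definition sphere_measure :: "(real^'n) measure" where
  "sphere_measure =
     scale_measure (ennreal (real CARD('n)))
       (distr (restrict_space lborel (ball 0 1 - {0})) (restrict_space borel (sphere 0 1)) sgn)"

definition post_v :: "real^'n \<Rightarrow> real^'n \<Rightarrow> real^'n \<Rightarrow> real^'n" where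
  "post_v v w \<sigma> = (1/2) *\<^sub>R (v + w) + (norm (v - w) / 2) *\<^sub>R \<sigma>"

definition post_vstar :: "real^'n \<Rightarrow> real^'n \<Rightarrow> real^'n \<Rightarrow> real^'n" where
  "post_vstar v w \<sigma> = (1/2) *\<^sub>R (v + w) - (norm (v - w) / 2) *\<^sub>R \<sigma>"

definition cos_deviation :: "real^'n \<Rightarrow> real^'n \<Rightarrow> real^'n \<Rightarrow> real" where
  "cos_deviation v w \<sigma> = ((v - w) /\<^sub>R norm (v - w)) \<bullet> \<sigma>"

text \<open>The angular factor \<open>b\<close>, as a function of \<open>c = cos \<theta>\<close>; \<open>d\<close> is the dimension.\<close>
definition angular_kernel :: "real \<Rightarrow> real \<Rightarrow> real \<Rightarrow> (real \<Rightarrow> real) \<Rightarrow> real \<Rightarrow> real" where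
  "angular_kernel d \<gamma> s bt c =
     \<bar>sin (arccos c / 2)\<bar> powr (- (d - 1) - 2 * s)
     * \<bar>cos (arccos c / 2)\<bar> powr (\<gamma> + 2 * s + 1) * bt c"

definition collision_kernel ::
    "real \<Rightarrow> real \<Rightarrow> (real \<Rightarrow> real) \<Rightarrow> real^'n \<Rightarrow> real^'n \<Rightarrow> real^'n \<Rightarrow> real" where
  "collision_kernel \<gamma> s bt v w \<sigma> =
     norm (v - w) powr \<gamma> * angular_kernel (real CARD('n)) \<gamma> s bt (cos_deviation v w \<sigma>)"

text \<open>The integrand of \<open>Q(g,g)(v)\<close>, restricted to deviation angles \<open>\<theta> \<ge> \<epsilon>\<close>;
  the integration variable is the pair of \<open>\<sigma>\<close> and \<open>w = v\<^sub>*\<close>.\<close>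
definition truncated_collision_integrand ::
    "real \<Rightarrow> real \<Rightarrow> (real \<Rightarrow> real) \<Rightarrow> real \<Rightarrow> (real^'n \<Rightarrow> real) \<Rightarrow> real^'n
      \<Rightarrow> (real^'n) \<times> (real^'n) \<Rightarrow> real" where
  "truncated_collision_integrand \<gamma> s bt \<epsilon> g v = (\<lambda>(\<sigma>, w).
     if arccos (cos_deviation v w \<sigma>) \<ge> \<epsilon>
     then (g (post_vstar v w \<sigma>) * g (post_v v w \<sigma>) - g w * g v) * collision_kernel \<gamma> s bt v w \<sigma>
     else 0)"

text \<open>
  \<open>has_collision_value \<gamma> s bt g v q\<close>: the collision integral \<open>Q(g,g)(v)\<close> is well defined and
  equals \<open>q\<close>.  For \<open>s \<ge> 1/2\<close> the non-integrable singularity of \<open>b\<close> at \<open>\<theta> = 0\<close> is in general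
  only compensated after cancellation of the first-order terms under the reflection of \<open>\<sigma>\<close>
  about the axis \<open>v - v\<^sub>*\<close>, so the integral is a principal value in the deviation angle.
  If the full integrand is Lebesgue integrable, this is its Lebesgue integral.
\<close>
definition has_collision_value ::
    "real \<Rightarrow> real \<Rightarrow> (real \<Rightarrow> real) \<Rightarrow> (real^'n \<Rightarrow> real) \<Rightarrow> real^'n \<Rightarrow> real \<Rightarrow> bool" where
  "has_collision_value \<gamma> s bt g v q \<longleftrightarrow>
     (\<forall>\<epsilon>>0. integrable (sphere_measure \<Otimes>\<^sub>M lborel) (truncated_collision_integrand \<gamma> s bt \<epsilon> g v)) \<and>
     ((\<lambda>\<epsilon>. integral\<^sup>L (sphere_measure \<Otimes>\<^sub>M lborel) (truncated_collision_integrand \<gamma> s bt \<epsilon> g v))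
        \<longlongrightarrow> q) (at_right 0)"

text \<open>\<open>\<rho>\<close> is a \<open>C\<^sup>1\<close> function on the open set \<open>U\<close> with nonvanishing gradient \<open>G\<close>, and inside
  \<open>U\<close> the set \<open>\<Omega>\<close> is the region where \<open>\<rho> < 0\<close>; then the boundary of \<open>\<Omega>\<close> in \<open>U\<close> is the
  level set \<open>\<rho> = 0\<close>, and \<open>G\<close> points out of \<open>\<Omega>\<close> there.\<close>
definition C1_defining_function ::
    "(real^'n) set \<Rightarrow> (real^'n) set \<Rightarrow> (real^'n \<Rightarrow> real) \<Rightarrow> (real^'n \<Rightarrow> real^'n) \<Rightarrow> bool" where
  "C1_defining_function \<Omega> U \<rho> G \<longleftrightarrow>
     open U \<and> (\<forall>x\<in>U. GDERIV \<rho> x :> G x) \<and> continuous_on U G \<and> (\<forall>x\<in>U. G x \<noteq> 0) \<and>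
     \<Omega> \<inter> U = {x \<in> U. \<rho> x < 0}"

definition C1_domain :: "(real^'n) set \<Rightarrow> bool" where
  "C1_domain \<Omega> \<longleftrightarrow> open \<Omega> \<and> connected \<Omega> \<and> \<Omega> \<noteq> {} \<and>
     (\<forall>x\<in>frontier \<Omega>. \<exists>U \<rho> G. x \<in> U \<and> C1_defining_function \<Omega> U \<rho> G)"

definition outward_unit_normal :: "(real^'n) set \<Rightarrow> real^'n \<Rightarrow> real^'n \<Rightarrow> bool" where
  "outward_unit_normal \<Omega> x \<nu> \<longleftrightarrow>
     (\<exists>U \<rho> G. x \<in> U \<and> C1_defining_function \<Omega> U \<rho> G \<and> \<nu> = G x /\<^sub>R norm (G x))"

definition boltzmann_equation_at ::
    "real \<Rightarrow> real \<Rightarrow> (real \<Rightarrow> real) \<Rightarrow> (real \<Rightarrow> real^'n \<Rightarrow> real^'n \<Rightarrow> real)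
      \<Rightarrow> real \<Rightarrow> real^'n \<Rightarrow> real^'n \<Rightarrow> bool" where
  "boltzmann_equation_at \<gamma> s bt f t x v \<longleftrightarrow>
     (\<exists>f\<^sub>t f\<^sub>x q. ((\<lambda>\<tau>. f \<tau> x v) has_real_derivative f\<^sub>t) (at t) \<and>
        GDERIV (\<lambda>y. f t y v) x :> f\<^sub>x \<and>
        has_collision_value \<gamma> s bt (f t x) v q \<and>
        f\<^sub>t + v \<bullet> f\<^sub>x = q)"

text \<open>The equation is imposed at interior times and positions only; the initial and boundary
  data are attained through the continuity of \<open>f\<close> up to \<open>t = 0\<close> and up to the boundary.\<close>
definition classical_inflow_solution ::
    "real \<Rightarrow> real \<Rightarrow> (real \<Rightarrow> real) \<Rightarrow> (real^'n) set \<Rightarrow> (real^'n \<Rightarrow> real^'n) \<Rightarrow> real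
      \<Rightarrow> (real^'n \<Rightarrow> real^'n \<Rightarrow> real) \<Rightarrow> (real \<Rightarrow> real^'n \<Rightarrow> real^'n \<Rightarrow> real)
      \<Rightarrow> (real \<Rightarrow> real^'n \<Rightarrow> real^'n \<Rightarrow> real) \<Rightarrow> bool" where
  "classical_inflow_solution \<gamma> s bt \<Omega> n T f\<^sub>i\<^sub>n f\<^sub>b f \<longleftrightarrow>
     continuous_on ({0..T} \<times> closure \<Omega> \<times> UNIV) (\<lambda>(t, x, v). f t x v) \<and>
     (\<forall>t\<in>{0<..<T}. \<forall>x\<in>\<Omega>. \<forall>v. boltzmann_equation_at \<gamma> s bt f t x v) \<and>
     (\<forall>x\<in>\<Omega>. \<forall>v. f 0 x v = f\<^sub>i\<^sub>n x v) \<and>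
     (\<forall>t\<in>{0..T}. \<forall>x\<in>frontier \<Omega>. \<forall>v. v \<bullet> n x < 0 \<longrightarrow> f t x v = f\<^sub>b t x v)"

text \<open>The integrability conditions are explicit because the Bochner integral of a
  non-integrable function is \<open>0\<close>.\<close>
definition hydrodynamic_bounds ::
    "real \<Rightarrow> real \<Rightarrow> real \<Rightarrow> real \<Rightarrow> (real^'n \<Rightarrow> real) \<Rightarrow> bool" where
  "hydrodynamic_bounds m\<^sub>0 M\<^sub>0 E\<^sub>0 H\<^sub>0 g \<longleftrightarrow>
     integrable lborel g \<and> m\<^sub>0 \<le> (LINT v|lborel. g v) \<and> (LINT v|lborel. g v) \<le> M\<^sub>0 \<and>
     integrable lborel (\<lambda>v. g v * (norm v)\<^sup>2) \<and> (LINT v|lborel. g v * (norm v)\<^sup>2) \<le> E\<^sub>0 \<and>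
     integrable lborel (\<lambda>v. g v * ln (g v)) \<and> (LINT v|lborel. g v * ln (g v)) \<le> H\<^sub>0"

end

theory Submission
  imports Defs
begin

text \<open>
  The barrier \<open>a exp (- \<beta> t) \<langle>v\<rangle>\<^sup>-\<^sup>q\<close> lies below the initial and the incoming data. Suppose that the
  difference \<open>h\<close> of the solution and the barrier has a negative minimum \<open>- \<epsilon>\<close>, attained at \<open>(t, x, v)\<close>.
  Then \<open>\<partial>\<^sub>t f + v \<bullet> \<nabla>\<^sub>x f \<le> - \<beta> a exp (- \<beta> t) \<langle>v\<rangle>\<^sup>-\<^sup>q\<close> there, so it suffices that
  \<open>Q(f,f)(v) \<ge> - C a exp (- \<beta> t) \<langle>v\<rangle>\<^sup>-\<^sup>q\<close> with \<open>C < \<beta>\<close>.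

  Write \<open>w = v - v\<^sub>*'\<close>. For fixed \<open>\<sigma>\<close> the map \<open>v\<^sub>* \<mapsto> w\<close> has an explicit Jacobian, and it turns the gain
  term into an integral over \<open>w\<close> of \<open>f (v - w)\<close> times a spherical integral of \<open>f v'\<close>. Since \<open>f v' \<ge> a exp (- \<beta> t) \<langle>v'\<rangle>\<^sup>-\<^sup>q - \<epsilon>\<close>
  with equality at \<open>v\<close>, the function \<open>f v'\<close> may be replaced by the weight. The reflection of \<open>\<sigma>\<close> about \<open>w\<close> maps
  \<open>v' - v\<close> to its negative, and the second differences of the weight are at least
  \<open>- q \<langle>v\<rangle>\<^sup>-\<^sup>q min (|v' - v|\<^sup>2 / \<langle>v\<rangle>\<^sup>2) 1\<close>. The spherical integral of this minimum against the kernel is of order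
  \<open>(|w| / \<langle>v\<rangle>)\<^sup>2\<^sup>s\<close>, so that mass and energy bound the remainder. What is left is \<open>f v\<close> times the difference of the
  integrals of \<open>f v\<^sub>*'\<close> and \<open>f v\<^sub>*\<close>, which is nonnegative by the cancellation lemma.
\<close>

section \<open>Changes of variables for Lebesgue measure\<close>

text \<open>Grazing collisions can make gain and loss separately infinite, so the deviation angle is
  cut off before they are split. All integrals are then taken in the extended nonnegative reals,
  where subtraction is the delicate point: the loss and the weight multiplying
  \<open>\<epsilon>\<close> have to be finite. The bounds proving this blow up as the cut is
  removed, whereas the constant C has to survive that limit. Hence there are two estimates of the
  spherical kernel: one with the factor min and uniform in the cut, one without it and merely
  qualitative.

  The size of the remainder rests on exponents. Let p be the cosine of the angle between sigma and
  w. The Jacobian and |v - v_*|^gamma contribute p^(-gamma-2), the factor cos(theta/2)^(gamma+2s+1)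
  turns this into p^(2s-1), and in the tangent r of that angle every power of p disappears, which
  leaves r^(-1-2s) dr. The resulting |w|^gamma (|w|/<v>)^(2s) grows at most linearly in v_*' because
  gamma + 2s <= 1.\<close>

lemma nn_integral_lborel_translate:
  fixes f :: "'a::euclidean_space \<Rightarrow> ennreal"
  assumes [measurable]: "f \<in> borel_measurable borel"
  shows "(\<integral>\<^sup>+x. f (a + x) \<partial>lborel) = (\<integral>\<^sup>+x. f x \<partial>lborel)"
proof -
  have "(\<integral>\<^sup>+x. f x \<partial>lborel) = (\<integral>\<^sup>+x. f x \<partial>distr lborel borel ((+) a))"
    by (simp add: lborel_distr_plus)
  also have "\<dots> = (\<integral>\<^sup>+x. f (a + x) \<partial>lborel)"
    by (subst nn_integral_distr) auto
  finally show ?thesis by simp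
qed

lemma nn_integral_lborel_scale:
  fixes f :: "'a::euclidean_space \<Rightarrow> ennreal"
  assumes [measurable]: "f \<in> borel_measurable borel" and "c \<noteq> 0"
  shows "(\<integral>\<^sup>+x. f x \<partial>lborel) = ennreal (\<bar>c\<bar> ^ DIM('a)) * (\<integral>\<^sup>+x. f (c *\<^sub>R x) \<partial>lborel)"
proof -
  have "(\<integral>\<^sup>+x. f x \<partial>lborel)
      = (\<integral>\<^sup>+x. f x \<partial>density (distr lborel borel (\<lambda>x. 0 + c *\<^sub>R x)) (\<lambda>x::'a. ennreal (\<bar>c\<bar> ^ DIM('a))))"
    using lborel_affine[OF \<open>c \<noteq> 0\<close>, of "0::'a"] by simp
  also have "\<dots> = ennreal (\<bar>c\<bar> ^ DIM('a)) * (\<integral>\<^sup>+x. f (c *\<^sub>R x) \<partial>lborel)"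
    by (simp add: nn_integral_density nn_integral_distr nn_integral_cmult)
  finally show ?thesis .
qed

lemma nn_integral_lborel_scale_real:
  fixes f :: "real \<Rightarrow> ennreal"
  assumes "f \<in> borel_measurable borel" and "c > 0"
  shows "(\<integral>\<^sup>+x. f x \<partial>lborel) = ennreal c * (\<integral>\<^sup>+x. f (c * x) \<partial>lborel)"
  using nn_integral_real_affine[of f c 0] assms by simp

text \<open>The base points run through a slab of thickness one, so that no product structure adapted
  to \<open>e\<close> is needed.\<close>
lemma nn_integral_lborel_lines:
  fixes f :: "'a::euclidean_space \<Rightarrow> ennreal"
  assumes [measurable]: "f \<in> borel_measurable borel" and e: "norm e = 1"
  shows "(\<integral>\<^sup>+x. f x \<partial>lborel) =
    (\<integral>\<^sup>+x. indicator {0..1} (x \<bullet> e) * (\<integral>\<^sup>+t. f (x - (x \<bullet> e) *\<^sub>R e + t *\<^sub>R e) \<partial>lborel) \<partial>lborel)"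
proof -
  have ee: "e \<bullet> e = 1" using e by (simp add: dot_square_norm)
  have base: "(\<integral>\<^sup>+t. f (x - (x \<bullet> e) *\<^sub>R e + t *\<^sub>R e) \<partial>lborel) = (\<integral>\<^sup>+t. f (x + t *\<^sub>R e) \<partial>lborel)" for x
    using nn_integral_lborel_translate[of "\<lambda>t. f (x - (x \<bullet> e) *\<^sub>R e + t *\<^sub>R e)" "x \<bullet> e"]
    by (simp add: algebra_simps)
  have "(\<integral>\<^sup>+x. indicator {0..1} (x \<bullet> e) * (\<integral>\<^sup>+t. f (x + t *\<^sub>R e) \<partial>lborel) \<partial>lborel)
      = (\<integral>\<^sup>+x. \<integral>\<^sup>+t. indicator {0..1} (x \<bullet> e) * f (x + t *\<^sub>R e) \<partial>lborel \<partial>lborel)"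
    by (simp add: nn_integral_cmult)
  \<comment> \<open>Once \<open>t\<close> is outside, \<open>x\<close> can be shifted by a multiple
    of \<open>e\<close>. Then \<open>f\<close> no longer depends on \<open>t\<close>, and the
    integral over \<open>t\<close> is the thickness one of the slab.\<close>
  also have "\<dots> = (\<integral>\<^sup>+t. \<integral>\<^sup>+x. indicator {0..1} (x \<bullet> e) * f (x + t *\<^sub>R e) \<partial>lborel \<partial>lborel)"
    by (rule lborel_pair.Fubini'[symmetric]) simp
  also have "\<dots> = (\<integral>\<^sup>+t. \<integral>\<^sup>+x. indicator {0..1} (x \<bullet> e - t) * f x \<partial>lborel \<partial>lborel)"
  proof (rule nn_integral_cong)
    fix t :: real
    show "(\<integral>\<^sup>+x. indicator {0..1} (x \<bullet> e) * f (x + t *\<^sub>R e) \<partial>lborel)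
        = (\<integral>\<^sup>+x. indicator {0..1} (x \<bullet> e - t) * f x \<partial>lborel)"
      using nn_integral_lborel_translate[of "\<lambda>x. indicator {0..1} (x \<bullet> e - t) * f x" "t *\<^sub>R e"]
      by (simp add: inner_add_left ee add.commute)
  qed
  also have "\<dots> = (\<integral>\<^sup>+x. \<integral>\<^sup>+t. indicator {0..1} (x \<bullet> e - t) * f x \<partial>lborel \<partial>lborel)"
    by (rule lborel_pair.Fubini') simp
  also have "\<dots> = (\<integral>\<^sup>+x. f x \<partial>lborel)"
  proof (rule nn_integral_cong)
    fix x :: 'a
    have "(\<integral>\<^sup>+t. indicator {0..1} (x \<bullet> e - t) * f x \<partial>lborel)
        = (\<integral>\<^sup>+t. indicator {x \<bullet> e - 1..x \<bullet> e} t * f x \<partial>lborel)"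
      by (intro nn_integral_cong) (auto simp: indicator_def)
    also have "\<dots> = f x"
      by (simp add: nn_integral_multc)
    finally show "(\<integral>\<^sup>+t. indicator {0..1} (x \<bullet> e - t) * f x \<partial>lborel) = f x" .
  qed
  finally show ?thesis by (simp add: base)
qed

text \<open>The map t -> t/2 - c/(2t) sends the positive half-line increasingly onto the real line
  with derivative (1 + c/t^2)/2. For z orthogonal to e and c = |z|^2 it describes, on a line
  parallel to e, the passage from z + t e to the point u with u + |u| e = z + t e.\<close>

lemma nn_integral_lborel_half_line:
  fixes f :: "real \<Rightarrow> ennreal"
  assumes [measurable]: "f \<in> borel_measurable borel" and c: "c > 0"
  shows "(\<integral>\<^sup>+t. f t \<partial>lborel) =
    (\<integral>\<^sup>+t. indicator {0<..} t * ennreal ((1 + c / t\<^sup>2) / 2) * f (t / 2 - c / (2 * t)) \<partial>lborel)"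
proof -
  define D where "D t = indicator {0<..} t * ennreal ((1 + c / t\<^sup>2) / 2)" for t :: real
  define S where "S t = t / 2 - c / (2 * t)" for t :: real
  have [measurable]: "D \<in> borel_measurable borel" "S \<in> borel_measurable borel"
    unfolding D_def S_def by measurable
  \<comment> \<open>The inverse map: \<open>r l\<close> is the positive root of t^2 - 2 l t - c =
    0.\<close>
  define r where "r l = l + sqrt (l\<^sup>2 + c)" for l :: real
  have r_pos: "r l > 0" for l
  proof -
    have "\<bar>l\<bar> < sqrt (l\<^sup>2 + c)" using c by (intro real_less_rsqrt) auto
    then show ?thesis unfolding r_def by linarith
  qed
  have Sr: "S (r l) = l" for l
  proof -
    have "(r l)\<^sup>2 - c = 2 * l * r l"
      using c by (simp add: r_def power2_eq_square algebra_simps real_sqrt_mult_self)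
    moreover have "S (r l) = ((r l)\<^sup>2 - c) / (2 * r l)"
      using r_pos[of l] by (simp add: S_def field_simps power2_eq_square)
    ultimately show ?thesis using r_pos[of l] by simp
  qed
  have S_mono: "S x < S y \<longleftrightarrow> x < y" if "x > 0" "y > 0" for x y
  proof -
    have *: "S x < S y" if "0 < x" "x < y" for x y
    proof -
        have "c / (2 * y) < c / (2 * x)" using that c by (intro divide_strict_left_mono) auto
        then show ?thesis using that by (simp add: S_def)
    qed
    show ?thesis using *[of x y] *[of y x] that by (cases x y rule: linorder_cases) auto
  qed
  have DS: "(S has_real_derivative (1 + c / t\<^sup>2) / 2) (at t)" if "t > 0" for t
    unfolding S_def using that
    by (auto intro!: derivative_eq_intros simp: field_simps power2_eq_square)
  have "lborel = distr (density lborel D) borel S"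
  proof (rule lborel_eqI)
    fix l u :: real assume "\<And>b. b \<in> Basis \<Longrightarrow> l \<bullet> b \<le> u \<bullet> b"
    then have lu: "l \<le> u" by simp
    then have rlu: "r l \<le> r u" using S_mono[of "r u" "r l"] r_pos Sr by (metis not_less)
    have eq: "indicator {0<..} t * indicator (S -` box l u) t = (indicator {r l<..<r u} t :: ennreal)" for t
      using S_mono[of "r l" t] S_mono[of t "r u"] r_pos[of l] r_pos[of u]
      by (auto simp: indicator_def Sr)
    have "emeasure (distr (density lborel D) borel S) (box l u) = (\<integral>\<^sup>+t. D t * indicator (S -` box l u) t \<partial>lborel)"
    proof -
        have "S -` box l u \<in> sets borel" by (rule measurable_sets_borel[of S borel]) auto
        then show ?thesis by (simp add: emeasure_distr emeasure_density del: box_real)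
    qed
    also have "\<dots> = (\<integral>\<^sup>+t. ennreal ((1 + c / t\<^sup>2) / 2) * indicator {r l<..<r u} t \<partial>lborel)"
      by (intro nn_integral_cong, subst eq[symmetric]) (simp add: D_def mult_ac)
    also have "\<dots> = (\<integral>\<^sup>+t. ennreal ((1 + c / t\<^sup>2) / 2) * indicator {r l..r u} t \<partial>lborel)"
    proof (rule nn_integral_cong_AE)
      show "AE t in lborel. ennreal ((1 + c / t\<^sup>2) / 2) * indicator {r l<..<r u} t
          = ennreal ((1 + c / t\<^sup>2) / 2) * indicator {r l..r u} t"
        using AE_lborel_singleton[of "r l"] AE_lborel_singleton[of "r u"]
        by eventually_elim (auto simp: indicator_def)
    qed
    also have "\<dots> = ennreal (S (r u) - S (r l))"
      using r_pos[of l] rlu c by (intro nn_integral_FTC_Icc DS) auto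
    finally show "emeasure (distr (density lborel D) borel S) (box l u) = ennreal (prod ((\<bullet>) (u - l)) Basis)"
      by (simp add: Sr)
  qed simp
  then have "(\<integral>\<^sup>+t. f t \<partial>lborel) = (\<integral>\<^sup>+t. f t \<partial>distr (density lborel D) borel S)"
    by simp
  also have "\<dots> = (\<integral>\<^sup>+t. D t * f (S t) \<partial>lborel)"
    by (simp add: nn_integral_distr nn_integral_density)
  finally show ?thesis by (simp add: D_def S_def)
qed

text \<open>In dimension at least two the line lies in a hyperplane. This discards the points
  without a component orthogonal to \<open>e\<close>, for which the one-dimensional substitutions
  degenerate.\<close>

lemma AE_lborel_not_on_line:
  fixes e :: "'a::euclidean_space"
  assumes "2 \<le> DIM('a)"
  shows "AE x in lborel. x \<noteq> (x \<bullet> e) *\<^sub>R e"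
proof -
  obtain a where a: "a \<noteq> 0" "orthogonal e a"
    using orthogonal_to_vector_exists[OF assms] by blast
  have "negligible {x. a \<bullet> x = 0}" using a by (intro negligible_hyperplane) auto
  then have "{x. a \<bullet> x = 0} \<in> null_sets lborel"
    by (simp add: negligible_iff_null_sets null_sets_def)
  then have "AE x in lborel. x \<notin> {x. a \<bullet> x = 0}" by (rule AE_not_in)
  then show ?thesis
  proof eventually_elim
    case (elim x)
    then show ?case using a(2) by (auto simp: orthogonal_def inner_commute) (metis inner_scaleR_right mult_zero_right inner_commute)
  qed
qed

text \<open>The argument of \<open>f\<close> on the right is the point \<open>u\<close> with \<open>(u + |u| e) / 2 = x\<close>.\<close>
lemma nn_integral_lborel_halfspace:
  fixes f :: "'a::euclidean_space \<Rightarrow> ennreal"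
  assumes [measurable]: "f \<in> borel_measurable borel" and e: "norm e = 1" and d: "2 \<le> DIM('a)"
  shows "(\<integral>\<^sup>+x. f x \<partial>lborel) =
    (\<integral>\<^sup>+x. indicator {0<..} (x \<bullet> e) * ennreal (2 ^ (DIM('a) - 1) * (norm x)\<^sup>2 / (x \<bullet> e)\<^sup>2)
       * f (2 *\<^sub>R x - ((norm x)\<^sup>2 / (x \<bullet> e)) *\<^sub>R e) \<partial>lborel)"
proof -
  have ee: "e \<bullet> e = 1" using e by (simp add: dot_square_norm)
  \<comment> \<open>\<open>g\<close> belongs to the variable y = u + |u| e. The final dilation by 2
    passes to the midpoint y/2, and its Jacobian 2^d turns the 1/2 of the half-line density into
    2^(d-1).\<close>
  define g where "g y = indicator {0<..} (y \<bullet> e) * ennreal ((norm y)\<^sup>2 / (2 * (y \<bullet> e)\<^sup>2))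
     * f (y - ((norm y)\<^sup>2 / (2 * (y \<bullet> e))) *\<^sub>R e)" for y
  have [measurable]: "g \<in> borel_measurable borel" unfolding g_def by measurable
  have "(\<integral>\<^sup>+x. f x \<partial>lborel) = (\<integral>\<^sup>+x. g x \<partial>lborel)"
  proof (subst (1 2) nn_integral_lborel_lines[OF _ e], safe intro!: nn_integral_cong_AE)
    show "AE x in lborel. indicator {0..1} (x \<bullet> e) * (\<integral>\<^sup>+t. f (x - (x \<bullet> e) *\<^sub>R e + t *\<^sub>R e) \<partial>lborel)
        = indicator {0..1} (x \<bullet> e) * (\<integral>\<^sup>+t. g (x - (x \<bullet> e) *\<^sub>R e + t *\<^sub>R e) \<partial>lborel)"
      using AE_lborel_not_on_line[OF d, of e]
    proof eventually_elim
      case (elim x)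
      define z where "z = x - (x \<bullet> e) *\<^sub>R e"
      have ze: "z \<bullet> e = 0" by (simp add: z_def inner_diff_left ee)
      have c: "(norm z)\<^sup>2 > 0" using elim by (simp add: z_def)
      have n: "(norm (z + t *\<^sub>R e))\<^sup>2 = (norm z)\<^sup>2 + t\<^sup>2" for t
        unfolding power2_norm_eq_inner using ze
        by (simp add: inner_add_left inner_add_right ee inner_commute power2_eq_square)
      have i: "(z + t *\<^sub>R e) \<bullet> e = t" for t by (simp add: inner_add_left ze ee)
      have "(\<integral>\<^sup>+t. f (z + t *\<^sub>R e) \<partial>lborel) = (\<integral>\<^sup>+t. g (z + t *\<^sub>R e) \<partial>lborel)"
      proof (subst nn_integral_lborel_half_line[OF _ c], measurable, intro nn_integral_cong)
        fix t :: real
        show "indicator {0<..} t * ennreal ((1 + (norm z)\<^sup>2 / t\<^sup>2) / 2) * f (z + (t / 2 - (norm z)\<^sup>2 / (2 * t)) *\<^sub>R e)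
            = g (z + t *\<^sub>R e)"
        proof (cases "t > 0")
          case True
          then have 1: "(1 + (norm z)\<^sup>2 / t\<^sup>2) / 2 = ((norm z)\<^sup>2 + t\<^sup>2) / (2 * t\<^sup>2)"
            by (simp add: field_simps)
          have 2: "t / 2 - (norm z)\<^sup>2 / (2 * t) = t - ((norm z)\<^sup>2 + t\<^sup>2) / (2 * t)"
            using True by (simp add: field_simps power2_eq_square)
          show ?thesis unfolding g_def n i 1 2 by (simp add: algebra_simps)
        qed (simp add: g_def i)
      qed
      then show ?case by (simp add: z_def)
    qed
  qed simp_all
  also have "\<dots> = ennreal (2 ^ DIM('a)) * (\<integral>\<^sup>+x. g (2 *\<^sub>R x) \<partial>lborel)"
    using nn_integral_lborel_scale[of g 2] by simp
  also have "\<dots> = (\<integral>\<^sup>+x. ennreal (2 ^ DIM('a)) * g (2 *\<^sub>R x) \<partial>lborel)"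
    by (rule nn_integral_cmult[symmetric]) measurable
  also have "\<dots> = (\<integral>\<^sup>+x. indicator {0<..} (x \<bullet> e) * ennreal (2 ^ (DIM('a) - 1) * (norm x)\<^sup>2 / (x \<bullet> e)\<^sup>2)
       * f (2 *\<^sub>R x - ((norm x)\<^sup>2 / (x \<bullet> e)) *\<^sub>R e) \<partial>lborel)"
  proof (rule nn_integral_cong)
    fix x :: 'a
    have 1: "(2 * norm x)\<^sup>2 / (2 * (2 * (x \<bullet> e))) = (norm x)\<^sup>2 / (x \<bullet> e)" by (simp add: power2_eq_square)
    have "(2::real) ^ DIM('a) = 2 * 2 ^ (DIM('a) - 1)" using d by (simp flip: power_Suc)
    then have "ennreal (2 ^ DIM('a)) * ennreal ((2 * norm x)\<^sup>2 / (2 * (2 * (x \<bullet> e))\<^sup>2))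
        = ennreal (2 ^ (DIM('a) - 1) * (norm x)\<^sup>2 / (x \<bullet> e)\<^sup>2)"
      by (subst ennreal_mult'[symmetric]) (simp_all add: power2_eq_square)
    then show "ennreal (2 ^ DIM('a)) * g (2 *\<^sub>R x) = indicator {0<..} (x \<bullet> e) *
        ennreal (2 ^ (DIM('a) - 1) * (norm x)\<^sup>2 / (x \<bullet> e)\<^sup>2) * f (2 *\<^sub>R x - ((norm x)\<^sup>2 / (x \<bullet> e)) *\<^sub>R e)"
      unfolding g_def by (simp add: 1 indicator_def mult.assoc[symmetric])
  qed
  finally show ?thesis .
qed

text \<open>The map fixes \<open>e\<close> and negates the orthogonal complement. It is composed of
  -1 on the whole space and of t -> -t on every line parallel to \<open>e\<close>, both of which
  preserve the measure.\<close>

lemma nn_integral_lborel_reflect: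
  fixes f :: "'a::euclidean_space \<Rightarrow> ennreal"
  assumes [measurable]: "f \<in> borel_measurable borel" and e: "norm e = 1"
  shows "(\<integral>\<^sup>+x. f (2 *\<^sub>R (x \<bullet> e) *\<^sub>R e - x) \<partial>lborel) = (\<integral>\<^sup>+x. f x \<partial>lborel)"
proof -
  have ee: "e \<bullet> e = 1" using e by (simp add: dot_square_norm)
  have "(\<integral>\<^sup>+x. f (2 *\<^sub>R (x \<bullet> e) *\<^sub>R e - x) \<partial>lborel) = (\<integral>\<^sup>+x. f (- x) \<partial>lborel)"
  proof -
    have "(\<integral>\<^sup>+t. f (2 *\<^sub>R ((x - (x \<bullet> e) *\<^sub>R e + t *\<^sub>R e) \<bullet> e) *\<^sub>R e - (x - (x \<bullet> e) *\<^sub>R e + t *\<^sub>R e)) \<partial>lborel)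
        = (\<integral>\<^sup>+t. f (- (x - (x \<bullet> e) *\<^sub>R e + t *\<^sub>R e)) \<partial>lborel)" for x
    proof -
      define z where "z = x - (x \<bullet> e) *\<^sub>R e"
      have ze: "z \<bullet> e = 0" by (simp add: z_def inner_diff_left ee)
      have 1: "2 *\<^sub>R ((z + t *\<^sub>R e) \<bullet> e) *\<^sub>R e - (z + t *\<^sub>R e) = - (z + (-1 * t) *\<^sub>R e)" for t
        by (simp add: inner_add_left ze ee) (simp flip: scaleR_diff_left)
      show ?thesis
        using nn_integral_lborel_scale[of "\<lambda>t::real. f (- (z + t *\<^sub>R e))" "-1"]
        unfolding z_def[symmetric] 1 by simp
    qed
    then show ?thesis by (subst (1 2) nn_integral_lborel_lines[OF _ e]) simp_all
  qed
  also have "\<dots> = (\<integral>\<^sup>+x. f x \<partial>lborel)"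
    using nn_integral_lborel_scale[of f "-1"] by simp
  finally show ?thesis .
qed

text \<open>The dilation of the whole space has Jacobian r^d, and undoing it on the lines parallel
  to \<open>e\<close> costs one factor r. No integral over the hyperplane itself is formed.\<close>

lemma nn_integral_lborel_dilate_perp:
  fixes f :: "'a::euclidean_space \<Rightarrow> ennreal"
  assumes [measurable]: "f \<in> borel_measurable borel" and e: "norm e = 1" and r: "r > 0"
  shows "(\<integral>\<^sup>+x. f x \<partial>lborel) =
    ennreal (r ^ (DIM('a) - 1)) * (\<integral>\<^sup>+x. f ((x \<bullet> e) *\<^sub>R e + r *\<^sub>R (x - (x \<bullet> e) *\<^sub>R e)) \<partial>lborel)"
proof -
  have ee: "e \<bullet> e = 1" using e by (simp add: dot_square_norm)
  define g where "g y = f ((y \<bullet> e) *\<^sub>R e + r *\<^sub>R (y - (y \<bullet> e) *\<^sub>R e))" for y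
  have [measurable]: "g \<in> borel_measurable borel" unfolding g_def by measurable
  have "(\<integral>\<^sup>+x. g x \<partial>lborel) = (\<integral>\<^sup>+x. ennreal r * f (r *\<^sub>R x) \<partial>lborel)"
  proof -
    have "(\<integral>\<^sup>+t. g (x - (x \<bullet> e) *\<^sub>R e + t *\<^sub>R e) \<partial>lborel)
        = (\<integral>\<^sup>+t. ennreal r * f (r *\<^sub>R (x - (x \<bullet> e) *\<^sub>R e + t *\<^sub>R e)) \<partial>lborel)" for x
    proof -
      define z where "z = x - (x \<bullet> e) *\<^sub>R e"
      have ze: "z \<bullet> e = 0" by (simp add: z_def inner_diff_left ee)
      have "(\<integral>\<^sup>+t. g (z + t *\<^sub>R e) \<partial>lborel) = (\<integral>\<^sup>+t. f (r *\<^sub>R z + t *\<^sub>R e) \<partial>lborel)"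
        by (simp add: g_def inner_add_left ze ee add.commute)
      also have "\<dots> = ennreal r * (\<integral>\<^sup>+t. f (r *\<^sub>R z + (r * t) *\<^sub>R e) \<partial>lborel)"
        by (rule nn_integral_lborel_scale_real[OF _ r]) measurable
      also have "\<dots> = (\<integral>\<^sup>+t. ennreal r * f (r *\<^sub>R (z + t *\<^sub>R e)) \<partial>lborel)"
        by (simp add: nn_integral_cmult scaleR_add_right)
      finally show ?thesis by (simp add: z_def)
    qed
    then show ?thesis by (subst (1 2) nn_integral_lborel_lines[OF _ e]) simp_all
  qed
  then have "(\<integral>\<^sup>+x. g x \<partial>lborel) = ennreal r * (\<integral>\<^sup>+x. f (r *\<^sub>R x) \<partial>lborel)"
    by (simp add: nn_integral_cmult)
  then have "ennreal (r ^ (DIM('a) - 1)) * (\<integral>\<^sup>+x. g x \<partial>lborel)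
     = ennreal (r ^ (DIM('a) - 1) * r) * (\<integral>\<^sup>+x. f (r *\<^sub>R x) \<partial>lborel)"
    using r by (simp add: ennreal_mult' mult.assoc)
  also have "r ^ (DIM('a) - 1) * r = r ^ DIM('a)"
    by (metis DIM_positive power_minus_mult)
  also have "ennreal (r ^ DIM('a)) * (\<integral>\<^sup>+x. f (r *\<^sub>R x) \<partial>lborel) = (\<integral>\<^sup>+x. f x \<partial>lborel)"
    using nn_integral_lborel_scale[of f r] r by simp
  finally show ?thesis unfolding g_def by simp
qed

text \<open>Averaging over the scale \<open>t \<in> (1, 2)\<close> and exchanging the integrals replaces polar coordinates.\<close>
lemma nn_integral_lborel_radial:
  fixes G :: "'a::euclidean_space \<Rightarrow> ennreal" and h :: "'a \<Rightarrow> real"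
  assumes [measurable]: "G \<in> borel_measurable borel" "h \<in> borel_measurable borel"
    and G: "\<And>c x. c > 0 \<Longrightarrow> G (c *\<^sub>R x) = G x" and h: "\<And>c x. c > 0 \<Longrightarrow> h (c *\<^sub>R x) = h x"
    and h_pos: "\<And>x. h x > 0"
  shows "(\<integral>\<^sup>+x. G x * indicator {..<h x} (norm x) \<partial>lborel)
    = (\<integral>\<^sup>+x. G x * ennreal (h x ^ DIM('a)) * indicator {..<1} (norm x) \<partial>lborel)"
proof -
  define d where "d = DIM('a)"
  define H where "H x = G x * indicator {..<h x} (norm x)" for x
  have [measurable]: "H \<in> borel_measurable borel"
    unfolding H_def indicator_def lessThan_iff by measurable
  have unit: "(\<integral>\<^sup>+t. indicator {1<..<2::real} t \<partial>lborel) = 1" by simp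
  have "(\<integral>\<^sup>+x. H x \<partial>lborel) = (\<integral>\<^sup>+t. indicator {1<..<2::real} t * (\<integral>\<^sup>+x. H x \<partial>lborel) \<partial>lborel)"
    by (simp add: nn_integral_multc)
  also have "\<dots> = (\<integral>\<^sup>+t. \<integral>\<^sup>+x. indicator {1<..<2::real} t * ennreal (t ^ d) * H (t *\<^sub>R x) \<partial>lborel \<partial>lborel)"
  proof (rule nn_integral_cong)
    fix t :: real
    show "indicator {1<..<2} t * (\<integral>\<^sup>+x. H x \<partial>lborel)
       = (\<integral>\<^sup>+x. indicator {1<..<2} t * ennreal (t ^ d) * H (t *\<^sub>R x) \<partial>lborel)"
      using nn_integral_lborel_scale[of H t]
      by (cases "t \<in> {1<..<2}") (auto simp: nn_integral_cmult d_def)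
  qed
  also have "\<dots> = (\<integral>\<^sup>+x. \<integral>\<^sup>+t. indicator {1<..<2::real} t * ennreal (t ^ d) * H (t *\<^sub>R x) \<partial>lborel \<partial>lborel)"
    by (rule lborel_pair.Fubini') simp
  \<comment> \<open>On the ray through \<open>x\<close> put t = h(x) s. As \<open>G\<close> and
    \<open>h\<close> are constant along rays, the condition |t x| < h(x) becomes |s x| < 1, and t^d
    dt yields the power d + 1 of \<open>h x\<close>.\<close>
  also have "\<dots> = (\<integral>\<^sup>+x. \<integral>\<^sup>+s. G x * ennreal (h x ^ (d + 1)) * (indicator {1<..<2::real} (h x * s)
       * ennreal (s ^ d) * indicator {..<1} (norm (s *\<^sub>R x))) \<partial>lborel \<partial>lborel)"
  proof (rule nn_integral_cong)
    fix x :: 'a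
    have "(\<integral>\<^sup>+t. indicator {1<..<2::real} t * ennreal (t ^ d) * H (t *\<^sub>R x) \<partial>lborel)
       = (\<integral>\<^sup>+s. ennreal (h x) * (indicator {1<..<2::real} (h x * s) * ennreal ((h x * s) ^ d) * H ((h x * s) *\<^sub>R x)) \<partial>lborel)"
      by (subst nn_integral_lborel_scale_real[OF _ h_pos[of x]]) (simp_all add: nn_integral_cmult)
    also have "\<dots> = (\<integral>\<^sup>+s. G x * ennreal (h x ^ (d + 1)) * (indicator {1<..<2::real} (h x * s)
       * ennreal (s ^ d) * indicator {..<1} (norm (s *\<^sub>R x))) \<partial>lborel)"
    proof (rule nn_integral_cong)
      fix s :: real
      show "ennreal (h x) * (indicator {1<..<2::real} (h x * s) * ennreal ((h x * s) ^ d) * H ((h x * s) *\<^sub>R x))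
        = G x * ennreal (h x ^ (d + 1)) * (indicator {1<..<2::real} (h x * s)
       * ennreal (s ^ d) * indicator {..<1} (norm (s *\<^sub>R x)))"
      proof (cases "h x * s \<in> {1<..<2}")
        case True
        then have hs: "h x * s > 0" by simp
        then have s: "s > 0" using h_pos[of x] by (simp add: zero_less_mult_iff)
        have "indicator {..<h x} (norm ((h x * s) *\<^sub>R x)) = (indicator {..<1} (norm (s *\<^sub>R x)) :: ennreal)"
          using h_pos[of x] s by (simp add: indicator_def abs_mult)
        then show ?thesis
          using h_pos[of x] s True by (simp add: H_def G h power_mult_distrib ennreal_mult mult_ac)
      qed simp
    qed
    finally show "(\<integral>\<^sup>+t. indicator {1<..<2::real} t * ennreal (t ^ d) * H (t *\<^sub>R x) \<partial>lborel)
       = (\<integral>\<^sup>+s. G x * ennreal (h x ^ (d + 1)) * (indicator {1<..<2::real} (h x * s)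
       * ennreal (s ^ d) * indicator {..<1} (norm (s *\<^sub>R x))) \<partial>lborel)" .
  qed
  also have "\<dots> = (\<integral>\<^sup>+s. \<integral>\<^sup>+x. G x * ennreal (h x ^ (d + 1)) * (indicator {1<..<2::real} (h x * s)
       * ennreal (s ^ d) * indicator {..<1} (norm (s *\<^sub>R x))) \<partial>lborel \<partial>lborel)"
    by (rule lborel_pair.Fubini'[symmetric]) (simp add: indicator_def)
  \<comment> \<open>Dilating \<open>x\<close> by \<open>s\<close> absorbs s^d; afterwards
    \<open>s\<close> occurs only in the window 1 < h(x) s < 2.\<close>
  also have "\<dots> = (\<integral>\<^sup>+s. \<integral>\<^sup>+x. G x * ennreal (h x ^ (d + 1)) * indicator {1<..<2::real} (h x * s)
       * indicator {..<1} (norm x) \<partial>lborel \<partial>lborel)"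
  proof (rule nn_integral_cong)
    fix s :: real
    show "(\<integral>\<^sup>+x. G x * ennreal (h x ^ (d + 1)) * (indicator {1<..<2::real} (h x * s)
       * ennreal (s ^ d) * indicator {..<1} (norm (s *\<^sub>R x))) \<partial>lborel)
       = (\<integral>\<^sup>+x. G x * ennreal (h x ^ (d + 1)) * indicator {1<..<2::real} (h x * s)
       * indicator {..<1} (norm x) \<partial>lborel)" (is "?L = ?R")
    proof (cases "s > 0")
      case True
      have "?R = ennreal (s ^ d) * (\<integral>\<^sup>+x. G x * ennreal (h x ^ (d + 1)) * indicator {1<..<2::real} (h x * s)
         * indicator {..<1} (norm (s *\<^sub>R x)) \<partial>lborel)"
        using True by (subst nn_integral_lborel_scale[of _ s]) (simp_all add: G h d_def indicator_def)
      also have "\<dots> = ?L"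
        by (subst nn_integral_cmult[symmetric]) (auto simp: indicator_def mult_ac intro!: nn_integral_cong)
      finally show ?thesis by simp
    next
      case False
      then have "h x * s \<le> 0" for x using h_pos[of x] by (simp add: mult_le_0_iff)
      then have "indicator {1<..<2::real} (h x * s) = (0::ennreal)" for x
        by (smt (verit) greaterThanLessThan_iff indicator_simps(2))
      then show ?thesis by simp
    qed
  qed
  also have "\<dots> = (\<integral>\<^sup>+x. \<integral>\<^sup>+s. G x * ennreal (h x ^ (d + 1)) * indicator {1<..<2::real} (h x * s)
       * indicator {..<1} (norm x) \<partial>lborel \<partial>lborel)"
    by (rule lborel_pair.Fubini') (simp add: indicator_def)
  also have "\<dots> = (\<integral>\<^sup>+x. G x * ennreal (h x ^ d) * indicator {..<1} (norm x) \<partial>lborel)"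
  proof (rule nn_integral_cong)
    fix x :: 'a
    have "(\<integral>\<^sup>+s. G x * ennreal (h x ^ (d + 1)) * indicator {1<..<2::real} (h x * s)
       * indicator {..<1} (norm x) \<partial>lborel)
       = G x * ennreal (h x ^ d) * indicator {..<1} (norm x) * (ennreal (h x) * (\<integral>\<^sup>+s. indicator {1<..<2::real} (h x * s) \<partial>lborel))"
      using h_pos[of x]
      by (simp add: ennreal_mult mult_ac flip: nn_integral_cmult)
    \<comment> \<open>The window has length 1 / \<open>h x\<close>, which brings the exponent d + 1
      down to d.\<close>
    also have "ennreal (h x) * (\<integral>\<^sup>+s. indicator {1<..<2::real} (h x * s) \<partial>lborel) = 1"
      using nn_integral_lborel_scale_real[OF _ h_pos[of x], of "indicator {1<..<2}"] by simp
    finally show "(\<integral>\<^sup>+s. G x * ennreal (h x ^ (d + 1)) * indicator {1<..<2::real} (h x * s)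
       * indicator {..<1} (norm x) \<partial>lborel) = G x * ennreal (h x ^ d) * indicator {..<1} (norm x)" by simp
  qed
  finally show ?thesis by (simp add: H_def d_def)
qed

section \<open>The surface measure of the sphere\<close>

lemma space_sphere_measure: "space (sphere_measure :: (real^'n) measure) = sphere 0 1"
  by (simp add: sphere_measure_def space_scale_measure space_restrict_space)

lemma sets_sphere_measure [measurable_cong]:
  "sets (sphere_measure :: (real^'n) measure) = sets (restrict_space borel (sphere 0 1))"
  by (simp add: sphere_measure_def)

lemma borel_measurable_sgn_vec [measurable]: "sgn \<in> borel_measurable (borel :: (real^'n) measure)"
  unfolding sgn_div_norm[abs_def] by measurable

lemma sgn_measurable_sphere:
  "sgn \<in> restrict_space lborel (ball 0 1 - {0}) \<rightarrow>\<^sub>M restrict_space borel (sphere 0 1 :: (real^'n) set)"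
proof (rule measurable_restrict_space2)
  show "sgn \<in> space (restrict_space lborel (ball 0 1 - {0})) \<rightarrow> (sphere 0 1 :: (real^'n) set)"
    by (auto simp: space_restrict_space norm_sgn)
  show "sgn \<in> borel_measurable (restrict_space lborel (ball 0 1 - {0} :: (real^'n) set))"
    by (rule measurable_restrict_space1) measurable
qed

lemma measurable_ident_sphere: "(\<lambda>x. x) \<in> (sphere_measure :: (real^'n) measure) \<rightarrow>\<^sub>M borel"
  unfolding measurable_cong_sets[OF sets_sphere_measure refl] by (rule measurable_restrict_space1) simp

lemma measurable_sphere_measure:
  "F \<in> borel_measurable borel \<Longrightarrow> F \<in> borel_measurable (sphere_measure :: (real^'n) measure)"
  using measurable_compose[OF measurable_ident_sphere] by blast

lemma measurable_sphere_lborel: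
  fixes F :: "(real^'n) \<times> (real^'n) \<Rightarrow> 'b::topological_space"
  assumes "F \<in> borel_measurable borel"
  shows "F \<in> borel_measurable (sphere_measure \<Otimes>\<^sub>M lborel)"
proof -
  have "(\<lambda>x. x) \<in> (sphere_measure :: (real^'n) measure) \<Otimes>\<^sub>M (lborel :: (real^'n) measure) \<rightarrow>\<^sub>M borel \<Otimes>\<^sub>M borel"
    by (rule measurable_pair) (auto simp: comp_def intro!: measurable_compose[OF measurable_fst measurable_ident_sphere])
  then have "(\<lambda>x. x) \<in> (sphere_measure :: (real^'n) measure) \<Otimes>\<^sub>M (lborel :: (real^'n) measure) \<rightarrow>\<^sub>M borel"
    by (simp add: borel_prod)
  from measurable_compose[OF this assms] show ?thesis by simp
qed

text \<open>The puncture of the ball is a null set, and functions of \<open>sgn x\<close> are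
  constant along rays. In this form \<open>nn_integral_lborel_radial\<close> applies to spherical
  integrals.\<close>

lemma nn_integral_sphere_measure:
  fixes F :: "real^'n \<Rightarrow> ennreal"
  assumes [measurable]: "F \<in> borel_measurable borel"
  shows "(\<integral>\<^sup>+\<sigma>. F \<sigma> \<partial>sphere_measure)
    = ennreal (real CARD('n)) * (\<integral>\<^sup>+x. F (sgn x) * indicator {..<1} (norm x) \<partial>lborel)"
proof -
  have [measurable]: "F \<in> borel_measurable (restrict_space borel (sphere 0 1))"
    by (rule measurable_restrict_space1) simp
  have "(\<integral>\<^sup>+\<sigma>. F \<sigma> \<partial>sphere_measure)
    = ennreal (real CARD('n)) * (\<integral>\<^sup>+x. F (sgn x) * indicator (ball 0 1 - {0}) x \<partial>lborel)"
    unfolding sphere_measure_def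
    by (simp add: nn_integral_scale_measure nn_integral_distr[OF sgn_measurable_sphere] nn_integral_restrict_space)
  also have "(\<integral>\<^sup>+x. F (sgn x) * indicator (ball 0 1 - {0}) x \<partial>lborel)
    = (\<integral>\<^sup>+x. F (sgn x) * indicator {..<1} (norm x) \<partial>lborel)"
  proof (rule nn_integral_cong_AE)
    show "AE x in lborel. F (sgn x) * indicator (ball 0 1 - {0}) x = F (sgn x) * indicator {..<1} (norm x)"
      using AE_lborel_singleton[of "0 :: real^'n"] by eventually_elim (simp add: indicator_def)
  qed
  finally show ?thesis .
qed

lemma finite_measure_sphere: "finite_measure (sphere_measure :: (real^'n) measure)"
proof
  have "emeasure (sphere_measure :: (real^'n) measure) (space sphere_measure)
      = (\<integral>\<^sup>+\<sigma>. 1 \<partial>(sphere_measure :: (real^'n) measure))" by simp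
  also have "\<dots> = ennreal (real CARD('n)) * (\<integral>\<^sup>+x. indicator {..<1} (norm (x :: real^'n)) \<partial>lborel)"
    by (subst nn_integral_sphere_measure) simp_all
  also have "(\<integral>\<^sup>+x. indicator {..<1} (norm (x :: real^'n)) \<partial>lborel) = emeasure lborel (ball (0 :: real^'n) 1)"
  proof -
    have "(indicator {..<1} (norm x) :: ennreal) = indicator (ball 0 1) x" for x :: "real^'n"
      by (simp add: indicator_def)
    then show ?thesis by simp
  qed
  finally have "emeasure (sphere_measure :: (real^'n) measure) (space sphere_measure)
      = ennreal (real CARD('n)) * emeasure lborel (ball (0 :: real^'n) 1)" .
  then show "emeasure (sphere_measure :: (real^'n) measure) (space sphere_measure) \<noteq> \<infinity>"
    using emeasure_lborel_ball_finite[of "0 :: real^'n" 1] by (auto simp: ennreal_mult_eq_top_iff)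
qed

lemma pair_sigma_finite_sphere_lborel:
  "pair_sigma_finite (sphere_measure :: (real^'n) measure) (lborel :: (real^'n) measure)"
  by (intro pair_sigma_finite.intro finite_measure.axioms(1)[OF finite_measure_sphere] sigma_finite_lborel)

section \<open>Reflection and bisection of angles on the sphere\<close>

lemma sgn_inner_eq: "sgn x \<bullet> e = (x \<bullet> e) / norm (x :: 'a::real_inner)"
  by (simp add: sgn_div_norm divide_inverse mult.commute)

text \<open>The reflection about the axis \<open>e\<close> is an isometry commuting with
  \<open>sgn\<close>, so its invariance passes from the ball to the sphere.\<close>

lemma nn_integral_sphere_reflect:
  fixes F :: "real^'n \<Rightarrow> ennreal"
  assumes [measurable]: "F \<in> borel_measurable borel" and e: "norm e = 1"
  shows "(\<integral>\<^sup>+\<sigma>. F (2 *\<^sub>R (\<sigma> \<bullet> e) *\<^sub>R e - \<sigma>) \<partial>sphere_measure) = (\<integral>\<^sup>+\<sigma>. F \<sigma> \<partial>sphere_measure)"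
proof -
  define R where "R x = 2 *\<^sub>R (x \<bullet> e) *\<^sub>R e - x" for x :: "real^'n"
  have ee: "e \<bullet> e = 1" using e by (simp add: dot_square_norm)
  have [measurable]: "R \<in> borel_measurable borel" unfolding R_def by measurable
  have n: "norm (R x) = norm x" for x
    unfolding norm_eq_sqrt_inner R_def
    by (simp add: inner_diff_left inner_diff_right ee inner_commute algebra_simps)
  have s: "R (sgn x) = sgn (R x)" for x
    unfolding sgn_div_norm n by (simp add: R_def scaleR_diff_right mult.commute)
  have "(\<integral>\<^sup>+x. F (sgn x) * indicator {..<1} (norm x) \<partial>lborel)
     = (\<integral>\<^sup>+x. F (sgn (R x)) * indicator {..<1} (norm (R x)) \<partial>lborel)"
    unfolding R_def by (rule nn_integral_lborel_reflect[OF _ e, symmetric]) (simp add: indicator_def)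
  then show ?thesis
    unfolding R_def[symmetric] by (simp add: nn_integral_sphere_measure n s)
qed

text \<open>Here x is the midpoint of u and |u| e, hence lies on the bisector of the angle between u
  and \<open>e\<close>. The second identity is the double-angle formula for the cosine.\<close>

lemma bisector_inverse:
  fixes x e :: "'a::real_inner"
  assumes e: "norm e = 1" and x: "x \<bullet> e > 0"
  defines "u \<equiv> 2 *\<^sub>R x - ((norm x)\<^sup>2 / (x \<bullet> e)) *\<^sub>R e"
  shows norm_bisector_inverse: "norm u = (norm x)\<^sup>2 / (x \<bullet> e)"
    and sgn_bisector_inverse: "sgn u \<bullet> e = 2 * (sgn x \<bullet> e)\<^sup>2 - 1"
proof -
  have ee: "e \<bullet> e = 1" using e by (simp add: dot_square_norm)
  have n: "norm x > 0" using x by auto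
  have "(norm u)\<^sup>2 = ((norm x)\<^sup>2 / (x \<bullet> e))\<^sup>2"
    unfolding u_def power2_norm_eq_inner using x
    by (simp add: inner_diff_left inner_diff_right ee inner_commute field_simps power2_eq_square)
  then show nu: "norm u = (norm x)\<^sup>2 / (x \<bullet> e)"
    by (rule power2_eq_imp_eq) (use x in simp_all)
  have "u \<bullet> e = 2 * (x \<bullet> e) - (norm x)\<^sup>2 / (x \<bullet> e)" by (simp add: u_def inner_diff_left ee)
  moreover have "(2 * a - n\<^sup>2 / a) / (n\<^sup>2 / a) = 2 * (a / n)\<^sup>2 - 1" if "a > 0" "n > 0" for a n :: real
    using that by (simp add: field_simps power2_eq_square)
  ultimately show "sgn u \<bullet> e = 2 * (sgn x \<bullet> e)\<^sup>2 - 1" using x n by (simp add: sgn_inner_eq nu)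
qed

text \<open>With \<open>p = cos \<alpha>\<close> the argument \<open>2 p\<^sup>2 - 1\<close> is \<open>cos (2 \<alpha>)\<close>: the deviation angle
  is twice the angle to the bisector.\<close>
lemma nn_integral_sphere_double_angle:
  fixes K :: "real \<Rightarrow> ennreal" and e :: "real^'n"
  assumes [measurable]: "K \<in> borel_measurable borel" and e: "norm e = 1" and d: "2 \<le> CARD('n)"
  shows "(\<integral>\<^sup>+\<sigma>. K (\<sigma> \<bullet> e) \<partial>sphere_measure)
    = (\<integral>\<^sup>+\<sigma>. indicator {0<..} (\<sigma> \<bullet> e) * ennreal (2 ^ (CARD('n) - 1) * (\<sigma> \<bullet> e) ^ (CARD('n) - 2))
        * K (2 * (\<sigma> \<bullet> e)\<^sup>2 - 1) \<partial>sphere_measure)"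
proof -
  have ee: "e \<bullet> e = 1" using e by (simp add: dot_square_norm)
  \<comment> \<open>The ball |u| < 1 becomes the region |x| < \<open>sgn x \<bullet> e\<close>. The
    value 1 elsewhere only keeps \<open>h\<close> positive, since \<open>G\<close> vanishes
    there.\<close>
  define h where "h x = (if x \<bullet> e > 0 then sgn x \<bullet> e else 1)" for x :: "real^'n"
  define G where "G x = indicator {0<..} (x \<bullet> e) * ennreal (2 ^ (CARD('n) - 1) / (sgn x \<bullet> e)\<^sup>2)
      * K (2 * (sgn x \<bullet> e)\<^sup>2 - 1)" for x :: "real^'n"
  have [measurable]: "h \<in> borel_measurable borel" "G \<in> borel_measurable borel"
    unfolding h_def G_def by measurable
  have sgn_pos: "sgn x \<bullet> e > 0 \<longleftrightarrow> x \<bullet> e > 0" for x :: "real^'n"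
    by (cases "x = 0") (simp_all add: sgn_div_norm zero_less_mult_iff)
  have "(\<integral>\<^sup>+x. K (sgn x \<bullet> e) * indicator {..<1} (norm x) \<partial>lborel)
    = (\<integral>\<^sup>+x. G x * indicator {..<h x} (norm x) \<partial>lborel)"
  proof (subst nn_integral_lborel_halfspace[OF _ e], goal_cases)
    case 3
    show ?case
    proof (rule nn_integral_cong)
      fix x :: "real^'n"
      define u where "u = 2 *\<^sub>R x - ((norm x)\<^sup>2 / (x \<bullet> e)) *\<^sub>R e"
      show "indicator {0<..} (x \<bullet> e) * ennreal (2 ^ (DIM(real^'n) - 1) * (norm x)\<^sup>2 / (x \<bullet> e)\<^sup>2) *
         (K (sgn u \<bullet> e) * indicator {..<1} (norm u)) = G x * indicator {..<h x} (norm x)"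
      proof (cases "x \<bullet> e > 0")
        case True
        then have x: "norm x > 0" by auto
        note nu = norm_bisector_inverse[OF e True, folded u_def]
        have hx: "h x = (x \<bullet> e) / norm x" using True by (simp add: h_def sgn_inner_eq)
        note 1 = sgn_bisector_inverse[OF e True, folded u_def]
        have 2: "indicator {..<1} (norm u) = (indicator {..<h x} (norm x) :: ennreal)"
        proof -
          have "n\<^sup>2 / a < 1 \<longleftrightarrow> n < a / n" if "a > 0" "n > 0" for a n :: real
            using that by (simp add: field_simps power2_eq_square)
          then show ?thesis unfolding hx nu using True x by (simp add: indicator_def)
        qed
        have 3: "2 ^ (DIM(real^'n) - 1) * (norm x)\<^sup>2 / (x \<bullet> e)\<^sup>2 = 2 ^ (CARD('n) - 1) / (sgn x \<bullet> e)\<^sup>2"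
          using True x by (simp add: sgn_inner_eq power_divide)
        show ?thesis unfolding 1 2 3 G_def by (simp add: mult_ac)
      qed (simp add: G_def)
    qed
  qed (use d in \<open>simp_all add: indicator_def\<close>)
  also have "\<dots> = (\<integral>\<^sup>+x. G x * ennreal (h x ^ DIM(real^'n)) * indicator {..<1} (norm x) \<partial>lborel)"
  proof (rule nn_integral_lborel_radial)
    show "h x > 0" for x using sgn_pos[of x] by (simp add: h_def)
  qed (auto simp: G_def h_def sgn_scaleR zero_less_mult_iff indicator_def)
  \<comment> \<open>The power p^d of the radius and the p^(-2) of the Jacobian combine to
    p^(d-2).\<close>
  also have "\<dots> = (\<integral>\<^sup>+x. indicator {0<..} (sgn x \<bullet> e) * ennreal (2 ^ (CARD('n) - 1) * (sgn x \<bullet> e) ^ (CARD('n) - 2))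
        * K (2 * (sgn x \<bullet> e)\<^sup>2 - 1) * indicator {..<1} (norm x) \<partial>lborel)"
  proof (rule nn_integral_cong)
    fix x :: "real^'n"
    show "G x * ennreal (h x ^ DIM(real^'n)) * indicator {..<1} (norm x)
      = indicator {0<..} (sgn x \<bullet> e) * ennreal (2 ^ (CARD('n) - 1) * (sgn x \<bullet> e) ^ (CARD('n) - 2))
        * K (2 * (sgn x \<bullet> e)\<^sup>2 - 1) * indicator {..<1} (norm x)"
    proof (cases "x \<bullet> e > 0")
      case True
      define p where "p = sgn x \<bullet> e"
      have p: "p > 0" using True sgn_pos[of x] by (simp add: p_def)
      have "p ^ CARD('n) = p ^ (CARD('n) - 2) * p\<^sup>2"
        using d by (metis le_add_diff_inverse2 power_add)
      then have "ennreal (2 ^ (CARD('n) - 1) / p\<^sup>2) * ennreal (p ^ CARD('n)) = ennreal (2 ^ (CARD('n) - 1) * p ^ (CARD('n) - 2))"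
        using p by (subst ennreal_mult'[symmetric]) simp_all
      moreover have "G x * ennreal (h x ^ DIM(real^'n)) * indicator {..<1} (norm x)
        = ennreal (2 ^ (CARD('n) - 1) / p\<^sup>2) * ennreal (p ^ CARD('n)) * (K (2 * p\<^sup>2 - 1) * indicator {..<1} (norm x))"
        using True p by (simp add: G_def h_def p_def[symmetric] mult_ac)
      ultimately show ?thesis
        using p by (simp add: p_def[symmetric] mult_ac)
    qed (use sgn_pos[of x] in \<open>simp add: G_def\<close>)
  qed
  finally show ?thesis
    by (simp add: nn_integral_sphere_measure)
qed

section \<open>Zonal integrals in the tangent of the angle\<close>

text \<open>The half ball and the slab 0 < x . e < 1 both consist of initial pieces of the rays of
  the half-space; the piece in the slab has length 1/p, which the factor p^d compensates. In the
  slab the component along \<open>e\<close> and the orthogonal one can be rescaled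
  independently.\<close>

lemma nn_integral_sphere_slab:
  fixes Z :: "real \<Rightarrow> ennreal" and e :: "real^'n"
  assumes [measurable]: "Z \<in> borel_measurable borel" and e: "norm e = 1"
  shows "(\<integral>\<^sup>+\<sigma>. indicator {0<..} (\<sigma> \<bullet> e) * Z (\<sigma> \<bullet> e) \<partial>sphere_measure)
    = ennreal (real CARD('n)) * (\<integral>\<^sup>+x. indicator {0<..<1} (x \<bullet> e) * Z (sgn x \<bullet> e) * ennreal ((sgn x \<bullet> e) ^ CARD('n)) \<partial>lborel)"
proof -
  define h where "h x = (if x \<bullet> e > 0 then 1 / (sgn x \<bullet> e) else 1)" for x :: "real^'n"
  define G where "G x = indicator {0<..} (x \<bullet> e) * Z (sgn x \<bullet> e) * ennreal ((sgn x \<bullet> e) ^ CARD('n))" for x :: "real^'n"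
  have [measurable]: "h \<in> borel_measurable borel" "G \<in> borel_measurable borel"
    unfolding h_def G_def by measurable
  have sgn_pos: "sgn x \<bullet> e > 0 \<longleftrightarrow> x \<bullet> e > 0" for x :: "real^'n"
    by (cases "x = 0") (simp_all add: sgn_div_norm zero_less_mult_iff)
  have "(\<integral>\<^sup>+x. indicator {0<..<1} (x \<bullet> e) * Z (sgn x \<bullet> e) * ennreal ((sgn x \<bullet> e) ^ CARD('n)) \<partial>lborel)
     = (\<integral>\<^sup>+x. G x * indicator {..<h x} (norm x) \<partial>lborel)"
  proof (rule nn_integral_cong)
    fix x :: "real^'n"
    have "indicator {0<..<1} (x \<bullet> e) = (indicator {0<..} (x \<bullet> e) * indicator {..<h x} (norm x) :: ennreal)"
    proof (cases "x \<bullet> e > 0")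
      case True
      then have "norm x > 0" by auto
      then show ?thesis using True by (auto simp: indicator_def h_def sgn_inner_eq field_simps)
    qed simp
    then show "indicator {0<..<1} (x \<bullet> e) * Z (sgn x \<bullet> e) * ennreal ((sgn x \<bullet> e) ^ CARD('n)) = G x * indicator {..<h x} (norm x)"
      by (simp add: G_def mult_ac)
  qed
  also have "\<dots> = (\<integral>\<^sup>+x. G x * ennreal (h x ^ DIM(real^'n)) * indicator {..<1} (norm x) \<partial>lborel)"
  proof (rule nn_integral_lborel_radial)
    show "h x > 0" for x using sgn_pos[of x] by (simp add: h_def)
  qed (auto simp: G_def h_def sgn_scaleR zero_less_mult_iff indicator_def)
  also have "\<dots> = (\<integral>\<^sup>+x. indicator {0<..} (sgn x \<bullet> e) * Z (sgn x \<bullet> e) * indicator {..<1} (norm x) \<partial>lborel)"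
  proof (rule nn_integral_cong)
    fix x :: "real^'n"
    show "G x * ennreal (h x ^ DIM(real^'n)) * indicator {..<1} (norm x)
      = indicator {0<..} (sgn x \<bullet> e) * Z (sgn x \<bullet> e) * indicator {..<1} (norm x)"
    proof (cases "x \<bullet> e > 0")
      case True
      define p where "p = sgn x \<bullet> e"
      have p: "p > 0" using True sgn_pos[of x] by (simp add: p_def)
      have "ennreal (p ^ CARD('n)) * ennreal ((1 / p) ^ CARD('n)) = 1"
        using p by (subst ennreal_mult'[symmetric]) (simp_all add: power_one_over)
      then show ?thesis
        using True p by (simp add: G_def h_def p_def[symmetric] mult_ac)
    qed (use sgn_pos[of x] in \<open>simp add: G_def\<close>)
  qed
  finally show ?thesis
    by (simp add: nn_integral_sphere_measure)
qed


text \<open>The same averaging trick, now with dilations of the hyperplane orthogonal to \<open>e\<close>.\<close>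
lemma nn_integral_slab_zonal:
  fixes M :: "real \<Rightarrow> ennreal" and e :: "'a::euclidean_space"
  assumes [measurable]: "M \<in> borel_measurable borel" and e: "norm e = 1" and d: "2 \<le> DIM('a)"
  defines "\<rho> \<equiv> \<lambda>x. norm (x - (x \<bullet> e) *\<^sub>R e) / (x \<bullet> e)"
  shows "(\<integral>\<^sup>+x. indicator {0<..<1} (x \<bullet> e) * M (\<rho> x) \<partial>lborel)
    = (\<integral>\<^sup>+x. indicator {0<..<1} (x \<bullet> e) * indicator {1<..<2} (1 / \<rho> x) * ennreal ((1 / \<rho> x) ^ DIM('a)) \<partial>lborel)
      * (\<integral>\<^sup>+s. indicator {0<..} s * ennreal (s ^ (DIM('a) - 2)) * M s \<partial>lborel)"
proof -
  define D where "D = DIM('a) - 1"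
  have D: "DIM('a) = Suc D" "DIM('a) - 2 = D - 1" "D \<ge> 1" using d by (auto simp: D_def)
  have ee: "e \<bullet> e = 1" using e by (simp add: dot_square_norm)
  define V where "V x = (indicator {0<..<1} (x \<bullet> e) :: ennreal)" for x :: 'a
  have [measurable]: "\<rho> \<in> borel_measurable borel" "V \<in> borel_measurable borel"
    unfolding \<rho>_def V_def by measurable
  define T where "T r x = (x \<bullet> e) *\<^sub>R e + r *\<^sub>R (x - (x \<bullet> e) *\<^sub>R e)" for r x
  have Te: "T r x \<bullet> e = x \<bullet> e" for r x by (simp add: T_def inner_add_left inner_diff_left ee)
  have VT: "V (T r x) = V x" for r x by (simp add: V_def Te)
  have \<rho>T: "\<rho> (T r x) = r * \<rho> x" if "r > 0" for r x
    unfolding \<rho>_def Te using that by (simp add: T_def)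
  have dil: "(\<integral>\<^sup>+x. f x \<partial>lborel) = ennreal (r ^ D) * (\<integral>\<^sup>+x. f (T r x) \<partial>lborel)"
    if "f \<in> borel_measurable borel" "r > 0" for f :: "'a \<Rightarrow> ennreal" and r
    unfolding T_def D_def by (rule nn_integral_lborel_dilate_perp[OF that(1) e that(2)])
  have "(\<integral>\<^sup>+x. V x * M (\<rho> x) \<partial>lborel) = (\<integral>\<^sup>+t. indicator {1<..<2::real} t * (\<integral>\<^sup>+x. V x * M (\<rho> x) \<partial>lborel) \<partial>lborel)"
    by (simp add: nn_integral_multc)
  also have "\<dots> = (\<integral>\<^sup>+t. \<integral>\<^sup>+x. V x * (indicator {1<..<2::real} t * ennreal (t ^ D) * M (t * \<rho> x)) \<partial>lborel \<partial>lborel)"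
  proof (rule nn_integral_cong)
    fix t :: real
    show "indicator {1<..<2} t * (\<integral>\<^sup>+x. V x * M (\<rho> x) \<partial>lborel)
       = (\<integral>\<^sup>+x. V x * (indicator {1<..<2} t * ennreal (t ^ D) * M (t * \<rho> x)) \<partial>lborel)"
    proof (cases "t \<in> {1<..<2}")
      case True
      then show ?thesis
        using dil[of "\<lambda>x. V x * M (\<rho> x)" t]
        by (simp add: VT \<rho>T nn_integral_cmult[symmetric] mult_ac)
    qed simp
  qed
  also have "\<dots> = (\<integral>\<^sup>+x. \<integral>\<^sup>+t. V x * (indicator {1<..<2::real} t * ennreal (t ^ D) * M (t * \<rho> x)) \<partial>lborel \<partial>lborel)"
    by (rule lborel_pair.Fubini') simp
  \<comment> \<open>For fixed \<open>x\<close> the substitution s = t rho(x) frees the argument of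
    \<open>M\<close> from \<open>x\<close>. It needs rho(x) > 0, hence a point off the axis.\<close>
  also have "\<dots> = (\<integral>\<^sup>+x. \<integral>\<^sup>+s. V x * (ennreal (1 / \<rho> x) * (indicator {1<..<2::real} (s / \<rho> x) * ennreal ((s / \<rho> x) ^ D) * M s)) \<partial>lborel \<partial>lborel)"
  proof (rule nn_integral_cong_AE)
    show "AE x in lborel. (\<integral>\<^sup>+t. V x * (indicator {1<..<2::real} t * ennreal (t ^ D) * M (t * \<rho> x)) \<partial>lborel)
      = (\<integral>\<^sup>+s. V x * (ennreal (1 / \<rho> x) * (indicator {1<..<2::real} (s / \<rho> x) * ennreal ((s / \<rho> x) ^ D) * M s)) \<partial>lborel)"
      using AE_lborel_not_on_line[OF d, of e]
    proof eventually_elim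
      case (elim x)
      show ?case
      proof (cases "x \<bullet> e \<in> {0<..<1}")
        case True
        then have r: "\<rho> x > 0" using elim by (simp add: \<rho>_def)
        have "(\<integral>\<^sup>+t. indicator {1<..<2::real} t * ennreal (t ^ D) * M (t * \<rho> x) \<partial>lborel)
          = ennreal (1 / \<rho> x) * (\<integral>\<^sup>+s. indicator {1<..<2::real} (s / \<rho> x) * ennreal ((s / \<rho> x) ^ D) * M s \<partial>lborel)"
          using nn_integral_lborel_scale_real[of "\<lambda>t. indicator {1<..<2::real} t * ennreal (t ^ D) * M (t * \<rho> x)" "1 / \<rho> x"] r
          by simp
        then show ?thesis by (simp add: nn_integral_cmult)
      qed (simp add: V_def)
    qed
  qed
  also have "\<dots> = (\<integral>\<^sup>+s. \<integral>\<^sup>+x. V x * (ennreal (1 / \<rho> x) * (indicator {1<..<2::real} (s / \<rho> x) * ennreal ((s / \<rho> x) ^ D) * M s)) \<partial>lborel \<partial>lborel)"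
    by (rule lborel_pair.Fubini'[symmetric]) simp
  also have "\<dots> = (\<integral>\<^sup>+s. (\<integral>\<^sup>+x. V x * indicator {1<..<2} (1 / \<rho> x) * ennreal ((1 / \<rho> x) ^ DIM('a)) \<partial>lborel)
       * (indicator {0<..} s * ennreal (s ^ (DIM('a) - 2)) * M s) \<partial>lborel)"
  proof (rule nn_integral_cong)
    fix s :: real
    have \<rho>0: "V x = 0 \<or> \<rho> x \<ge> 0" for x by (auto simp: V_def \<rho>_def indicator_def)
    show "(\<integral>\<^sup>+x. V x * (ennreal (1 / \<rho> x) * (indicator {1<..<2::real} (s / \<rho> x) * ennreal ((s / \<rho> x) ^ D) * M s)) \<partial>lborel)
      = (\<integral>\<^sup>+x. V x * indicator {1<..<2} (1 / \<rho> x) * ennreal ((1 / \<rho> x) ^ DIM('a)) \<partial>lborel)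
       * (indicator {0<..} s * ennreal (s ^ (DIM('a) - 2)) * M s)" (is "?L = ?R")
    proof (cases "s > 0")
      case True
      have "?L = (\<integral>\<^sup>+x. V x * ennreal (1 / \<rho> x) * indicator {1<..<2::real} (s / \<rho> x) * ennreal ((s / \<rho> x) ^ D) \<partial>lborel) * M s"
        by (subst nn_integral_multc[symmetric]) (simp_all add: mult_ac)
      \<comment> \<open>Dilating by \<open>s\<close> orthogonally to \<open>e\<close> preserves the
        slab and multiplies \<open>\<rho>\<close> by \<open>s\<close>. The window becomes
        independent of \<open>s\<close>, and the double integral factorizes.\<close>
      also have "(\<integral>\<^sup>+x. V x * ennreal (1 / \<rho> x) * indicator {1<..<2::real} (s / \<rho> x) * ennreal ((s / \<rho> x) ^ D) \<partial>lborel)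
        = ennreal (s ^ D) * (\<integral>\<^sup>+x. V x * ennreal (1 / (s * \<rho> x)) * indicator {1<..<2::real} (1 / \<rho> x) * ennreal ((1 / \<rho> x) ^ D) \<partial>lborel)"
        by (subst dil[OF _ True]) (use True in \<open>simp_all add: VT \<rho>T\<close>)
      also have "\<dots> = (\<integral>\<^sup>+x. ennreal (s ^ D) * (V x * ennreal (1 / (s * \<rho> x)) * indicator {1<..<2::real} (1 / \<rho> x) * ennreal ((1 / \<rho> x) ^ D)) \<partial>lborel)"
        by (rule nn_integral_cmult[symmetric]) simp
      also have "\<dots> = (\<integral>\<^sup>+x. (V x * indicator {1<..<2} (1 / \<rho> x) * ennreal ((1 / \<rho> x) ^ DIM('a))) * ennreal (s ^ (DIM('a) - 2)) \<partial>lborel)"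
      proof (rule nn_integral_cong)
        fix x :: 'a
        have "ennreal (s ^ D) * (ennreal (1 / (s * r)) * ennreal ((1 / r) ^ D)) = ennreal ((1 / r) ^ DIM('a)) * ennreal (s ^ (DIM('a) - 2))"
          if "r \<ge> 0" for r
        proof -
          have "s ^ D = s * s ^ (DIM('a) - 2)" using D by (cases D) auto
          then have "s ^ D * (1 / (s * r) * (1 / r) ^ D) = (1 / r) ^ DIM('a) * s ^ (DIM('a) - 2)"
            using True by (simp add: D(1))
          then show ?thesis using that True by (simp add: ennreal_mult[symmetric])
        qed
        note key = this[of "\<rho> x"]
        show "ennreal (s ^ D) * (V x * ennreal (1 / (s * \<rho> x)) * indicator {1<..<2::real} (1 / \<rho> x) * ennreal ((1 / \<rho> x) ^ D))
          = (V x * indicator {1<..<2} (1 / \<rho> x) * ennreal ((1 / \<rho> x) ^ DIM('a))) * ennreal (s ^ (DIM('a) - 2))"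
          using \<rho>0[of x] key by (auto simp: indicator_def mult_ac)
      qed
      also have "\<dots> = (\<integral>\<^sup>+x. V x * indicator {1<..<2} (1 / \<rho> x) * ennreal ((1 / \<rho> x) ^ DIM('a)) \<partial>lborel) * ennreal (s ^ (DIM('a) - 2))"
        by (rule nn_integral_multc) simp
      finally show ?thesis using True by (simp add: mult.assoc)
    next
      case False
      have z: "V x * (ennreal (1 / \<rho> x) * (indicator {1<..<2::real} (s / \<rho> x) * ennreal ((s / \<rho> x) ^ D) * M s)) = 0" for x
      proof (cases "V x = 0")
        case Vx: False
        then have "s / \<rho> x \<le> 0" using \<rho>0[of x] False by (simp add: divide_le_0_iff)
        then show ?thesis by simp
      qed simp
      have "?L = (\<integral>\<^sup>+x. 0 \<partial>(lborel :: 'a measure))" by (rule nn_integral_cong) (rule z)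
      then show ?thesis using False by simp
    qed
  qed
  also have "\<dots> = (\<integral>\<^sup>+x. V x * indicator {1<..<2} (1 / \<rho> x) * ennreal ((1 / \<rho> x) ^ DIM('a)) \<partial>lborel)
       * (\<integral>\<^sup>+s. indicator {0<..} s * ennreal (s ^ (DIM('a) - 2)) * M s \<partial>lborel)"
    by (rule nn_integral_cmult) simp
  finally show ?thesis by (simp add: V_def)
qed

text \<open>If 1 / \<open>\<rho> x\<close> exceeds 1, the orthogonal component is shorter than x . e
  < 1, so \<open>x\<close> lies in the ball of radius 2. What matters is a finite bound independent
  of \<open>e\<close>.\<close>

lemma slab_zonal_constant_le:
  fixes e :: "'a::euclidean_space"
  assumes e: "norm e = 1"
  defines "\<rho> \<equiv> \<lambda>x. norm (x - (x \<bullet> e) *\<^sub>R e) / (x \<bullet> e)"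
  shows "(\<integral>\<^sup>+x. indicator {0<..<1} (x \<bullet> e) * indicator {1<..<2} (1 / \<rho> x) * ennreal ((1 / \<rho> x) ^ DIM('a)) \<partial>lborel)
     \<le> ennreal (2 ^ DIM('a) * measure lborel (ball (0::'a) 2))"
proof -
  have "(\<integral>\<^sup>+x. indicator {0<..<1} (x \<bullet> e) * indicator {1<..<2} (1 / \<rho> x) * ennreal ((1 / \<rho> x) ^ DIM('a)) \<partial>lborel)
    \<le> (\<integral>\<^sup>+x. ennreal (2 ^ DIM('a)) * indicator (ball (0::'a) 2) x \<partial>lborel)"
  proof (rule nn_integral_mono)
    fix x :: 'a
    show "indicator {0<..<1} (x \<bullet> e) * indicator {1<..<2} (1 / \<rho> x) * ennreal ((1 / \<rho> x) ^ DIM('a))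
      \<le> ennreal (2 ^ DIM('a)) * indicator (ball (0::'a) 2) x"
    proof (cases "x \<bullet> e \<in> {0<..<1} \<and> 1 / \<rho> x \<in> {1<..<2}")
      case True
      then have \<rho>0: "\<rho> x \<ge> 0" by (auto simp: \<rho>_def)
      have "\<rho> x < 1" using True by (auto simp: divide_simps split: if_splits)
      then have "norm (x - (x \<bullet> e) *\<^sub>R e) < x \<bullet> e" using True by (simp add: \<rho>_def)
      moreover have "norm x \<le> norm (x - (x \<bullet> e) *\<^sub>R e) + norm ((x \<bullet> e) *\<^sub>R e)"
        using norm_triangle_ineq[of "x - (x \<bullet> e) *\<^sub>R e" "(x \<bullet> e) *\<^sub>R e"] by simp
      ultimately have "x \<in> ball 0 2" using True e by simp
      moreover have "(1 / \<rho> x) ^ DIM('a) \<le> 2 ^ DIM('a)" using True \<rho>0 by (intro power_mono) auto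
      ultimately show ?thesis using True \<rho>0 by (auto simp: indicator_def intro!: ennreal_leI)
    qed (auto simp: indicator_def)
  qed
  also have "\<dots> = ennreal (2 ^ DIM('a) * measure lborel (ball (0::'a) 2))"
    using emeasure_lborel_ball_finite[of "0::'a" 2]
    by (subst nn_integral_cmult_indicator) (simp_all add: ennreal_mult emeasure_eq_ennreal_measure)
  finally show ?thesis .
qed


text \<open>Rescaling \<open>r\<close> extracts mu^(2s). The remaining integral of min(r^2, 1)
  r^(-1-2s) is split at 1: it converges at zero because s < 1 and at infinity because s > 0.\<close>

lemma nn_integral_min_powr_le:
  fixes \<mu> s :: real
  assumes s: "0 < s" "s < 1" and \<mu>: "\<mu> > 0"
  shows "(\<integral>\<^sup>+r. indicator {0<..} r * ennreal (min (\<mu>\<^sup>2 * r\<^sup>2) 1 * r powr (-1 - 2 * s)) \<partial>lborel)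
    \<le> ennreal ((1 / (2 - 2 * s) + 1 / (2 * s)) * \<mu> powr (2 * s))"
proof -
  define I where "I r = (if r \<in> {0..1} then r powr (1 - 2 * s) else 0) + (if r \<in> {1..} then r powr (-1 - 2 * s) else 0)" for r :: real
  have I: "(I has_integral (1 / (2 - 2 * s) + 1 / (2 * s))) UNIV"
    unfolding I_def
  proof (rule has_integral_add)
    show "((\<lambda>r. if r \<in> {0..1} then r powr (1 - 2 * s) else 0) has_integral 1 / (2 - 2 * s)) UNIV"
      using has_integral_powr_from_0[of "1 - 2 * s" 1] s
      by (subst has_integral_restrict_UNIV) simp
    show "((\<lambda>r. if r \<in> {1..} then r powr (-1 - 2 * s) else 0) has_integral 1 / (2 * s)) UNIV"
      using has_integral_powr_to_inf[of "-1 - 2 * s" 1] s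
      by (subst has_integral_restrict_UNIV) (simp add: divide_simps)
  qed
  have Im: "I \<in> borel_measurable borel" unfolding I_def by measurable
  have "(\<integral>\<^sup>+r. indicator {0<..} r * ennreal (min (\<mu>\<^sup>2 * r\<^sup>2) 1 * r powr (-1 - 2 * s)) \<partial>lborel)
    = ennreal (1 / \<mu>) * (\<integral>\<^sup>+r. indicator {0<..} r * ennreal (min (r\<^sup>2) 1 * (r / \<mu>) powr (-1 - 2 * s)) \<partial>lborel)"
    using \<mu> by (subst nn_integral_lborel_scale_real[of _ "1 / \<mu>"])
      (simp_all add: indicator_def zero_less_divide_iff power_divide)
  also have "\<dots> \<le> ennreal (1 / \<mu>) * (\<integral>\<^sup>+r. ennreal (\<mu> powr (1 + 2 * s)) * ennreal (I r) \<partial>lborel)"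
  proof (intro mult_left_mono nn_integral_mono)
    fix r :: real
    show "indicator {0<..} r * ennreal (min (r\<^sup>2) 1 * (r / \<mu>) powr (-1 - 2 * s)) \<le> ennreal (\<mu> powr (1 + 2 * s)) * ennreal (I r)"
    proof (cases "r > 0")
      case True
      have 1: "(r / \<mu>) powr (-1 - 2 * s) = \<mu> powr (1 + 2 * s) * r powr (-1 - 2 * s)"
        using True \<mu> by (simp add: powr_divide powr_minus_divide powr_diff powr_add field_simps)
      have "min (r\<^sup>2) 1 * r powr (-1 - 2 * s) \<le> I r"
      proof (cases "r \<le> 1")
        case r1: True
        have "r powr (1 - 2 * s) = r powr (2 + (-1 - 2 * s))" by simp
        also have "\<dots> = r\<^sup>2 * r powr (-1 - 2 * s)" using True by (subst powr_add) simp
        finally have e: "r\<^sup>2 * r powr (-1 - 2 * s) = r powr (1 - 2 * s)" ..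
        have "min (r\<^sup>2) 1 * r powr (-1 - 2 * s) \<le> r\<^sup>2 * r powr (-1 - 2 * s)"
          by (intro mult_right_mono) auto
        then show ?thesis using True r1 e by (simp add: I_def)
      next
        case False
        have "min (r\<^sup>2) 1 * r powr (-1 - 2 * s) \<le> 1 * r powr (-1 - 2 * s)"
          by (intro mult_right_mono) auto
        then show ?thesis using False by (simp add: I_def)
      qed
      then have "\<mu> powr (1 + 2 * s) * (min (r\<^sup>2) 1 * r powr (-1 - 2 * s)) \<le> \<mu> powr (1 + 2 * s) * I r"
        by (rule mult_left_mono) simp
      then have "ennreal (min (r\<^sup>2) 1 * (r / \<mu>) powr (-1 - 2 * s)) \<le> ennreal (\<mu> powr (1 + 2 * s) * I r)"
        unfolding 1 by (intro ennreal_leI) (simp add: mult_ac)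
      also have "\<dots> = ennreal (\<mu> powr (1 + 2 * s)) * ennreal (I r)" by (rule ennreal_mult') simp
      finally show ?thesis using True by simp
    qed simp
  qed simp
  also have "\<dots> = ennreal (1 / \<mu>) * (ennreal (\<mu> powr (1 + 2 * s)) * ennreal (1 / (2 - 2 * s) + 1 / (2 * s)))"
    using Im nn_integral_has_integral_lborel[OF Im _ I] by (simp add: nn_integral_cmult I_def)
  also have "\<dots> = ennreal ((1 / (2 - 2 * s) + 1 / (2 * s)) * \<mu> powr (2 * s))"
    using \<mu> s by (simp add: ennreal_mult'[symmetric] powr_add del: ennreal_plus)
  finally show ?thesis .
qed

text \<open>The factors are the normalization of \<open>sphere_measure\<close>, the bound of
  \<open>slab_zonal_constant_le\<close> and the radial integral of
  \<open>nn_integral_min_powr_le\<close>.\<close>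

definition angular_constant :: "'n::finite itself \<Rightarrow> real \<Rightarrow> real" where
  "angular_constant _ s = real CARD('n) * (2 ^ CARD('n) * measure lborel (ball (0::real^'n) 2))
     * (1 / (2 - 2 * s) + 1 / (2 * s))"

lemma angular_constant_nonneg: "0 < s \<Longrightarrow> s < 1 \<Longrightarrow> 0 \<le> angular_constant TYPE('n::finite) s"
  by (simp add: angular_constant_def)

text \<open>Let p be the cosine and r the tangent of the angle to \<open>e\<close>, so that 1 - p^2
  = (r p)^2. The powers p^(-(d-1+2s)), p^(2s-1) and the p^d of the slab multiply to 1. What remains,
  r^(-(d-1+2s)) together with the r^(d-2) of the zonal formula, is r^(-1-2s). The minimum with 1
  controls directions almost orthogonal to \<open>e\<close>, where r is unbounded.\<close>

lemma sphere_angular_bound: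
  fixes e :: "real^'n" and s \<mu> :: real
  assumes d: "2 \<le> CARD('n)" and s: "0 < s" "s < 1" and e: "norm e = 1" and \<mu>: "\<mu> > 0"
  shows "(\<integral>\<^sup>+\<sigma>. indicator {0<..} (\<sigma> \<bullet> e) * ennreal (min (\<mu>\<^sup>2 * ((1 - (\<sigma> \<bullet> e)\<^sup>2) / (\<sigma> \<bullet> e)\<^sup>2)) 1
        * (1 - (\<sigma> \<bullet> e)\<^sup>2) powr (- (real CARD('n) - 1 + 2 * s) / 2) * (\<sigma> \<bullet> e) powr (2 * s - 1)) \<partial>sphere_measure)
      \<le> ennreal (angular_constant TYPE('n) s * \<mu> powr (2 * s))"
proof -
  define a where "a = real CARD('n) - 1 + 2 * s"
  define C\<^sub>1 where "C\<^sub>1 = 2 ^ CARD('n) * measure lborel (ball (0::real^'n) 2)"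
  define C\<^sub>2 where "C\<^sub>2 = 1 / (2 - 2 * s) + 1 / (2 * s)"
  have nonneg: "C\<^sub>1 \<ge> 0" "C\<^sub>2 \<ge> 0" using s by (auto simp: C\<^sub>1_def C\<^sub>2_def)
  have ee: "e \<bullet> e = 1" using e by (simp add: dot_square_norm)
  define Z where "Z p = ennreal (min (\<mu>\<^sup>2 * ((1 - p\<^sup>2) / p\<^sup>2)) 1 * (1 - p\<^sup>2) powr (- a / 2) * p powr (2 * s - 1))" for p :: real
  define M where "M r = ennreal (min (\<mu>\<^sup>2 * r\<^sup>2) 1 * r powr (- a))" for r :: real
  define \<rho> where "\<rho> x = norm (x - (x \<bullet> e) *\<^sub>R e) / (x \<bullet> e)" for x
  have [measurable]: "Z \<in> borel_measurable borel" "M \<in> borel_measurable borel"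
    unfolding Z_def M_def by measurable
  have "(\<integral>\<^sup>+\<sigma>. indicator {0<..} (\<sigma> \<bullet> e) * Z (\<sigma> \<bullet> e) \<partial>sphere_measure)
    = ennreal (real CARD('n)) * (\<integral>\<^sup>+x. indicator {0<..<1} (x \<bullet> e) * Z (sgn x \<bullet> e) * ennreal ((sgn x \<bullet> e) ^ CARD('n)) \<partial>lborel)"
    by (rule nn_integral_sphere_slab[OF _ e]) simp
  also have "(\<integral>\<^sup>+x. indicator {0<..<1} (x \<bullet> e) * Z (sgn x \<bullet> e) * ennreal ((sgn x \<bullet> e) ^ CARD('n)) \<partial>lborel)
    = (\<integral>\<^sup>+x. indicator {0<..<1} (x \<bullet> e) * M (\<rho> x) \<partial>lborel)"
  proof (rule nn_integral_cong_AE)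
    have "2 \<le> DIM(real^'n)" using d by simp
    from AE_lborel_not_on_line[OF this, of e]
    show "AE x in lborel. indicator {0<..<1} (x \<bullet> e) * Z (sgn x \<bullet> e) * ennreal ((sgn x \<bullet> e) ^ CARD('n))
      = indicator {0<..<1} (x \<bullet> e) * M (\<rho> x)"
    proof eventually_elim
      case (elim x)
      show ?case
      proof (cases "x \<bullet> e \<in> {0<..<1}")
        case True
        define r where "r = \<rho> x"
        define p where "p = sgn x \<bullet> e"
        define y where "y = x - (x \<bullet> e) *\<^sub>R e"
        have t: "x \<bullet> e > 0" using True by simp
        then have nx: "norm x > 0" by auto
        have r: "r > 0" using elim t by (simp add: r_def \<rho>_def)
        have p: "p = (x \<bullet> e) / norm x" "p > 0" using t nx by (simp_all add: p_def sgn_inner_eq)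
        have "(norm y)\<^sup>2 = (norm x)\<^sup>2 - (x \<bullet> e)\<^sup>2"
          unfolding y_def power2_norm_eq_inner
          by (simp add: inner_diff_left inner_diff_right ee inner_commute power2_eq_square)
        moreover have "r * p = norm y / norm x" using t by (simp add: p r_def \<rho>_def y_def)
        ultimately have rp: "(r * p)\<^sup>2 = 1 - p\<^sup>2" using nx by (simp add: p power_divide diff_divide_distrib)
        have 1: "(1 - p\<^sup>2) / p\<^sup>2 = r\<^sup>2" using p(2) by (simp add: rp[symmetric] power_mult_distrib)
        have "(1 - p\<^sup>2) powr (- a / 2) = ((r * p) powr 2) powr (- a / 2)"
          using r p(2) by (simp add: rp[symmetric])
        also have "\<dots> = (r * p) powr (- a)" by (simp add: powr_powr)
        also have "\<dots> = r powr (- a) * p powr (- a)" using r p(2) by (simp add: powr_mult)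
        finally have 2: "(1 - p\<^sup>2) powr (- a / 2) = r powr (- a) * p powr (- a)" .
        have "p powr (- a) * p powr (2 * s - 1) * p ^ CARD('n) = p powr (- a + (2 * s - 1) + real CARD('n))"
          using p(2) by (simp only: powr_add powr_realpow)
        also have "\<dots> = 1" using p(2) by (simp add: a_def)
        finally have 3: "p powr (- a) * p powr (2 * s - 1) * p ^ CARD('n) = 1" .
        have "min (\<mu>\<^sup>2 * ((1 - p\<^sup>2) / p\<^sup>2)) 1 * (1 - p\<^sup>2) powr (- a / 2) * p powr (2 * s - 1) * p ^ CARD('n)
          = min (\<mu>\<^sup>2 * r\<^sup>2) 1 * r powr (- a) * (p powr (- a) * p powr (2 * s - 1) * p ^ CARD('n))"
          unfolding 1 2 by (simp add: mult_ac)
        also have "\<dots> = min (\<mu>\<^sup>2 * r\<^sup>2) 1 * r powr (- a)" unfolding 3 by simp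
        finally have "Z p * ennreal (p ^ CARD('n)) = M r"
          using p(2) unfolding Z_def M_def by (subst ennreal_mult''[symmetric]) auto
        then show ?thesis by (simp add: p_def r_def mult.assoc)
      qed simp
    qed
  qed
  also have "\<dots> \<le> ennreal C\<^sub>1 * ennreal (C\<^sub>2 * \<mu> powr (2 * s))"
  proof -
    have "(\<integral>\<^sup>+x. indicator {0<..<1} (x \<bullet> e) * M (\<rho> x) \<partial>lborel)
      = (\<integral>\<^sup>+x. indicator {0<..<1} (x \<bullet> e) * indicator {1<..<2} (1 / \<rho> x) * ennreal ((1 / \<rho> x) ^ DIM(real^'n)) \<partial>lborel)
      * (\<integral>\<^sup>+s. indicator {0<..} s * ennreal (s ^ (DIM(real^'n) - 2)) * M s \<partial>lborel)"
      unfolding \<rho>_def using d by (intro nn_integral_slab_zonal e) auto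
    also have "(\<integral>\<^sup>+s. indicator {0<..} s * ennreal (s ^ (DIM(real^'n) - 2)) * M s \<partial>lborel)
      = (\<integral>\<^sup>+r. indicator {0<..} r * ennreal (min (\<mu>\<^sup>2 * r\<^sup>2) 1 * r powr (-1 - 2 * s)) \<partial>lborel)"
    proof (rule nn_integral_cong)
      fix r :: real
      show "indicator {0<..} r * ennreal (r ^ (DIM(real^'n) - 2)) * M r
        = indicator {0<..} r * ennreal (min (\<mu>\<^sup>2 * r\<^sup>2) 1 * r powr (-1 - 2 * s))"
      proof (cases "r > 0")
        case True
        have "r ^ (CARD('n) - 2) * r powr (- a) = r powr (real (CARD('n) - 2) + (- a))"
          using True by (simp add: powr_add powr_realpow del: add_uminus_conv_diff)
        also have "real (CARD('n) - 2) + (- a) = -1 - 2 * s" using d by (simp add: a_def)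
        finally have "r ^ (CARD('n) - 2) * (min (\<mu>\<^sup>2 * r\<^sup>2) 1 * r powr (- a)) = min (\<mu>\<^sup>2 * r\<^sup>2) 1 * r powr (-1 - 2 * s)"
          by (simp add: mult_ac)
        then show ?thesis using True by (simp add: M_def ennreal_mult'[symmetric])
      qed simp
    qed
    also have "(\<integral>\<^sup>+x. indicator {0<..<1} (x \<bullet> e) * indicator {1<..<2} (1 / \<rho> x) * ennreal ((1 / \<rho> x) ^ DIM(real^'n)) \<partial>lborel) * \<dots>
      \<le> ennreal C\<^sub>1 * ennreal (C\<^sub>2 * \<mu> powr (2 * s))"
      using slab_zonal_constant_le[OF e] nn_integral_min_powr_le[OF s \<mu>]
      unfolding \<rho>_def C\<^sub>1_def C\<^sub>2_def by (intro mult_mono) simp_all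
    finally show ?thesis .
  qed
  finally have "(\<integral>\<^sup>+\<sigma>. indicator {0<..} (\<sigma> \<bullet> e) * Z (\<sigma> \<bullet> e) \<partial>sphere_measure)
      \<le> ennreal (real CARD('n)) * (ennreal C\<^sub>1 * ennreal (C\<^sub>2 * \<mu> powr (2 * s)))"
    by (simp add: mult_left_mono)
  also have "\<dots> = ennreal (real CARD('n) * C\<^sub>1 * C\<^sub>2 * \<mu> powr (2 * s))"
    using nonneg by (simp add: ennreal_mult'[symmetric] mult.assoc)
  finally show ?thesis by (simp add: Z_def a_def angular_constant_def C\<^sub>1_def C\<^sub>2_def)
qed

section \<open>Change of variables in the collision integral\<close>

lemma nn_integral_lborel_reflect_point:
  fixes f :: "'a::euclidean_space \<Rightarrow> ennreal"
  assumes [measurable]: "f \<in> borel_measurable borel"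
  shows "(\<integral>\<^sup>+w. f (v - w) \<partial>lborel) = (\<integral>\<^sup>+w. f w \<partial>lborel)"
  using nn_integral_lborel_scale[of "\<lambda>w. f (v + w)" "-1"] nn_integral_lborel_translate[of f v]
  by simp

text \<open>This gives the loss the shape that \<open>gain_transform\<close> gives to the gain, an
  integral over one velocity difference around a spherical integral, so that the two can be compared
  under the outer integral.\<close>

lemma loss_transform:
  fixes A :: "real \<Rightarrow> ennreal" and \<Phi> :: "real^'n \<Rightarrow> ennreal"
  assumes [measurable]: "A \<in> borel_measurable borel" "\<Phi> \<in> borel_measurable borel"
  shows "(\<integral>\<^sup>+(\<sigma>, w). \<Phi> w * ennreal (norm (v - w) powr \<gamma>) * A (cos_deviation v w \<sigma>) \<partial>(sphere_measure \<Otimes>\<^sub>M lborel))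
    = (\<integral>\<^sup>+u. \<Phi> (v - u) * ennreal (norm u powr \<gamma>) * (\<integral>\<^sup>+\<sigma>. A (\<sigma> \<bullet> sgn u) \<partial>sphere_measure) \<partial>lborel)"
proof -
  have "(\<integral>\<^sup>+(\<sigma>, w). \<Phi> w * ennreal (norm (v - w) powr \<gamma>) * A (cos_deviation v w \<sigma>) \<partial>(sphere_measure \<Otimes>\<^sub>M lborel))
    = (\<integral>\<^sup>+w. \<integral>\<^sup>+\<sigma>. \<Phi> w * ennreal (norm (v - w) powr \<gamma>) * A (cos_deviation v w \<sigma>) \<partial>sphere_measure \<partial>lborel)"
    by (subst pair_sigma_finite.nn_integral_snd[OF pair_sigma_finite_sphere_lborel, symmetric])
      (auto intro!: measurable_sphere_lborel simp: cos_deviation_def simp flip: borel_prod)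
  also have "\<dots> = (\<integral>\<^sup>+w. \<Phi> w * ennreal (norm (v - w) powr \<gamma>) * (\<integral>\<^sup>+\<sigma>. A (\<sigma> \<bullet> sgn (v - w)) \<partial>sphere_measure) \<partial>lborel)"
    by (intro nn_integral_cong, subst nn_integral_cmult[symmetric])
      (auto intro!: measurable_sphere_measure simp: cos_deviation_def sgn_div_norm inner_commute divide_inverse_commute)
  also have "\<dots> = (\<integral>\<^sup>+u. \<Phi> (v - u) * ennreal (norm u powr \<gamma>) * (\<integral>\<^sup>+\<sigma>. A (\<sigma> \<bullet> sgn u) \<partial>sphere_measure) \<partial>lborel)"
  proof (subst nn_integral_lborel_reflect_point[symmetric, where v = v])
    have "(\<lambda>w. \<integral>\<^sup>+\<sigma>. A (\<sigma> \<bullet> sgn (v - w)) \<partial>sphere_measure) \<in> borel_measurable borel"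
      by (simp add: nn_integral_sphere_measure)
    then show "(\<lambda>w. \<Phi> w * ennreal (norm (v - w) powr \<gamma>) * (\<integral>\<^sup>+\<sigma>. A (\<sigma> \<bullet> sgn (v - w)) \<partial>sphere_measure))
        \<in> borel_measurable borel" by measurable
  qed simp
  finally show ?thesis .
qed

text \<open>The angular weight left by Carleman's change of variables. With p the cosine of the
  angle between sigma and w = v - v_*', one has |v - v_*| = |w|/p and cos(theta) = 2 p^2 - 1. The
  relative speed contributes p^(-gamma), the Jacobian 2^(d-1) p^(-2), and the image is the
  half-space p > 0.\<close>

definition bisector_kernel :: "nat \<Rightarrow> real \<Rightarrow> (real \<Rightarrow> ennreal) \<Rightarrow> real \<Rightarrow> ennreal" where
  "bisector_kernel d \<gamma> A p = indicator {0<..} p * ennreal (2 ^ (d - 1) * p powr (- \<gamma> - 2)) * A (2 * p\<^sup>2 - 1)"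

lemma bisector_kernel_measurable [measurable]:
  assumes [measurable]: "A \<in> borel_measurable borel"
  shows "bisector_kernel d \<gamma> A \<in> borel_measurable borel"
  unfolding bisector_kernel_def[abs_def] by measurable

text \<open>Carleman's change of variables: \<open>w = v - v\<^sub>*'\<close> replaces \<open>v\<^sub>*\<close> for fixed \<open>\<sigma>\<close>.\<close>
lemma gain_transform:
  fixes A :: "real \<Rightarrow> ennreal" and \<Phi> \<Psi> :: "real^'n \<Rightarrow> ennreal"
  assumes [measurable]: "A \<in> borel_measurable borel" "\<Phi> \<in> borel_measurable borel" "\<Psi> \<in> borel_measurable borel"
    and d: "2 \<le> CARD('n)"
  shows "(\<integral>\<^sup>+(\<sigma>, w). \<Phi> (post_vstar v w \<sigma>) * \<Psi> (post_v v w \<sigma>) * ennreal (norm (v - w) powr \<gamma>)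
        * A (cos_deviation v w \<sigma>) \<partial>(sphere_measure \<Otimes>\<^sub>M lborel))
    = (\<integral>\<^sup>+w. \<Phi> (v - w) * ennreal (norm w powr \<gamma>) * (\<integral>\<^sup>+\<sigma>. \<Psi> (v - w + ((norm w)\<^sup>2 / (w \<bullet> \<sigma>)) *\<^sub>R \<sigma>)
        * bisector_kernel CARD('n) \<gamma> A (\<sigma> \<bullet> sgn w) \<partial>sphere_measure) \<partial>lborel)"
proof -
  define J where "J = (\<lambda>(\<sigma>, w). \<Phi> (v - w) * ennreal (norm w powr \<gamma>) * (\<Psi> (v - w + ((norm w)\<^sup>2 / (w \<bullet> \<sigma>)) *\<^sub>R \<sigma>)
        * bisector_kernel CARD('n) \<gamma> A (\<sigma> \<bullet> sgn w)))"
  have J: "J \<in> borel_measurable (sphere_measure \<Otimes>\<^sub>M lborel)"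
    unfolding J_def by (rule measurable_sphere_lborel) (simp flip: borel_prod)
  have "(\<integral>\<^sup>+(\<sigma>, w). \<Phi> (post_vstar v w \<sigma>) * \<Psi> (post_v v w \<sigma>) * ennreal (norm (v - w) powr \<gamma>)
        * A (cos_deviation v w \<sigma>) \<partial>(sphere_measure \<Otimes>\<^sub>M lborel))
    = (\<integral>\<^sup>+\<sigma>. \<integral>\<^sup>+w. \<Phi> (post_vstar v w \<sigma>) * \<Psi> (post_v v w \<sigma>) * ennreal (norm (v - w) powr \<gamma>)
        * A (cos_deviation v w \<sigma>) \<partial>lborel \<partial>sphere_measure)"
    by (subst lborel.nn_integral_fst[symmetric])
      (auto intro!: measurable_sphere_lborel simp: cos_deviation_def post_v_def post_vstar_def simp flip: borel_prod)
  also have "\<dots> = (\<integral>\<^sup>+\<sigma>. \<integral>\<^sup>+w. J (\<sigma>, w) \<partial>lborel \<partial>sphere_measure)"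
  proof (rule nn_integral_cong)
    fix \<sigma> :: "real^'n" assume "\<sigma> \<in> space sphere_measure"
    then have \<sigma>: "norm \<sigma> = 1" by (simp add: space_sphere_measure)
    \<comment> \<open>The integrand in the relative velocity u = v - v_*, for which v - v_*' = (u +
      |u| sigma)/2 and v - v' = (u - |u| sigma)/2.\<close>
    define R where "R u = \<Phi> (v - (1/2) *\<^sub>R (u + norm u *\<^sub>R \<sigma>)) * \<Psi> (v - (1/2) *\<^sub>R (u - norm u *\<^sub>R \<sigma>))
      * ennreal (norm u powr \<gamma>) * A (sgn u \<bullet> \<sigma>)" for u
    have [measurable]: "R \<in> borel_measurable borel" unfolding R_def by measurable
    have "(\<integral>\<^sup>+w. \<Phi> (post_vstar v w \<sigma>) * \<Psi> (post_v v w \<sigma>) * ennreal (norm (v - w) powr \<gamma>)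
        * A (cos_deviation v w \<sigma>) \<partial>lborel) = (\<integral>\<^sup>+w. R (v - w) \<partial>lborel)"
    proof (rule nn_integral_cong)
      fix w
      have 1: "post_vstar v w \<sigma> = v - (1/2) *\<^sub>R ((v - w) + norm (v - w) *\<^sub>R \<sigma>)"
        unfolding post_vstar_def by (simp add: vec_eq_iff field_simps)
      have 2: "post_v v w \<sigma> = v - (1/2) *\<^sub>R ((v - w) - norm (v - w) *\<^sub>R \<sigma>)"
        unfolding post_v_def by (simp add: vec_eq_iff field_simps)
      have 3: "cos_deviation v w \<sigma> = sgn (v - w) \<bullet> \<sigma>"
        by (simp add: cos_deviation_def sgn_div_norm)
      show "\<Phi> (post_vstar v w \<sigma>) * \<Psi> (post_v v w \<sigma>) * ennreal (norm (v - w) powr \<gamma>)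
        * A (cos_deviation v w \<sigma>) = R (v - w)" by (simp only: R_def 1 2 3)
    qed
    also have "\<dots> = (\<integral>\<^sup>+u. R u \<partial>lborel)" by (rule nn_integral_lborel_reflect_point) simp
    \<comment> \<open>The new variable x = (u + |u| sigma)/2 is v - v_*'.\<close>
    also have "\<dots> = (\<integral>\<^sup>+x. indicator {0<..} (x \<bullet> \<sigma>) * ennreal (2 ^ (DIM(real^'n) - 1) * (norm x)\<^sup>2 / (x \<bullet> \<sigma>)\<^sup>2)
       * R (2 *\<^sub>R x - ((norm x)\<^sup>2 / (x \<bullet> \<sigma>)) *\<^sub>R \<sigma>) \<partial>lborel)"
      using d by (intro nn_integral_lborel_halfspace \<sigma>) auto
    also have "\<dots> = (\<integral>\<^sup>+w. J (\<sigma>, w) \<partial>lborel)"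
    proof (rule nn_integral_cong)
      fix x :: "real^'n"
      define u where "u = 2 *\<^sub>R x - ((norm x)\<^sup>2 / (x \<bullet> \<sigma>)) *\<^sub>R \<sigma>"
      show "indicator {0<..} (x \<bullet> \<sigma>) * ennreal (2 ^ (DIM(real^'n) - 1) * (norm x)\<^sup>2 / (x \<bullet> \<sigma>)\<^sup>2) * R u = J (\<sigma>, x)"
      proof (cases "x \<bullet> \<sigma> > 0")
        case True
        define p where "p = sgn x \<bullet> \<sigma>"
        have ps: "\<sigma> \<bullet> sgn x = p" by (simp add: p_def inner_commute)
        have x: "norm x > 0" using True by auto
        have p: "p = (x \<bullet> \<sigma>) / norm x" "p > 0" using True x by (simp_all add: p_def sgn_inner_eq)
        note nu = norm_bisector_inverse[OF \<sigma> True, folded u_def]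
        have 1: "(1/2) *\<^sub>R (u + norm u *\<^sub>R \<sigma>) = x" by (simp add: nu) (simp add: u_def)
        have 2: "v - (1/2) *\<^sub>R (u - norm u *\<^sub>R \<sigma>) = v - x + ((norm x)\<^sup>2 / (x \<bullet> \<sigma>)) *\<^sub>R \<sigma>"
          by (simp add: nu) (simp add: u_def vec_eq_iff field_simps)
        have 3: "sgn u \<bullet> \<sigma> = 2 * p\<^sup>2 - 1"
          using sgn_bisector_inverse[OF \<sigma> True] by (simp add: u_def p_def)
        have "norm u = norm x / p" using True x by (simp add: nu p power2_eq_square)
        then have 4: "norm u powr \<gamma> = norm x powr \<gamma> * p powr (- \<gamma>)"
          using p(2) x by (simp add: powr_divide powr_minus_divide)
        have "2 ^ (CARD('n) - 1) * (norm x)\<^sup>2 / (x \<bullet> \<sigma>)\<^sup>2 = 2 ^ (CARD('n) - 1) * p powr (- 2)"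
          using True x p(2) by (simp add: powr_minus_divide powr_numeral) (simp add: p power_divide)
        moreover have "p powr (- \<gamma> - 2) = p powr (- \<gamma>) * p powr (- 2)"
          by (simp flip: powr_add)
        ultimately have 5: "ennreal (2 ^ (DIM(real^'n) - 1) * (norm x)\<^sup>2 / (x \<bullet> \<sigma>)\<^sup>2) * ennreal (norm u powr \<gamma>)
          = ennreal (norm x powr \<gamma>) * ennreal (2 ^ (CARD('n) - 1) * p powr (- \<gamma> - 2))"
          by (simp add: 4 ennreal_mult'[symmetric] mult_ac)
        have "indicator {0<..} (x \<bullet> \<sigma>) * ennreal (2 ^ (DIM(real^'n) - 1) * (norm x)\<^sup>2 / (x \<bullet> \<sigma>)\<^sup>2) * R u
          = (ennreal (2 ^ (DIM(real^'n) - 1) * (norm x)\<^sup>2 / (x \<bullet> \<sigma>)\<^sup>2) * ennreal (norm u powr \<gamma>))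
           * \<Phi> (v - x) * \<Psi> (v - x + ((norm x)\<^sup>2 / (x \<bullet> \<sigma>)) *\<^sub>R \<sigma>) * A (2 * p\<^sup>2 - 1)"
          using True by (simp only: R_def 1 2 3) (simp add: mult_ac)
        also have "\<dots> = J (\<sigma>, x)"
          unfolding 5 J_def using p(2) ps by (simp add: bisector_kernel_def mult_ac)
        finally show ?thesis .
      next
        case False
        then have "\<not> \<sigma> \<bullet> sgn x > 0"
          by (cases "x = 0") (simp_all add: inner_commute[of \<sigma>] sgn_inner_eq zero_less_divide_iff)
        then show ?thesis using False by (simp add: J_def bisector_kernel_def)
      qed
    qed
    finally show "(\<integral>\<^sup>+w. \<Phi> (post_vstar v w \<sigma>) * \<Psi> (post_v v w \<sigma>) * ennreal (norm (v - w) powr \<gamma>)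
        * A (cos_deviation v w \<sigma>) \<partial>lborel) = (\<integral>\<^sup>+w. J (\<sigma>, w) \<partial>lborel)" .
  qed
  also have "\<dots> = (\<integral>\<^sup>+w. \<integral>\<^sup>+\<sigma>. J (\<sigma>, w) \<partial>sphere_measure \<partial>lborel)"
    by (rule pair_sigma_finite.Fubini'[OF pair_sigma_finite_sphere_lborel, symmetric]) (use J in simp)
  also have "\<dots> = (\<integral>\<^sup>+w. \<Phi> (v - w) * ennreal (norm w powr \<gamma>) * (\<integral>\<^sup>+\<sigma>. \<Psi> (v - w + ((norm w)\<^sup>2 / (w \<bullet> \<sigma>)) *\<^sub>R \<sigma>)
        * bisector_kernel CARD('n) \<gamma> A (\<sigma> \<bullet> sgn w) \<partial>sphere_measure) \<partial>lborel)"
    unfolding J_def prod.case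
    by (intro nn_integral_cong nn_integral_cmult measurable_sphere_measure) measurable
  finally show ?thesis .
qed

text \<open>This is the cancellation lemma in the form of an inequality.\<close>
lemma loss_le_gain:
  fixes A :: "real \<Rightarrow> ennreal" and \<Phi> :: "real^'n \<Rightarrow> ennreal"
  assumes [measurable]: "A \<in> borel_measurable borel" "\<Phi> \<in> borel_measurable borel"
    and d: "2 \<le> CARD('n)" and \<gamma>: "- real CARD('n) \<le> \<gamma>"
  shows "(\<integral>\<^sup>+(\<sigma>, w). \<Phi> w * ennreal (norm (v - w) powr \<gamma>) * A (cos_deviation v w \<sigma>) \<partial>(sphere_measure \<Otimes>\<^sub>M lborel))
    \<le> (\<integral>\<^sup>+w. \<Phi> (v - w) * ennreal (norm w powr \<gamma>)
        * (\<integral>\<^sup>+\<sigma>. bisector_kernel CARD('n) \<gamma> A (\<sigma> \<bullet> sgn w) \<partial>sphere_measure) \<partial>lborel)"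
  unfolding loss_transform[OF assms(1,2)]
proof (rule nn_integral_mono)
  fix w :: "real^'n"
  show "\<Phi> (v - w) * ennreal (norm w powr \<gamma>) * (\<integral>\<^sup>+\<sigma>. A (\<sigma> \<bullet> sgn w) \<partial>sphere_measure)
    \<le> \<Phi> (v - w) * ennreal (norm w powr \<gamma>) * (\<integral>\<^sup>+\<sigma>. bisector_kernel CARD('n) \<gamma> A (\<sigma> \<bullet> sgn w) \<partial>sphere_measure)"
  proof (cases "w = 0")
    \<comment> \<open>The excluded case is trivial: \<open>0 powr \<gamma>\<close> is 0, so both
      sides vanish.\<close>
    case False
    then have e: "norm (sgn w) = 1" by (simp add: norm_sgn)
    have "(\<integral>\<^sup>+\<sigma>. A (\<sigma> \<bullet> sgn w) \<partial>sphere_measure)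
      = (\<integral>\<^sup>+\<sigma>. indicator {0<..} (\<sigma> \<bullet> sgn w) * ennreal (2 ^ (CARD('n) - 1) * (\<sigma> \<bullet> sgn w) ^ (CARD('n) - 2))
        * A (2 * (\<sigma> \<bullet> sgn w)\<^sup>2 - 1) \<partial>sphere_measure)"
      by (rule nn_integral_sphere_double_angle[OF _ e d]) simp
    also have "\<dots> \<le> (\<integral>\<^sup>+\<sigma>. bisector_kernel CARD('n) \<gamma> A (\<sigma> \<bullet> sgn w) \<partial>sphere_measure)"
    proof (rule nn_integral_mono)
      fix \<sigma> :: "real^'n" assume "\<sigma> \<in> space sphere_measure"
      then have "norm \<sigma> = 1" by (simp add: space_sphere_measure)
      define p where "p = \<sigma> \<bullet> sgn w"
      have p1: "p \<le> 1" using norm_cauchy_schwarz[of \<sigma> "sgn w"] \<open>norm \<sigma> = 1\<close> e by (simp add: p_def)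
      show "indicator {0<..} (\<sigma> \<bullet> sgn w) * ennreal (2 ^ (CARD('n) - 1) * (\<sigma> \<bullet> sgn w) ^ (CARD('n) - 2))
        * A (2 * (\<sigma> \<bullet> sgn w)\<^sup>2 - 1) \<le> bisector_kernel CARD('n) \<gamma> A (\<sigma> \<bullet> sgn w)"
        unfolding bisector_kernel_def p_def[symmetric]
      proof (cases "p > 0")
        case True
        \<comment> \<open>The sign in the cancellation lemma is decided here: gamma >= -d gives
          -gamma - 2 <= d - 2, and on (0, 1] the smaller exponent gives the larger power.\<close>
        have "p ^ (CARD('n) - 2) = p powr (real CARD('n) - 2)"
          using True d by (simp add: powr_realpow[symmetric])
        also have "\<dots> \<le> p powr (- \<gamma> - 2)" using True p1 \<gamma> by (intro powr_mono') auto
        finally show "indicator {0<..} p * ennreal (2 ^ (CARD('n) - 1) * p ^ (CARD('n) - 2)) * A (2 * p\<^sup>2 - 1)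
          \<le> indicator {0<..} p * ennreal (2 ^ (CARD('n) - 1) * p powr (- \<gamma> - 2)) * A (2 * p\<^sup>2 - 1)"
          by (intro mult_right_mono mult_left_mono ennreal_leI) auto
      qed simp
    qed
    finally show ?thesis by (rule mult_left_mono) simp
  qed simp
qed

section \<open>Weights and moments\<close>

lemma japanese_ge_1: "1 \<le> japanese v"
  by (simp add: japanese_def)

lemma japanese_pos: "0 < japanese v"
  using japanese_ge_1[of v] by linarith

lemma japanese_power2: "(japanese v)\<^sup>2 = 1 + (norm v)\<^sup>2"
  by (simp add: japanese_def)

lemma norm_le_japanese: "norm v \<le> japanese v"
  unfolding japanese_def by (rule real_le_rsqrt) simp

lemma japanese_powr_eq: "japanese v powr (- q) = (1 + (norm v)\<^sup>2) powr (- q / 2)"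
proof -
  have "(1 + (norm v)\<^sup>2) powr (- q / 2) = ((japanese v) powr 2) powr (- q / 2)"
    using japanese_pos[of v] by (simp add: japanese_power2)
  also have "\<dots> = japanese v powr (- q)" by (simp add: powr_powr)
  finally show ?thesis ..
qed

lemma japanese_powr_measurable [measurable]:
  "(\<lambda>v. japanese v powr (- q)) \<in> borel_measurable borel"
  unfolding japanese_def by measurable

text \<open>Bernoulli's inequality for a negative exponent, from ln (1 + y) <= y and exp z >= 1 +
  z.\<close>

lemma one_plus_powr_minus_ge:
  fixes p y :: real
  assumes "0 \<le> p" "0 \<le> y"
  shows "1 - p * y \<le> (1 + y) powr (- p)"
proof -
  have "1 - p * y \<le> 1 + (- p * ln (1 + y))"
    using mult_left_mono[OF ln_add_one_self_le_self[OF assms(2)] assms(1)] by simp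
  also have "\<dots> \<le> exp (- p * ln (1 + y))" by (rule exp_ge_add_one_self)
  also have "\<dots> = (1 + y) powr (- p)" using assms by (simp add: powr_def)
  finally show ?thesis .
qed

text \<open>The parallelogram law and the arithmetic-geometric mean inequality remove the first-order term.\<close>
lemma japanese_second_difference:
  fixes v h :: "real^'n"
  assumes q: "2 \<le> q"
  shows "2 * japanese v powr (- q) \<le> japanese (v + h) powr (- q) + japanese (v - h) powr (- q)
     + q * japanese v powr (- q) * min ((norm h)\<^sup>2 / (japanese v)\<^sup>2) 1"
proof -
  define a where "a = 1 + (norm v)\<^sup>2"
  define c where "c = (norm h)\<^sup>2"
  define b where "b = 2 * (v \<bullet> h)"
  define p where "p = q / 2"
  have p: "p \<ge> 1" "q = 2 * p" using q by (auto simp: p_def)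
  have a: "a \<ge> 1" and c: "c \<ge> 0" by (auto simp: a_def c_def)
  have plus: "1 + (norm (v + h))\<^sup>2 = a + c + b" and minus: "1 + (norm (v - h))\<^sup>2 = a + c - b"
    unfolding a_def b_def c_def power2_norm_eq_inner
    by (simp_all add: inner_add_left inner_add_right inner_diff_left inner_diff_right inner_commute)
  define X Y where "X = a + c + b" and "Y = a + c - b"
  have XY: "X > 0" "Y > 0" using plus minus zero_le_power2[of "norm (v + h)"] zero_le_power2[of "norm (v - h)"]
    unfolding X_def Y_def by linarith+
  have "X * Y = (a + c)\<^sup>2 - b\<^sup>2" by (simp add: X_def Y_def power2_eq_square algebra_simps)
  then have le: "X * Y \<le> (a + c)\<^sup>2" by simp
  have "(a + c) powr (- p) = ((a + c) powr 2) powr (- p / 2)" by (simp add: powr_powr)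
  also have "\<dots> = ((a + c)\<^sup>2) powr (- p / 2)" using a c by simp
  also have "\<dots> \<le> (X * Y) powr (- p / 2)" using XY p le by (intro powr_mono2') auto
  also have "\<dots> = X powr (- p / 2) * Y powr (- p / 2)" using XY by (simp add: powr_mult)
  finally have 1: "2 * (a + c) powr (- p) \<le> 2 * (X powr (- p / 2) * Y powr (- p / 2))" by simp
  have sq: "Z powr (- p) = (Z powr (- p / 2))\<^sup>2" for Z :: real
    by (simp add: powr_powr flip: powr_numeral)
  have "2 * (X powr (- p / 2) * Y powr (- p / 2)) \<le> X powr (- p) + Y powr (- p)"
    unfolding sq[of X] sq[of Y]
    using sum_squares_bound[of "X powr (- p / 2)" "Y powr (- p / 2)"] by (simp add: mult_ac)
  with 1 have 2: "2 * (a + c) powr (- p) \<le> X powr (- p) + Y powr (- p)" by linarith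
  have "a + c = a * (1 + c / a)" using a by (simp add: field_simps)
  then have 3: "(a + c) powr (- p) = a powr (- p) * (1 + c / a) powr (- p)" using a c by (simp add: powr_mult)
  \<comment> \<open>For c/a > 1 the left side is 2 (1 - p), which is nonpositive because q >= 2
    means p >= 1; otherwise Bernoulli's inequality applies.\<close>
  have "2 * (1 - p * min (c / a) 1) \<le> 2 * (1 + c / a) powr (- p)"
  proof (cases "c / a \<le> 1")
    case True
    then show ?thesis using one_plus_powr_minus_ge[of p "c / a"] a c p by simp
  next
    case False
    have "0 \<le> (1 + c / a) powr (- p)" by simp
    then show ?thesis using False p by (simp del: powr_ge_zero)
  qed
  then have "a powr (- p) * (2 * (1 - p * min (c / a) 1)) \<le> a powr (- p) * (2 * (1 + c / a) powr (- p))"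
    by (rule mult_left_mono) simp
  then have "2 * a powr (- p) - q * a powr (- p) * min (c / a) 1 \<le> 2 * (a + c) powr (- p)"
    by (simp add: 3 p(2) algebra_simps)
  with 2 have "2 * a powr (- p) \<le> X powr (- p) + Y powr (- p) + q * a powr (- p) * min (c / a) 1" by linarith
  then show ?thesis
    unfolding japanese_powr_eq japanese_power2 plus minus by (simp add: p_def X_def Y_def a_def c_def)
qed

text \<open>From |w| <= <v> (1 + |v - w|) the weight is at most <v>^gamma (1 + |v - w|)^(gamma+2s).
  The first factor is at most 1 because gamma <= 0, the second at most 1 + |v - w| because gamma +
  2s <= 1. The weight 1/<v> in the angular scale thus exactly absorbs the growth in
  \<open>v\<close>, and the bound is uniform in \<open>v\<close>.\<close>

lemma moment_bound:
  fixes F :: "real^'n \<Rightarrow> ennreal"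
  assumes [measurable]: "F \<in> borel_measurable borel"
    and \<gamma>: "\<gamma> \<le> 0" and s: "0 < \<gamma> + 2 * s" "\<gamma> + 2 * s \<le> 1"
  shows "(\<integral>\<^sup>+w. F (v - w) * ennreal (norm w powr \<gamma> * (norm w / japanese v) powr (2 * s)) \<partial>lborel)
    \<le> 2 * ((\<integral>\<^sup>+w. F w \<partial>lborel) + (\<integral>\<^sup>+w. F w * ennreal ((norm w)\<^sup>2) \<partial>lborel))"
proof -
  have "norm w powr \<gamma> * (norm w / japanese v) powr (2 * s) \<le> 2 * (1 + (norm (v - w))\<^sup>2)" for w
  proof (cases "w = 0")
    case False
    define J where "J = japanese v"
    define z where "z = norm (v - w)"
    have J: "J \<ge> 1" by (simp add: J_def japanese_ge_1)
    have z: "z \<ge> 0" by (simp add: z_def)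
    have "norm w \<le> norm v + z"
      using norm_triangle_sub[of w v] by (simp add: z_def norm_minus_commute)
    also have "\<dots> \<le> J + z * J" using norm_le_japanese[of v] J z by (intro add_mono) (auto simp: J_def mult_le_cancel_left1)
    finally have w: "norm w \<le> J * (1 + z)" by (simp add: algebra_simps)
    have "norm w powr \<gamma> * (norm w / J) powr (2 * s) = norm w powr (\<gamma> + 2 * s) * J powr (- (2 * s))"
      using False J by (simp add: powr_divide powr_add powr_minus_divide)
    also have "\<dots> \<le> (J * (1 + z)) powr (\<gamma> + 2 * s) * J powr (- (2 * s))"
      using w s by (intro mult_right_mono powr_mono2) auto
    also have "\<dots> = J powr \<gamma> * (1 + z) powr (\<gamma> + 2 * s)"
      using J z by (simp add: powr_mult powr_add powr_minus_divide)
    also have "\<dots> \<le> 1 * (1 + z) powr 1"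
    proof (intro mult_mono)
      show "J powr \<gamma> \<le> 1" using powr_mono[OF \<gamma> J] J by simp
    qed (use s z powr_mono[of "\<gamma> + 2 * s" 1 "1 + z"] in auto)
    also have "\<dots> \<le> 2 * (1 + z\<^sup>2)" using z sum_squares_bound[of z 1] zero_le_power2[of z] by (simp, linarith)
    finally show ?thesis by (simp add: J_def z_def)
  qed simp
  then have "(\<integral>\<^sup>+w. F (v - w) * ennreal (norm w powr \<gamma> * (norm w / japanese v) powr (2 * s)) \<partial>lborel)
    \<le> (\<integral>\<^sup>+w. F (v - w) * ennreal (2 * (1 + (norm (v - w))\<^sup>2)) \<partial>lborel)"
    by (intro nn_integral_mono mult_left_mono ennreal_leI) auto
  also have "\<dots> = (\<integral>\<^sup>+w. F w * ennreal (2 * (1 + (norm w)\<^sup>2)) \<partial>lborel)"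
    by (rule nn_integral_lborel_reflect_point) simp
  also have "\<dots> = (\<integral>\<^sup>+w. 2 * (F w + F w * ennreal ((norm w)\<^sup>2)) \<partial>lborel)"
    by (intro nn_integral_cong) (simp add: ennreal_mult ring_distribs mult_ac)
  also have "\<dots> = 2 * ((\<integral>\<^sup>+w. F w \<partial>lborel) + (\<integral>\<^sup>+w. F w * ennreal ((norm w)\<^sup>2) \<partial>lborel))"
    by (simp add: nn_integral_cmult nn_integral_add)
  finally show ?thesis .
qed

text \<open>Since gamma <= 0 and every coordinate is at most |w|, the function |w|^gamma is
  dominated by the product of the |w_b|^(gamma/d). This reduces the claim to one-dimensional
  integrals with exponent greater than -1.\<close>

lemma nn_integral_powr_ball_finite:
  fixes \<gamma> :: real
  assumes \<gamma>: "- real DIM('a) < \<gamma>" "\<gamma> \<le> 0"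
  shows "(\<integral>\<^sup>+w. indicator (ball 0 1) w * ennreal (norm (w :: 'a::euclidean_space) powr \<gamma>) \<partial>lborel) < \<infinity>"
proof -
  define d where "d = real DIM('a)"
  have d: "d > 0" by (simp add: d_def)
  define k where "k x = (indicator {-1..1} x * ennreal (\<bar>x\<bar> powr (\<gamma> / d)) :: ennreal)" for x :: real
  have [measurable]: "k \<in> borel_measurable borel" unfolding k_def by measurable
  \<comment> \<open>Zero coordinates have to be excluded, because \<open>0 powr x\<close> is 0 and
    would make the dominating product vanish.\<close>
  have "AE w in lborel. w \<bullet> b \<noteq> (0::real)" if "b \<in> Basis" for b :: 'a
  proof -
    have "negligible {w. b \<bullet> w = 0}" using that by (intro negligible_hyperplane) auto
    then have "{w. b \<bullet> w = 0} \<in> null_sets lborel"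
      by (simp add: negligible_iff_null_sets null_sets_def)
    then have "AE w in lborel. w \<notin> {w. b \<bullet> w = 0}" by (rule AE_not_in)
    then show ?thesis by (simp add: inner_commute)
  qed
  then have "AE w in lborel. \<forall>b\<in>Basis. (w :: 'a) \<bullet> b \<noteq> (0::real)"
    by (intro eventually_ball_finite) auto
  then have "(\<integral>\<^sup>+w. indicator (ball 0 1) w * ennreal (norm (w :: 'a) powr \<gamma>) \<partial>lborel)
    \<le> (\<integral>\<^sup>+w. (\<Prod>b\<in>(Basis :: 'a set). k (w \<bullet> b)) \<partial>lborel)"
  proof (rule nn_integral_mono_AE[OF eventually_mono])
    fix w :: 'a assume w: "\<forall>b\<in>Basis. w \<bullet> b \<noteq> 0"
    show "indicator (ball 0 1) w * ennreal (norm w powr \<gamma>) \<le> (\<Prod>b\<in>(Basis :: 'a set). k (w \<bullet> b))"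
    proof (cases "norm w < 1")
      case True
      have b1: "\<bar>w \<bullet> b\<bar> \<le> norm w" if "b \<in> Basis" for b using that by (rule Basis_le_norm)
      have "norm w powr \<gamma> = (\<Prod>b\<in>(Basis :: 'a set). norm w powr (\<gamma> / d))"
        using d by (cases "w = 0") (simp_all add: d_def powr_power)
      also have "\<dots> \<le> (\<Prod>b\<in>(Basis :: 'a set). \<bar>w \<bullet> b\<bar> powr (\<gamma> / d))"
        using w b1 \<gamma>(2) d by (intro prod_mono) (auto intro!: powr_mono2' simp: divide_le_0_iff)
      finally have "ennreal (norm w powr \<gamma>) \<le> (\<Prod>b\<in>(Basis :: 'a set). ennreal (\<bar>w \<bullet> b\<bar> powr (\<gamma> / d)))"
        by (subst prod_ennreal) (auto intro!: ennreal_leI)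
      also have "\<dots> = (\<Prod>b\<in>(Basis :: 'a set). k (w \<bullet> b))"
      proof (rule prod.cong[OF refl])
        fix b :: 'a assume "b \<in> Basis"
        then have "\<bar>w \<bullet> b\<bar> \<le> 1" using b1 True by fastforce
        then show "ennreal (\<bar>w \<bullet> b\<bar> powr (\<gamma> / d)) = k (w \<bullet> b)" by (simp add: k_def indicator_def abs_le_iff)
      qed
      finally show ?thesis using True by simp
    qed simp
  qed
  also have "\<dots> = (\<Prod>b\<in>(Basis :: 'a set). \<integral>\<^sup>+x. k x \<partial>lborel)"
    by (rule nn_integral_lborel_prod) auto
  also have "\<dots> < \<infinity>"
  proof -
    have g: "\<gamma> / d > -1" using \<gamma>(1) d by (simp add: d_def divide_less_eq less_divide_eq)
    define I where "I x = (if x \<in> {0..1} then x powr (\<gamma> / d) else 0)" for x :: real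
    have Im [measurable]: "I \<in> borel_measurable borel" unfolding I_def by measurable
    have I_int: "(I has_integral (1 / (\<gamma> / d + 1))) UNIV"
      unfolding I_def using has_integral_powr_from_0[of "\<gamma> / d" 1] g
      by (subst has_integral_restrict_UNIV) simp
    have I: "(\<integral>\<^sup>+x. ennreal (I x) \<partial>lborel) = ennreal (1 / (\<gamma> / d + 1))"
      by (rule nn_integral_has_integral_lborel[OF Im _ I_int]) (simp add: I_def)
    have "(\<integral>\<^sup>+x. k x \<partial>lborel) \<le> (\<integral>\<^sup>+x. ennreal (I x) + ennreal (I (- x)) \<partial>lborel)"
      by (intro nn_integral_mono) (auto simp: k_def I_def indicator_def)
    also have "\<dots> = ennreal (1 / (\<gamma> / d + 1)) + ennreal (1 / (\<gamma> / d + 1))"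
      using nn_integral_lborel_scale[of "\<lambda>x. ennreal (I x)" "-1"] I by (simp add: nn_integral_add)
    also have "\<dots> < \<infinity>" by simp
    finally show ?thesis by (simp add: power_less_top_ennreal)
  qed
  finally show ?thesis .
qed

section \<open>The collision operator at a touching point\<close>

text \<open>\<open>\<kappa>\<close> stands for the cosine of the smallest deviation angle that is kept.\<close>
definition cut_kernel :: "real \<Rightarrow> real \<Rightarrow> real \<Rightarrow> (real \<Rightarrow> real) \<Rightarrow> real \<Rightarrow> real \<Rightarrow> real" where
  "cut_kernel d \<gamma> s bt \<kappa> c = (if c \<in> {-1..\<kappa>} then angular_kernel d \<gamma> s bt c else 0)"

abbreviation cut_bisector_kernel ::
    "nat \<Rightarrow> real \<Rightarrow> real \<Rightarrow> (real \<Rightarrow> real) \<Rightarrow> real \<Rightarrow> real \<Rightarrow> ennreal" where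
  "cut_bisector_kernel d \<gamma> s bt \<kappa> \<equiv> bisector_kernel d \<gamma> (\<lambda>c. ennreal (cut_kernel (real d) \<gamma> s bt \<kappa> c))"

text \<open>With grazing angles removed the loss and the gain can be studied apart. As extended
  nonnegative integrals they make sense before integrability is known.\<close>

definition cut_loss :: "real \<Rightarrow> real \<Rightarrow> (real \<Rightarrow> real) \<Rightarrow> real \<Rightarrow> (real^'n \<Rightarrow> real) \<Rightarrow> real^'n \<Rightarrow> ennreal" where
  "cut_loss \<gamma> s bt \<kappa> F v = (\<integral>\<^sup>+(\<sigma>, w). ennreal (F w * F v
     * (norm (v - w) powr \<gamma> * cut_kernel (real CARD('n)) \<gamma> s bt \<kappa> (cos_deviation v w \<sigma>))) \<partial>(sphere_measure \<Otimes>\<^sub>M lborel))"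

definition cut_gain :: "real \<Rightarrow> real \<Rightarrow> (real \<Rightarrow> real) \<Rightarrow> real \<Rightarrow> (real^'n \<Rightarrow> real) \<Rightarrow> real^'n \<Rightarrow> ennreal" where
  "cut_gain \<gamma> s bt \<kappa> F v = (\<integral>\<^sup>+(\<sigma>, w). ennreal (F (post_vstar v w \<sigma>) * F (post_v v w \<sigma>)
     * (norm (v - w) powr \<gamma> * cut_kernel (real CARD('n)) \<gamma> s bt \<kappa> (cos_deviation v w \<sigma>))) \<partial>(sphere_measure \<Otimes>\<^sub>M lborel))"

text \<open>The power of 2 comes from the Jacobian in \<open>bisector_kernel\<close>, and
  \<open>b\<close> bounds the angular factor. The absence of \<open>\<kappa>\<close> is what allows
  the cut to be removed in the end.\<close>

definition cut_constant :: "'n::finite itself \<Rightarrow> real \<Rightarrow> real \<Rightarrow> real" where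
  "cut_constant _ s b = 2 ^ (CARD('n) - 1) * b * angular_constant TYPE('n) s"

text \<open>The half-angle formulas eliminate \<open>arccos\<close>. For c = 2 p^2 - 1 the two bases
  become 1 - p^2 and p^2, as needed after the bisector substitution.\<close>

lemma angular_kernel_eq:
  assumes "c \<in> {-1..1}"
  shows "angular_kernel d \<gamma> s bt c
    = ((1 - c) / 2) powr (- (d - 1 + 2 * s) / 2) * ((1 + c) / 2) powr ((\<gamma> + 2 * s + 1) / 2) * bt c"
proof -
  define y where "y = arccos c / 2"
  have c: "cos (2 * y) = c" using assms by (simp add: y_def cos_arccos)
  have sin: "(1 - c) / 2 = (sin y)\<^sup>2" using cos_double_sin[of y] c by simp
  have cos: "(1 + c) / 2 = (cos y)\<^sup>2" using cos_double_cos[of y] c by simp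
  have sq: "(x\<^sup>2) powr (p / 2) = \<bar>x\<bar> powr p" for x p :: real
  proof (cases "x = 0")
    case False
    have "(x\<^sup>2) powr (p / 2) = (\<bar>x\<bar> powr 2) powr (p / 2)" using False by simp
    also have "\<dots> = \<bar>x\<bar> powr p" unfolding powr_powr by simp
    finally show ?thesis .
  qed simp
  have "- (d - 1) - 2 * s = - (d - 1 + 2 * s)" by simp
  then show ?thesis
    unfolding angular_kernel_def y_def[symmetric] sin cos sq by (simp only:)
qed

section \<open>Spherical estimates for the cut kernel\<close>

context
  fixes s \<gamma> b_hi :: real and bt :: "real \<Rightarrow> real"
  assumes d: "2 \<le> CARD('n::finite)"
    and s: "0 < s" "s < 1"
    and \<gamma>: "- real CARD('n) < \<gamma>" "\<gamma> \<le> 0"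
    and \<gamma>s: "0 < \<gamma> + 2 * s" "\<gamma> + 2 * s \<le> 1"
    and bt_measurable: "bt \<in> borel_measurable (restrict_space borel {-1..1})"
    and bt_bounds: "\<And>c. c \<in> {-1..1} \<Longrightarrow> 0 \<le> bt c \<and> bt c \<le> b_hi"
begin

lemma cut_kernel_nonneg: "\<kappa> \<le> 1 \<Longrightarrow> 0 \<le> cut_kernel (real CARD('n)) \<gamma> s bt \<kappa> c"
  using bt_bounds[of c] by (simp add: cut_kernel_def angular_kernel_def)

lemma cut_kernel_measurable:
  assumes "\<kappa> \<le> 1"
  shows "cut_kernel (real CARD('n)) \<gamma> s bt \<kappa> \<in> borel_measurable borel"
proof -
  \<comment> \<open>Measurability of \<open>bt\<close> is available on [-1, 1] only, hence the
    extension by zero.\<close>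
  define bt' where "bt' c = (if c \<in> {-1..1} then bt c else 0)" for c
  have [measurable]: "bt' \<in> borel_measurable borel"
    using bt_measurable by (subst (asm) measurable_restrict_space_iff[of _ _ 0]) (simp_all add: bt'_def[abs_def])
  have "cut_kernel (real CARD('n)) \<gamma> s bt \<kappa> = (\<lambda>c. if c \<in> {-1..\<kappa>} then
     ((1 - c) / 2) powr (- (real CARD('n) - 1 + 2 * s) / 2) * ((1 + c) / 2) powr ((\<gamma> + 2 * s + 1) / 2) * bt' c else 0)"
    using assms by (auto simp: fun_eq_iff cut_kernel_def angular_kernel_eq bt'_def)
  also have "\<dots> \<in> borel_measurable borel" by measurable
  finally show ?thesis .
qed

text \<open>The factor cos(theta/2)^(gamma+2s+1) is p^(gamma+2s+1), and with the p^(-gamma-2) of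
  \<open>bisector_kernel\<close> it leaves the power p^(2s-1) that
  \<open>sphere_angular_bound\<close> requires. Dropping the cut only enlarges the kernel, so the
  bound is uniform in \<open>\<kappa>\<close>.\<close>

lemma bisector_cut_kernel_le:
  assumes p: "p \<le> 1" and \<kappa>: "\<kappa> \<le> 1"
  shows "cut_bisector_kernel CARD('n) \<gamma> s bt \<kappa> p
    \<le> indicator {0<..} p * ennreal (2 ^ (CARD('n) - 1) * b_hi
        * ((1 - p\<^sup>2) powr (- (real CARD('n) - 1 + 2 * s) / 2) * p powr (2 * s - 1)))"
proof (cases "p > 0")
  case True
  define c where "c = 2 * p\<^sup>2 - 1"
  have "p\<^sup>2 \<le> 1" using True p by (simp add: power_le_one)
  then have c: "c \<in> {-1..1}" by (simp add: c_def)
  define U where "U = (1 - p\<^sup>2) powr (- (real CARD('n) - 1 + 2 * s) / 2)"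
  have c1: "(1 - c) / 2 = 1 - p\<^sup>2" "(1 + c) / 2 = p\<^sup>2" by (simp_all add: c_def)
  have "(p\<^sup>2) powr ((\<gamma> + 2 * s + 1) / 2) = (p powr 2) powr ((\<gamma> + 2 * s + 1) / 2)" using True by simp
  also have "\<dots> = p powr (\<gamma> + 2 * s + 1)" unfolding powr_powr by (simp add: add_divide_distrib)
  finally have p2: "(p\<^sup>2) powr ((\<gamma> + 2 * s + 1) / 2) = p powr (\<gamma> + 2 * s + 1)" .
  have "cut_kernel (real CARD('n)) \<gamma> s bt \<kappa> c \<le> angular_kernel (real CARD('n)) \<gamma> s bt c"
    using bt_bounds[OF c] by (simp add: cut_kernel_def angular_kernel_def)
  also have "\<dots> \<le> U * p powr (\<gamma> + 2 * s + 1) * b_hi"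
    unfolding angular_kernel_eq[OF c] c1 p2 U_def using bt_bounds[OF c] by (intro mult_left_mono) auto
  finally have "2 ^ (CARD('n) - 1) * p powr (- \<gamma> - 2) * cut_kernel (real CARD('n)) \<gamma> s bt \<kappa> c
    \<le> 2 ^ (CARD('n) - 1) * p powr (- \<gamma> - 2) * (U * p powr (\<gamma> + 2 * s + 1) * b_hi)"
    by (rule mult_left_mono) simp
  also have "\<dots> = 2 ^ (CARD('n) - 1) * b_hi * (U * (p powr (- \<gamma> - 2) * p powr (\<gamma> + 2 * s + 1)))"
    by (simp add: mult_ac)
  also have "p powr (- \<gamma> - 2) * p powr (\<gamma> + 2 * s + 1) = p powr (2 * s - 1)"
    by (simp flip: powr_add)
  finally show ?thesis
    using True by (simp add: bisector_kernel_def c_def[symmetric] U_def ennreal_leI flip: ennreal_mult')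
qed (simp add: bisector_kernel_def)

lemma cut_constant_nonneg: "0 \<le> cut_constant TYPE('n) s b_hi"
  using bt_bounds[of 0] angular_constant_nonneg[where 'n = 'n, OF s] by (simp add: cut_constant_def)

lemma sphere_cut_kernel_bound:
  fixes e :: "real^'n"
  assumes e: "norm e = 1" and \<mu>: "\<mu> > 0" and \<kappa>: "\<kappa> \<le> 1"
  shows "(\<integral>\<^sup>+\<sigma>. ennreal (min (\<mu>\<^sup>2 * ((1 - (\<sigma> \<bullet> e)\<^sup>2) / (\<sigma> \<bullet> e)\<^sup>2)) 1)
        * cut_bisector_kernel CARD('n) \<gamma> s bt \<kappa> (\<sigma> \<bullet> e) \<partial>sphere_measure)
      \<le> ennreal (cut_constant TYPE('n) s b_hi * \<mu> powr (2 * s))"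
proof -
  define E where "E = 2 ^ (CARD('n) - 1) * b_hi"
  have E: "E \<ge> 0" using bt_bounds[of 0] by (simp add: E_def)
  let ?m = "\<lambda>\<sigma>. min (\<mu>\<^sup>2 * ((1 - (\<sigma> \<bullet> e)\<^sup>2) / (\<sigma> \<bullet> e)\<^sup>2)) 1"
  let ?B = "\<lambda>\<sigma>. indicator {0<..} (\<sigma> \<bullet> e) * ennreal (?m \<sigma>
      * (1 - (\<sigma> \<bullet> e)\<^sup>2) powr (- (real CARD('n) - 1 + 2 * s) / 2) * (\<sigma> \<bullet> e) powr (2 * s - 1))"
  have "(\<integral>\<^sup>+\<sigma>. ennreal (?m \<sigma>) * cut_bisector_kernel CARD('n) \<gamma> s bt \<kappa> (\<sigma> \<bullet> e) \<partial>sphere_measure)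
    \<le> (\<integral>\<^sup>+\<sigma>. ennreal E * ?B \<sigma> \<partial>sphere_measure)"
  proof (rule nn_integral_mono)
    fix \<sigma> :: "real^'n" assume "\<sigma> \<in> space sphere_measure"
    then have \<sigma>: "norm \<sigma> = 1" by (simp add: space_sphere_measure)
    have p: "\<bar>\<sigma> \<bullet> e\<bar> \<le> 1" using Cauchy_Schwarz_ineq2[of \<sigma> e] \<sigma> e by simp
    then have "(\<sigma> \<bullet> e)\<^sup>2 \<le> 1" by (simp add: abs_square_le_1)
    then have m: "?m \<sigma> \<ge> 0" by simp
    have "ennreal (?m \<sigma>) * cut_bisector_kernel CARD('n) \<gamma> s bt \<kappa> (\<sigma> \<bullet> e)
      \<le> ennreal (?m \<sigma>) * (indicator {0<..} (\<sigma> \<bullet> e) * ennreal (E * ((1 - (\<sigma> \<bullet> e)\<^sup>2) powr (- (real CARD('n) - 1 + 2 * s) / 2) * (\<sigma> \<bullet> e) powr (2 * s - 1))))"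
      unfolding E_def using p \<kappa> by (intro mult_left_mono bisector_cut_kernel_le) auto
    also have "\<dots> = ennreal E * ?B \<sigma>"
      using m E by (simp add: indicator_def mult_ac flip: ennreal_mult)
    finally show "ennreal (?m \<sigma>) * cut_bisector_kernel CARD('n) \<gamma> s bt \<kappa> (\<sigma> \<bullet> e)
      \<le> ennreal E * ?B \<sigma>" .
  qed
  also have "\<dots> = ennreal E * (\<integral>\<^sup>+\<sigma>. ?B \<sigma> \<partial>sphere_measure)"
    by (rule nn_integral_cmult) (auto intro!: measurable_sphere_measure)
  also have "\<dots> \<le> ennreal E * ennreal (angular_constant TYPE('n) s * \<mu> powr (2 * s))"
    by (rule mult_left_mono[OF sphere_angular_bound[OF d s e \<mu>]]) simp
  finally show ?thesis
    using E angular_constant_nonneg[where 'n = 'n, OF s] by (simp add: ennreal_mult'[symmetric] cut_constant_def E_def mult.assoc)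
qed

text \<open>On the support of the cut kernel 1 - p^2 >= (1 - kappa)/2, so the factor min of
  \<open>sphere_cut_kernel_bound\<close> with mu = 1 is bounded below and can be divided out. The
  bound degenerates as kappa tends to 1 and serves for finiteness only.\<close>

lemma sphere_cut_kernel_finite:
  fixes e :: "real^'n"
  assumes \<kappa>: "\<kappa> < 1" and e: "norm e = 1"
  shows "(\<integral>\<^sup>+\<sigma>. cut_bisector_kernel CARD('n) \<gamma> s bt \<kappa> (\<sigma> \<bullet> e) \<partial>sphere_measure)
    \<le> ennreal (cut_constant TYPE('n) s b_hi / min ((1 - \<kappa>) / 2) 1)"
proof -
  define D where "D = cut_constant TYPE('n) s b_hi"
  define m where "m = min ((1 - \<kappa>) / 2) 1"
  have m: "m > 0" "m \<le> 1" using \<kappa> by (auto simp: m_def)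
  have [measurable]: "cut_kernel (real CARD('n)) \<gamma> s bt \<kappa> \<in> borel_measurable borel"
    using \<kappa> by (intro cut_kernel_measurable) simp
  let ?K = "cut_bisector_kernel CARD('n) \<gamma> s bt \<kappa>"
  have "(\<integral>\<^sup>+\<sigma>. ?K (\<sigma> \<bullet> e) \<partial>sphere_measure)
    \<le> (\<integral>\<^sup>+\<sigma>. ennreal (1 / m) * (ennreal (min (1\<^sup>2 * ((1 - (\<sigma> \<bullet> e)\<^sup>2) / (\<sigma> \<bullet> e)\<^sup>2)) 1) * ?K (\<sigma> \<bullet> e)) \<partial>sphere_measure)"
  proof (rule nn_integral_mono)
    fix \<sigma> :: "real^'n" assume "\<sigma> \<in> space sphere_measure"
    then have \<sigma>: "norm \<sigma> = 1" by (simp add: space_sphere_measure)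
    define p where "p = \<sigma> \<bullet> e"
    have p: "\<bar>p\<bar> \<le> 1" using Cauchy_Schwarz_ineq2[of \<sigma> e] \<sigma> e by (simp add: p_def)
    then have p2: "p\<^sup>2 \<le> 1" by (simp add: abs_square_le_1)
    show "?K (\<sigma> \<bullet> e) \<le> ennreal (1 / m) * (ennreal (min (1\<^sup>2 * ((1 - (\<sigma> \<bullet> e)\<^sup>2) / (\<sigma> \<bullet> e)\<^sup>2)) 1) * ?K (\<sigma> \<bullet> e))"
      unfolding p_def[symmetric]
    proof (cases "p > 0 \<and> 2 * p\<^sup>2 - 1 \<le> \<kappa>")
      case True
      have "m \<le> (1 - \<kappa>) / 2" unfolding m_def by (rule min.cobounded1)
      also have "\<dots> \<le> 1 - p\<^sup>2" using True by simp
      also have "1 - p\<^sup>2 \<le> (1 - p\<^sup>2) / p\<^sup>2"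
        using True p2 by (simp add: le_divide_eq mult_left_le)
      finally have "m \<le> min (1\<^sup>2 * ((1 - p\<^sup>2) / p\<^sup>2)) 1" using m by simp
      then have "1 \<le> 1 / m * min (1\<^sup>2 * ((1 - p\<^sup>2) / p\<^sup>2)) 1" using m by (simp add: le_divide_eq)
      then have "1 \<le> ennreal (1 / m * min (1\<^sup>2 * ((1 - p\<^sup>2) / p\<^sup>2)) 1)"
        by (metis ennreal_1 ennreal_leI)
      then have "1 * ?K p \<le> ennreal (1 / m * min (1\<^sup>2 * ((1 - p\<^sup>2) / p\<^sup>2)) 1) * ?K p"
        by (rule mult_right_mono) simp
      then show "?K p \<le> ennreal (1 / m) * (ennreal (min (1\<^sup>2 * ((1 - p\<^sup>2) / p\<^sup>2)) 1) * ?K p)"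
        by (subst (asm) ennreal_mult') (use m in \<open>simp_all only: mult.assoc mult_1 zero_le_divide_1_iff less_imp_le\<close>)
    next
      case False
      then show "?K p \<le> ennreal (1 / m) * (ennreal (min (1\<^sup>2 * ((1 - p\<^sup>2) / p\<^sup>2)) 1) * ?K p)"
        by (auto simp: bisector_kernel_def cut_kernel_def)
    qed
  qed
  also have "\<dots> = ennreal (1 / m) * (\<integral>\<^sup>+\<sigma>. ennreal (min (1\<^sup>2 * ((1 - (\<sigma> \<bullet> e)\<^sup>2) / (\<sigma> \<bullet> e)\<^sup>2)) 1) * ?K (\<sigma> \<bullet> e) \<partial>sphere_measure)"
    by (rule nn_integral_cmult) (auto intro!: measurable_sphere_measure)
  also have "\<dots> \<le> ennreal (1 / m) * ennreal (D * 1 powr (2 * s))"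
    unfolding D_def using \<kappa> by (intro mult_left_mono sphere_cut_kernel_bound[OF e]) auto
  finally show ?thesis
    using m cut_constant_nonneg by (simp add: ennreal_mult'[symmetric] D_def m_def)
qed

text \<open>Reflecting \<open>\<sigma>\<close> about the axis \<open>w\<close> turns \<open>v' - v\<close> into its negative.\<close>
lemma sphere_cut_kernel_symmetrized:
  fixes v w :: "real^'n"
  assumes q: "2 \<le> q" and w: "w \<noteq> 0" and \<kappa>: "\<kappa> \<le> 1"
  shows "(\<integral>\<^sup>+\<sigma>. ennreal (japanese v powr (- q)) * cut_bisector_kernel CARD('n) \<gamma> s bt \<kappa> (\<sigma> \<bullet> sgn w) \<partial>sphere_measure)
    \<le> (\<integral>\<^sup>+\<sigma>. ennreal (japanese (v - w + ((norm w)\<^sup>2 / (w \<bullet> \<sigma>)) *\<^sub>R \<sigma>) powr (- q))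
        * cut_bisector_kernel CARD('n) \<gamma> s bt \<kappa> (\<sigma> \<bullet> sgn w) \<partial>sphere_measure)
      + ennreal (q / 2 * cut_constant TYPE('n) s b_hi * japanese v powr (- q) * (norm w / japanese v) powr (2 * s))"
proof -
  define D where "D = cut_constant TYPE('n) s b_hi"
  have [measurable]: "cut_kernel (real CARD('n)) \<gamma> s bt \<kappa> \<in> borel_measurable borel"
    by (rule cut_kernel_measurable[OF \<kappa>])
  define K where "K = cut_bisector_kernel CARD('n) \<gamma> s bt \<kappa>"
  have [measurable]: "K \<in> borel_measurable borel" unfolding K_def by measurable
  define e where "e = sgn w"
  have e: "norm e = 1" using w by (simp add: e_def norm_sgn)
  have we: "w = norm w *\<^sub>R e" using w by (simp add: e_def sgn_div_norm)
  have ee: "e \<bullet> e = 1" using e by (simp add: dot_square_norm)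
  define g where "g v = japanese v powr (- q)" for v :: "real^'n"
  have g0: "g v \<ge> 0" for v by (simp add: g_def)
  have [measurable]: "g \<in> borel_measurable borel" unfolding g_def by (rule japanese_powr_measurable)
  \<comment> \<open>This is v' - v in the variables \<open>w\<close> and \<open>\<sigma>\<close>. It
    is orthogonal to sigma-independent data only in its product with itself: its length is |w| times
    the tangent of the angle between \<open>\<sigma>\<close> and \<open>w\<close>, so that
    |h|^2/<v>^2 is the quantity in \<open>m\<close> below.\<close>
  define h where "h \<sigma> = - w + ((norm w)\<^sup>2 / (w \<bullet> \<sigma>)) *\<^sub>R \<sigma>" for \<sigma>
  have [measurable]: "h \<in> borel_measurable borel" unfolding h_def by measurable
  define \<mu> where "\<mu> = norm w / japanese v"
  have \<mu>: "\<mu> > 0" using w japanese_pos[of v] by (simp add: \<mu>_def)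
  define m where "m \<sigma> = min (\<mu>\<^sup>2 * ((1 - (\<sigma> \<bullet> e)\<^sup>2) / (\<sigma> \<bullet> e)\<^sup>2)) 1" for \<sigma>
  have [measurable]: "m \<in> borel_measurable borel" unfolding m_def by measurable
  have ws: "w \<bullet> \<sigma> = norm w * (\<sigma> \<bullet> e)" for \<sigma> by (subst we) (simp add: inner_commute)
  have Re: "(2 *\<^sub>R (\<sigma> \<bullet> e) *\<^sub>R e - \<sigma>) \<bullet> e = \<sigma> \<bullet> e" for \<sigma> by (simp add: inner_diff_left ee)
  have hR: "h (2 *\<^sub>R (\<sigma> \<bullet> e) *\<^sub>R e - \<sigma>) = - h \<sigma>" if "\<sigma> \<bullet> e > 0" for \<sigma>
  proof -
    have "((norm w)\<^sup>2 / (norm w * (\<sigma> \<bullet> e))) *\<^sub>R (2 *\<^sub>R (\<sigma> \<bullet> e) *\<^sub>R e) = 2 *\<^sub>R (norm w *\<^sub>R e)"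
      using that w by (simp add: power2_eq_square)
    also have "\<dots> = 2 *\<^sub>R w" using we by simp
    finally show ?thesis
      unfolding h_def ws Re by (simp add: scaleR_diff_right scaleR_2)
  qed
  have "(\<integral>\<^sup>+\<sigma>. ennreal (g (v + h \<sigma>)) * K (\<sigma> \<bullet> e) \<partial>sphere_measure)
    = (\<integral>\<^sup>+\<sigma>. ennreal (g (v + h (2 *\<^sub>R (\<sigma> \<bullet> e) *\<^sub>R e - \<sigma>))) * K ((2 *\<^sub>R (\<sigma> \<bullet> e) *\<^sub>R e - \<sigma>) \<bullet> e) \<partial>sphere_measure)"
    by (rule nn_integral_sphere_reflect[OF _ e, symmetric]) measurable
  also have "\<dots> = (\<integral>\<^sup>+\<sigma>. ennreal (g (v - h \<sigma>)) * K (\<sigma> \<bullet> e) \<partial>sphere_measure)"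
  proof (rule nn_integral_cong)
    fix \<sigma> :: "real^'n"
    show "ennreal (g (v + h (2 *\<^sub>R (\<sigma> \<bullet> e) *\<^sub>R e - \<sigma>))) * K ((2 *\<^sub>R (\<sigma> \<bullet> e) *\<^sub>R e - \<sigma>) \<bullet> e)
      = ennreal (g (v - h \<sigma>)) * K (\<sigma> \<bullet> e)"
      unfolding Re
    proof (cases "\<sigma> \<bullet> e > 0")
      case True
      then show "ennreal (g (v + h (2 *\<^sub>R (\<sigma> \<bullet> e) *\<^sub>R e - \<sigma>))) * K (\<sigma> \<bullet> e) = ennreal (g (v - h \<sigma>)) * K (\<sigma> \<bullet> e)"
        by (simp only: hR[OF True] add_uminus_conv_diff)
    next
      case False
      then show "ennreal (g (v + h (2 *\<^sub>R (\<sigma> \<bullet> e) *\<^sub>R e - \<sigma>))) * K (\<sigma> \<bullet> e) = ennreal (g (v - h \<sigma>)) * K (\<sigma> \<bullet> e)"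
        by (simp add: K_def bisector_kernel_def)
    qed
  qed
  finally have sym: "(\<integral>\<^sup>+\<sigma>. ennreal (g (v + h \<sigma>)) * K (\<sigma> \<bullet> e) \<partial>sphere_measure)
    = (\<integral>\<^sup>+\<sigma>. ennreal (g (v - h \<sigma>)) * K (\<sigma> \<bullet> e) \<partial>sphere_measure)" .
  have meas: "F \<in> borel_measurable borel \<Longrightarrow> F \<in> borel_measurable sphere_measure" for F :: "real^'n \<Rightarrow> ennreal"
    by (rule measurable_sphere_measure)
  \<comment> \<open>By \<open>sym\<close> the integrals with \<open>v + h \<sigma>\<close> and
    \<open>v - h \<sigma>\<close> agree, so the second difference may be used pointwise and the
    factor 2 divided out at the end.\<close>
  have "2 * (\<integral>\<^sup>+\<sigma>. ennreal (g v) * K (\<sigma> \<bullet> e) \<partial>sphere_measure) = (\<integral>\<^sup>+\<sigma>. 2 * (ennreal (g v) * K (\<sigma> \<bullet> e)) \<partial>sphere_measure)"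
    by (rule nn_integral_cmult[symmetric], rule meas) measurable
  also have "\<dots> \<le> (\<integral>\<^sup>+\<sigma>. (ennreal (g (v + h \<sigma>)) * K (\<sigma> \<bullet> e) + ennreal (g (v - h \<sigma>)) * K (\<sigma> \<bullet> e))
      + ennreal (q * g v) * (ennreal (m \<sigma>) * K (\<sigma> \<bullet> e)) \<partial>sphere_measure)"
  proof (rule nn_integral_mono)
    fix \<sigma> :: "real^'n" assume "\<sigma> \<in> space sphere_measure"
    then have \<sigma>: "norm \<sigma> = 1" by (simp add: space_sphere_measure)
    show "2 * (ennreal (g v) * K (\<sigma> \<bullet> e)) \<le> (ennreal (g (v + h \<sigma>)) * K (\<sigma> \<bullet> e) + ennreal (g (v - h \<sigma>)) * K (\<sigma> \<bullet> e))
      + ennreal (q * g v) * (ennreal (m \<sigma>) * K (\<sigma> \<bullet> e))"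
    proof (cases "\<sigma> \<bullet> e > 0")
      case True
      have p2: "(\<sigma> \<bullet> e)\<^sup>2 \<le> 1"
        using Cauchy_Schwarz_ineq2[of \<sigma> e] \<sigma> e by (simp add: abs_square_le_1)
      have ss: "\<sigma> \<bullet> \<sigma> = 1" using \<sigma> by (simp add: dot_square_norm)
      have "(norm (h \<sigma>))\<^sup>2 = (norm w)\<^sup>2 * ((1 - (\<sigma> \<bullet> e)\<^sup>2) / (\<sigma> \<bullet> e)\<^sup>2)"
      proof -
        have "(norm (h \<sigma>))\<^sup>2 = w \<bullet> w - 2 * ((norm w)\<^sup>2 / (w \<bullet> \<sigma>) * (w \<bullet> \<sigma>)) + ((norm w)\<^sup>2 / (w \<bullet> \<sigma>))\<^sup>2"
          unfolding h_def power2_norm_eq_inner[of "_ + _"]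
          by (simp add: inner_add_left inner_add_right ss inner_commute[of \<sigma> w] power2_eq_square algebra_simps)
        also have "\<dots> = (norm w)\<^sup>2 * ((1 - (\<sigma> \<bullet> e)\<^sup>2) / (\<sigma> \<bullet> e)\<^sup>2)"
          unfolding ws power2_norm_eq_inner[symmetric] using True w
          by (simp add: field_simps power2_eq_square)
        finally show ?thesis .
      qed
      then have "min ((norm (h \<sigma>))\<^sup>2 / (japanese v)\<^sup>2) 1 = m \<sigma>"
        by (simp add: m_def \<mu>_def power_divide mult.commute)
      then have "2 * g v \<le> g (v + h \<sigma>) + g (v - h \<sigma>) + q * g v * m \<sigma>"
        using japanese_second_difference[OF q, of v "h \<sigma>"] by (simp add: g_def)
      then have "ennreal (2 * g v) \<le> ennreal (g (v + h \<sigma>) + g (v - h \<sigma>) + q * g v * m \<sigma>)"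
        by (rule ennreal_leI)
      also have "\<dots> = ennreal (g (v + h \<sigma>)) + ennreal (g (v - h \<sigma>)) + ennreal (q * g v) * ennreal (m \<sigma>)"
        using g0 q p2 by (simp add: m_def ennreal_mult[symmetric])
      finally have "ennreal (2 * g v) * K (\<sigma> \<bullet> e)
        \<le> (ennreal (g (v + h \<sigma>)) + ennreal (g (v - h \<sigma>)) + ennreal (q * g v) * ennreal (m \<sigma>)) * K (\<sigma> \<bullet> e)"
        by (rule mult_right_mono) simp
      then show ?thesis by (simp add: ennreal_mult' ring_distribs mult.assoc)
    qed (simp add: K_def bisector_kernel_def)
  qed
  also have "\<dots> = ((\<integral>\<^sup>+\<sigma>. ennreal (g (v + h \<sigma>)) * K (\<sigma> \<bullet> e) \<partial>sphere_measure)
      + (\<integral>\<^sup>+\<sigma>. ennreal (g (v - h \<sigma>)) * K (\<sigma> \<bullet> e) \<partial>sphere_measure))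
      + ennreal (q * g v) * (\<integral>\<^sup>+\<sigma>. ennreal (m \<sigma>) * K (\<sigma> \<bullet> e) \<partial>sphere_measure)"
    by (simp add: nn_integral_add nn_integral_cmult meas)
  also have "\<dots> \<le> 2 * (\<integral>\<^sup>+\<sigma>. ennreal (g (v + h \<sigma>)) * K (\<sigma> \<bullet> e) \<partial>sphere_measure)
      + ennreal (q * g v) * ennreal (D * \<mu> powr (2 * s))"
    unfolding sym[symmetric] mult_2
    using sphere_cut_kernel_bound[OF e \<mu> \<kappa>] unfolding m_def K_def D_def by (intro add_left_mono mult_left_mono) auto
  also have "ennreal (q * g v) * ennreal (D * \<mu> powr (2 * s)) = 2 * ennreal (q / 2 * D * g v * \<mu> powr (2 * s))"
  proof -
    have "ennreal (q * g v) * ennreal (D * \<mu> powr (2 * s)) = ennreal ((q * g v) * (D * \<mu> powr (2 * s)))"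
      using q g0 by (intro ennreal_mult'[symmetric]) auto
    also have "(q * g v) * (D * \<mu> powr (2 * s)) = 2 * (q / 2 * D * g v * \<mu> powr (2 * s))" by simp
    also have "ennreal \<dots> = 2 * ennreal (q / 2 * D * g v * \<mu> powr (2 * s))" by (subst ennreal_mult') simp_all
    finally show ?thesis .
  qed
  finally have "2 * (\<integral>\<^sup>+\<sigma>. ennreal (g v) * K (\<sigma> \<bullet> e) \<partial>sphere_measure)
    \<le> 2 * ((\<integral>\<^sup>+\<sigma>. ennreal (g (v + h \<sigma>)) * K (\<sigma> \<bullet> e) \<partial>sphere_measure) + ennreal (q / 2 * D * g v * \<mu> powr (2 * s)))"
    by (simp add: ring_distribs)
  then have "(\<integral>\<^sup>+\<sigma>. ennreal (g v) * K (\<sigma> \<bullet> e) \<partial>sphere_measure)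
    \<le> (\<integral>\<^sup>+\<sigma>. ennreal (g (v + h \<sigma>)) * K (\<sigma> \<bullet> e) \<partial>sphere_measure) + ennreal (q / 2 * D * g v * \<mu> powr (2 * s))"
    by (subst (asm) ennreal_mult_le_mult_iff) simp_all
  then show ?thesis
    unfolding g_def h_def K_def e_def \<mu>_def D_def by (simp add: algebra_simps)
qed

section \<open>Comparison of gain and loss\<close>

text \<open>For |w| < 1 the continuous \<open>F\<close> is bounded and |w|^gamma is integrable; for
  larger \<open>w\<close> the power is at most 1 and \<open>F\<close> is integrable. Finiteness is
  what later permits cancelling the term with \<open>\<epsilon>\<close>.\<close>

lemma gain_weight_finite:
  fixes F :: "real^'n \<Rightarrow> real"
  assumes F: "continuous_on UNIV F" "\<And>v. 0 \<le> F v" and mass: "(\<integral>\<^sup>+w. ennreal (F w) \<partial>lborel) < \<infinity>" and \<kappa>: "\<kappa> < 1"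
  shows "(\<integral>\<^sup>+w. ennreal (F (v - w)) * ennreal (norm w powr \<gamma>) * (\<integral>\<^sup>+\<sigma>. cut_bisector_kernel CARD('n) \<gamma> s bt \<kappa> (\<sigma> \<bullet> sgn w) \<partial>sphere_measure) \<partial>lborel) < \<infinity>"
proof -
  let ?K = "cut_bisector_kernel CARD('n) \<gamma> s bt \<kappa>"
  have [measurable]: "F \<in> borel_measurable borel"
    using F(1) by (rule borel_measurable_continuous_onI)
  have [measurable]: "ball (0 :: real^'n) 1 \<in> sets borel" by simp
  define D where "D = cut_constant TYPE('n) s b_hi / min ((1 - \<kappa>) / 2) 1"
  have "bounded (F ` cball v 1)"
    by (intro compact_imp_bounded compact_continuous_image continuous_on_subset[OF F(1)]) auto
  then obtain B where B: "\<And>z. z \<in> cball v 1 \<Longrightarrow> norm (F z) \<le> B"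
    unfolding bounded_iff by blast
  have "(\<integral>\<^sup>+w. ennreal (F (v - w)) * ennreal (norm w powr \<gamma>) * (\<integral>\<^sup>+\<sigma>. ?K (\<sigma> \<bullet> sgn w) \<partial>sphere_measure) \<partial>lborel)
    \<le> (\<integral>\<^sup>+w. (ennreal B * (indicator (ball 0 1) w * ennreal (norm w powr \<gamma>)) + ennreal (F (v - w))) * ennreal D \<partial>lborel)"
  proof (rule nn_integral_mono)
    fix w :: "real^'n"
    show "ennreal (F (v - w)) * ennreal (norm w powr \<gamma>) * (\<integral>\<^sup>+\<sigma>. ?K (\<sigma> \<bullet> sgn w) \<partial>sphere_measure)
      \<le> (ennreal B * (indicator (ball 0 1) w * ennreal (norm w powr \<gamma>)) + ennreal (F (v - w))) * ennreal D"
    proof (cases "w = 0")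
      case False
      have "ennreal (F (v - w)) * ennreal (norm w powr \<gamma>)
        \<le> ennreal B * (indicator (ball 0 1) w * ennreal (norm w powr \<gamma>)) + ennreal (F (v - w))"
      proof (cases "norm w < 1")
        case True
        then have "F (v - w) \<le> B" using B[of "v - w"] F(2)[of "v - w"] by (simp add: dist_norm)
        then have "ennreal (F (v - w)) * ennreal (norm w powr \<gamma>) \<le> ennreal B * ennreal (norm w powr \<gamma>)"
          by (intro mult_right_mono ennreal_leI) auto
        then show ?thesis using True by (simp add: add_increasing2)
      next
        case w1: False
        then have "norm w powr \<gamma> \<le> norm w powr 0" using \<gamma> by (intro powr_mono) auto
        then have "norm w powr \<gamma> \<le> 1" using False by simp
        then have "ennreal (F (v - w)) * ennreal (norm w powr \<gamma>) \<le> ennreal (F (v - w)) * 1"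
          by (intro mult_left_mono) (auto simp: ennreal_le_1)
        then show ?thesis by (simp add: add_increasing)
      qed
      moreover have "(\<integral>\<^sup>+\<sigma>. ?K (\<sigma> \<bullet> sgn w) \<partial>sphere_measure) \<le> ennreal D"
        unfolding D_def using False by (intro sphere_cut_kernel_finite \<kappa>) (simp add: norm_sgn)
      ultimately show ?thesis by (intro mult_mono) auto
    qed simp
  qed
  also have "\<dots> = (ennreal B * (\<integral>\<^sup>+w. indicator (ball 0 1) w * ennreal (norm (w :: real^'n) powr \<gamma>) \<partial>lborel)
      + (\<integral>\<^sup>+w. ennreal (F (v - w)) \<partial>lborel)) * ennreal D"
    by (simp add: nn_integral_multc nn_integral_add nn_integral_cmult)
  also have "(\<integral>\<^sup>+w. ennreal (F (v - w)) \<partial>lborel) = (\<integral>\<^sup>+w. ennreal (F w) \<partial>lborel)"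
    by (rule nn_integral_lborel_reflect_point) simp
  also have "(ennreal B * (\<integral>\<^sup>+w. indicator (ball 0 1) w * ennreal (norm (w :: real^'n) powr \<gamma>) \<partial>lborel)
      + (\<integral>\<^sup>+w. ennreal (F w) \<partial>lborel)) * ennreal D < \<infinity>"
    using nn_integral_powr_ball_finite[where 'a = "real^'n", of \<gamma>] \<gamma> mass
    by (simp add: ennreal_mult_less_top)
  finally show ?thesis .
qed

text \<open>Let X be the integral of f(v_*') against the gain kernel without f(v'). Inserting the
  lower bound for f(v') and symmetrizing gives a g(v) X <= gain + epsilon X + remainder. At the
  touching point a g(v) = f(v) + epsilon, so epsilon X cancels and f(v) X is left, which dominates
  the loss by the cancellation lemma.\<close>

lemma collision_loss_le_gain:
  fixes F :: "real^'n \<Rightarrow> real"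
  assumes F: "continuous_on UNIV F" "\<And>v'. 0 \<le> F v'" and mass: "(\<integral>\<^sup>+w. ennreal (F w) \<partial>lborel) \<le> ennreal M"
    and energy: "(\<integral>\<^sup>+w. ennreal (F w) * ennreal ((norm w)\<^sup>2) \<partial>lborel) \<le> ennreal E" and ME: "0 \<le> M" "0 \<le> E"
    and q: "2 \<le> q" and a: "0 \<le> a" and \<epsilon>: "0 \<le> \<epsilon>"
    and lower: "\<And>v'. a * japanese v' powr (- q) - \<epsilon> \<le> F v'" and eq: "F v = a * japanese v powr (- q) - \<epsilon>"
    and \<kappa>: "\<kappa> < 1"
  shows "cut_loss \<gamma> s bt \<kappa> F v < \<infinity>"
    and "cut_loss \<gamma> s bt \<kappa> F v \<le> cut_gain \<gamma> s bt \<kappa> F v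
      + ennreal (q * cut_constant TYPE('n) s b_hi * (M + E) * a * japanese v powr (- q))"
proof -
  define D where "D = q / 2 * cut_constant TYPE('n) s b_hi"
  have D: "D \<ge> 0" using q cut_constant_nonneg by (simp add: D_def)
  define A where "A c = ennreal (cut_kernel (real CARD('n)) \<gamma> s bt \<kappa> c)" for c
  have cut0: "0 \<le> cut_kernel (real CARD('n)) \<gamma> s bt \<kappa> c" for c using \<kappa> by (intro cut_kernel_nonneg) simp
  have [measurable]: "cut_kernel (real CARD('n)) \<gamma> s bt \<kappa> \<in> borel_measurable borel"
    using \<kappa> by (intro cut_kernel_measurable) simp
  have [measurable]: "A \<in> borel_measurable borel" unfolding A_def by measurable
  have [measurable]: "F \<in> borel_measurable borel" using F(1) by (rule borel_measurable_continuous_onI)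
  define K where "K = bisector_kernel CARD('n) \<gamma> A"
  have [measurable]: "K \<in> borel_measurable borel" unfolding K_def by measurable
  define \<phi> where "\<phi> w = ennreal (F (v - w)) * ennreal (norm w powr \<gamma>)" for w
  have [measurable]: "\<phi> \<in> borel_measurable borel" unfolding \<phi>_def by measurable
  define k where "k w = (\<integral>\<^sup>+\<sigma>. K (\<sigma> \<bullet> sgn w) \<partial>sphere_measure)" for w :: "real^'n"
  have [measurable]: "k \<in> borel_measurable borel" unfolding k_def by (simp add: nn_integral_sphere_measure)
  define V where "V w \<sigma> = v - w + ((norm w)\<^sup>2 / (w \<bullet> \<sigma>)) *\<^sub>R \<sigma>" for w \<sigma>
  have [measurable]: "(\<lambda>x. V (f x) (h x)) \<in> borel_measurable N" if "f \<in> borel_measurable N" "h \<in> borel_measurable N" for f h and N :: "'b measure"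
    using that unfolding V_def by measurable
  define \<Gamma> where "\<Gamma> w = (\<integral>\<^sup>+\<sigma>. ennreal (F (V w \<sigma>)) * K (\<sigma> \<bullet> sgn w) \<partial>sphere_measure)" for w :: "real^'n"
  have [measurable]: "\<Gamma> \<in> borel_measurable borel" unfolding \<Gamma>_def by (simp add: nn_integral_sphere_measure)
  define X where "X = (\<integral>\<^sup>+w. \<phi> w * k w \<partial>lborel)"
  define R where "R w = ennreal (norm w powr \<gamma> * (norm w / japanese v) powr (2 * s))" for w :: "real^'n"
  have [measurable]: "R \<in> borel_measurable borel" unfolding R_def by measurable
  define g where "g = japanese v powr (- q)"
  have g: "g \<ge> 0" by (simp add: g_def)
  have "(\<integral>\<^sup>+w. ennreal (F w) \<partial>lborel) < \<infinity>" using mass by (simp add: le_less_trans)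
  then have X: "X < \<infinity>"
    unfolding X_def \<phi>_def k_def K_def A_def using F \<kappa> by (intro gain_weight_finite) auto
  have meas: "f \<in> borel_measurable borel \<Longrightarrow> f \<in> borel_measurable sphere_measure" for f :: "real^'n \<Rightarrow> ennreal"
    by (rule measurable_sphere_measure)

  define L where "L = cut_loss \<gamma> s bt \<kappa> F v"
  define G where "G = cut_gain \<gamma> s bt \<kappa> F v"
  have "G = (\<integral>\<^sup>+(\<sigma>, w). ennreal (F (post_vstar v w \<sigma>)) * ennreal (F (post_v v w \<sigma>)) * ennreal (norm (v - w) powr \<gamma>)
      * A (cos_deviation v w \<sigma>) \<partial>(sphere_measure \<Otimes>\<^sub>M lborel))"
    unfolding G_def cut_gain_def A_def by (intro nn_integral_cong) (auto simp: ennreal_mult F(2) cut0 mult.assoc)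
  also have "\<dots> = (\<integral>\<^sup>+w. \<phi> w * \<Gamma> w \<partial>lborel)"
    unfolding \<phi>_def \<Gamma>_def V_def K_def by (rule gain_transform[OF _ _ _ d]) measurable
  finally have G: "G = (\<integral>\<^sup>+w. \<phi> w * \<Gamma> w \<partial>lborel)" .
  have "L = (\<integral>\<^sup>+(\<sigma>, w). ennreal (F v) * ennreal (F w) * ennreal (norm (v - w) powr \<gamma>) * A (cos_deviation v w \<sigma>) \<partial>(sphere_measure \<Otimes>\<^sub>M lborel))"
    unfolding L_def cut_loss_def A_def by (intro nn_integral_cong) (auto simp: ennreal_mult F(2) cut0 mult_ac)
  also have "\<dots> \<le> (\<integral>\<^sup>+w. ennreal (F v) * ennreal (F (v - w)) * ennreal (norm w powr \<gamma>) * k w \<partial>lborel)"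
    unfolding k_def K_def using \<gamma> by (intro loss_le_gain d) auto
  also have "\<dots> = ennreal (F v) * X"
    unfolding X_def by (subst nn_integral_cmult[symmetric]) (auto simp: \<phi>_def mult.assoc)
  finally have L: "L \<le> ennreal (F v) * X" .
  then have "L < \<infinity>" using X by (simp add: le_less_trans ennreal_mult_less_top)
  have pointwise: "ennreal (a * g) * (\<phi> w * k w) \<le> \<phi> w * \<Gamma> w + ennreal \<epsilon> * (\<phi> w * k w) + ennreal (D * a * g) * (ennreal (F (v - w)) * R w)" for w
  proof (cases "w = 0")
    case False
    have "ennreal (a * g) * k w = ennreal a * (\<integral>\<^sup>+\<sigma>. ennreal g * K (\<sigma> \<bullet> sgn w) \<partial>sphere_measure)"
      unfolding k_def using a g by (subst nn_integral_cmult) (auto intro!: meas simp: ennreal_mult mult.assoc)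
    also have "\<dots> \<le> ennreal a * ((\<integral>\<^sup>+\<sigma>. ennreal (japanese (V w \<sigma>) powr (- q)) * K (\<sigma> \<bullet> sgn w) \<partial>sphere_measure)
        + ennreal (D * g * (norm w / japanese v) powr (2 * s)))"
      unfolding g_def K_def A_def[abs_def] V_def D_def using False \<kappa> q by (intro mult_left_mono sphere_cut_kernel_symmetrized) auto
    also have "\<dots> = (\<integral>\<^sup>+\<sigma>. ennreal a * (ennreal (japanese (V w \<sigma>) powr (- q)) * K (\<sigma> \<bullet> sgn w)) \<partial>sphere_measure)
        + ennreal (D * a * g * (norm w / japanese v) powr (2 * s))"
      using a g D unfolding ring_distribs
      by (intro arg_cong2[of _ _ _ _ "(+)"] nn_integral_cmult[symmetric] meas)
        (auto simp: ennreal_mult[symmetric] mult_ac intro: measurable_compose[OF _ japanese_powr_measurable])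
    also have "(\<integral>\<^sup>+\<sigma>. ennreal a * (ennreal (japanese (V w \<sigma>) powr (- q)) * K (\<sigma> \<bullet> sgn w)) \<partial>sphere_measure)
        \<le> (\<integral>\<^sup>+\<sigma>. ennreal (F (V w \<sigma>)) * K (\<sigma> \<bullet> sgn w) + ennreal \<epsilon> * K (\<sigma> \<bullet> sgn w) \<partial>sphere_measure)"
    proof (rule nn_integral_mono)
      fix \<sigma>
      have "ennreal a * ennreal (japanese (V w \<sigma>) powr (- q)) \<le> ennreal (F (V w \<sigma>) + \<epsilon>)"
        using lower[of "V w \<sigma>"] a by (simp add: ennreal_mult'[symmetric] ennreal_leI)
      also have "\<dots> = ennreal (F (V w \<sigma>)) + ennreal \<epsilon>" using F(2) \<epsilon> by simp
      finally show "ennreal a * (ennreal (japanese (V w \<sigma>) powr (- q)) * K (\<sigma> \<bullet> sgn w))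
        \<le> ennreal (F (V w \<sigma>)) * K (\<sigma> \<bullet> sgn w) + ennreal \<epsilon> * K (\<sigma> \<bullet> sgn w)"
        unfolding mult.assoc[symmetric] distrib_right[symmetric] by (rule mult_right_mono) simp
    qed
    also have "\<dots> = \<Gamma> w + ennreal \<epsilon> * k w"
      unfolding \<Gamma>_def k_def by (simp add: nn_integral_add nn_integral_cmult meas)
    finally have "ennreal (a * g) * k w \<le> \<Gamma> w + ennreal \<epsilon> * k w + ennreal (D * a * g * (norm w / japanese v) powr (2 * s))"
      by (simp add: add_right_mono)
    then have "\<phi> w * (ennreal (a * g) * k w) \<le> \<phi> w * (\<Gamma> w + ennreal \<epsilon> * k w + ennreal (D * a * g * (norm w / japanese v) powr (2 * s)))"
      by (rule mult_left_mono) simp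
    also have "\<dots> = \<phi> w * \<Gamma> w + ennreal \<epsilon> * (\<phi> w * k w) + \<phi> w * ennreal (D * a * g * (norm w / japanese v) powr (2 * s))"
      by (simp add: distrib_left mult_ac)
    also have "\<phi> w * ennreal (D * a * g * (norm w / japanese v) powr (2 * s)) = ennreal (D * a * g) * (ennreal (F (v - w)) * R w)"
      unfolding \<phi>_def R_def using D a g by (simp add: ennreal_mult mult_ac)
    finally show ?thesis by (simp add: mult_ac)
  qed (simp add: \<phi>_def)
  \<comment> \<open>Only here is equality at \<open>v\<close> used; it makes the error of the lower
    bound at \<open>v'\<close> the same as the one at \<open>v\<close>.\<close>
  have "ennreal (F v) * X + ennreal \<epsilon> * X = ennreal (a * g) * X"
    using F(2)[of v] \<epsilon> by (simp add: eq g_def distrib_right[symmetric] flip: ennreal_plus)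
  also have "\<dots> = (\<integral>\<^sup>+w. ennreal (a * g) * (\<phi> w * k w) \<partial>lborel)"
    unfolding X_def by (rule nn_integral_cmult[symmetric]) measurable
  also have "\<dots> \<le> (\<integral>\<^sup>+w. \<phi> w * \<Gamma> w + ennreal \<epsilon> * (\<phi> w * k w) + ennreal (D * a * g) * (ennreal (F (v - w)) * R w) \<partial>lborel)"
    by (rule nn_integral_mono) (rule pointwise)
  also have "\<dots> = G + ennreal \<epsilon> * X + ennreal (D * a * g) * (\<integral>\<^sup>+w. ennreal (F (v - w)) * R w \<partial>lborel)"
    unfolding G X_def by (simp add: nn_integral_add nn_integral_cmult)
  also have "\<dots> \<le> G + ennreal \<epsilon> * X + ennreal (D * a * g) * ennreal (2 * (M + E))"
  proof (intro add_left_mono mult_left_mono)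
    have "(\<integral>\<^sup>+w. ennreal (F (v - w)) * R w \<partial>lborel)
      \<le> 2 * ((\<integral>\<^sup>+w. ennreal (F w) \<partial>lborel) + (\<integral>\<^sup>+w. ennreal (F w) * ennreal ((norm w)\<^sup>2) \<partial>lborel))"
      unfolding R_def by (rule moment_bound) (use \<gamma> \<gamma>s in auto)
    also have "\<dots> \<le> 2 * (ennreal M + ennreal E)"
      by (intro mult_left_mono add_mono mass energy) auto
    also have "\<dots> = ennreal (2 * (M + E))" using ME by (simp add: ennreal_mult)
    finally show "(\<integral>\<^sup>+w. ennreal (F (v - w)) * R w \<partial>lborel) \<le> ennreal (2 * (M + E))" .
  qed simp
  also have "\<dots> = ennreal \<epsilon> * X + (G + ennreal (D * (2 * (M + E)) * a * g))"
    using D a g ME by (simp add: ennreal_mult'[symmetric] add_ac mult_ac del: ennreal_plus)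
  finally have "ennreal \<epsilon> * X + ennreal (F v) * X \<le> ennreal \<epsilon> * X + (G + ennreal (D * (2 * (M + E)) * a * g))"
    by (simp add: add.commute)
  \<comment> \<open>Cancellation in the extended reals is legitimate because \<open>X\<close> is
    finite.\<close>
  moreover have "ennreal \<epsilon> * X \<noteq> \<infinity>" using X by (simp add: ennreal_mult_eq_top_iff)
  ultimately have "ennreal (F v) * X \<le> G + ennreal (D * (2 * (M + E)) * a * g)"
    by (simp add: ennreal_add_left_cancel_le)
  with L have "L \<le> G + ennreal (D * (2 * (M + E)) * a * g)" by (rule order_trans)
  moreover have "D * (2 * (M + E)) = q * cut_constant TYPE('n) s b_hi * (M + E)" by (simp add: D_def)
  ultimately show "cut_loss \<gamma> s bt \<kappa> F v < \<infinity>"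
    "cut_loss \<gamma> s bt \<kappa> F v \<le> cut_gain \<gamma> s bt \<kappa> F v
      + ennreal (q * cut_constant TYPE('n) s b_hi * (M + E) * a * japanese v powr (- q))"
    using \<open>L < \<infinity>\<close> by (simp_all only: L_def G_def g_def)
qed

text \<open>For every cut the loss is integrable, so the truncated integral is a genuine difference
  of gain and loss and \<open>collision_loss_le_gain\<close> bounds it below. As the bound does not
  depend on the cut, it passes to the principal value.\<close>

lemma has_collision_value_lower_bound:
  fixes F :: "real^'n \<Rightarrow> real"
  assumes F: "continuous_on UNIV F" "\<And>v'. 0 \<le> F v'" and mass: "(\<integral>\<^sup>+w. ennreal (F w) \<partial>lborel) \<le> ennreal M"
    and energy: "(\<integral>\<^sup>+w. ennreal (F w) * ennreal ((norm w)\<^sup>2) \<partial>lborel) \<le> ennreal E" and ME: "0 \<le> M" "0 \<le> E"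
    and q: "2 \<le> q" and a: "0 \<le> a" and \<epsilon>: "0 \<le> \<epsilon>"
    and lower: "\<And>v'. a * japanese v' powr (- q) - \<epsilon> \<le> F v'" and eq: "F v = a * japanese v powr (- q) - \<epsilon>"
    and Q: "has_collision_value \<gamma> s bt F v Q"
  shows "- (q * cut_constant TYPE('n) s b_hi * (M + E) * a * japanese v powr (- q)) \<le> Q"
proof -
  define C where "C = q * cut_constant TYPE('n) s b_hi * (M + E)"
  have C: "C \<ge> 0" using q ME cut_constant_nonneg by (simp add: C_def)
  have [measurable]: "F \<in> borel_measurable borel" using F(1) by (rule borel_measurable_continuous_onI)
  let ?M = "sphere_measure \<Otimes>\<^sub>M lborel :: ((real^'n) \<times> (real^'n)) measure"
  have bound: "- (C * a * japanese v powr (- q)) \<le> integral\<^sup>L ?M (truncated_collision_integrand \<gamma> s bt \<theta> F v)"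
    if \<theta>: "0 < \<theta>" "\<theta> \<le> pi" for \<theta>
  proof -
    define \<kappa> where "\<kappa> = cos \<theta>"
    have \<kappa>: "\<kappa> < 1" using \<theta> cos_monotone_0_pi[of 0 \<theta>] by (simp add: \<kappa>_def)
    have [measurable]: "cut_kernel (real CARD('n)) \<gamma> s bt \<kappa> \<in> borel_measurable borel"
      using \<kappa> by (intro cut_kernel_measurable) simp
    have cut0: "0 \<le> cut_kernel (real CARD('n)) \<gamma> s bt \<kappa> c" for c using \<kappa> by (intro cut_kernel_nonneg) simp
    define N where "N = (\<lambda>(\<sigma>, w). F w * F v * (norm (v - w) powr \<gamma> * cut_kernel (real CARD('n)) \<gamma> s bt \<kappa> (cos_deviation v w \<sigma>)))"
    define P where "P = (\<lambda>(\<sigma>, w). F (post_vstar v w \<sigma>) * F (post_v v w \<sigma>)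
        * (norm (v - w) powr \<gamma> * cut_kernel (real CARD('n)) \<gamma> s bt \<kappa> (cos_deviation v w \<sigma>)))"
    define T where "T = truncated_collision_integrand \<gamma> s bt \<theta> F v"
    have NP0: "0 \<le> N z" "0 \<le> P z" for z by (auto simp: N_def P_def F(2) cut0 split: prod.split)
    have TPN: "P z = T z + N z" if "z \<in> space ?M" for z
    proof -
      obtain \<sigma> w where z: "z = (\<sigma>, w)" by (cases z)
      then have \<sigma>: "norm \<sigma> = 1" using that by (simp add: space_pair_measure space_sphere_measure)
      define c where "c = cos_deviation v w \<sigma>"
      \<comment> \<open>At w = v the deviation cosine is 0 by the convention for division, hence the
        estimate through \<open>sgn\<close>, whose norm is at most 1 in every case.\<close>
      have "\<bar>c\<bar> \<le> norm (sgn (v - w)) * norm \<sigma>"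
        unfolding c_def cos_deviation_def sgn_div_norm by (rule Cauchy_Schwarz_ineq2)
      also have "\<dots> \<le> 1" using \<sigma> by (simp add: norm_sgn)
      finally have c: "-1 \<le> c" "c \<le> 1" by auto
      have "\<theta> \<le> arccos c \<longleftrightarrow> cos (arccos c) \<le> cos \<theta>"
        using \<theta> arccos_bounded[OF c] by (intro cos_mono_le_eq[symmetric]) auto
      then have iff: "\<theta> \<le> arccos c \<longleftrightarrow> c \<le> \<kappa>" using c by (simp add: \<kappa>_def cos_arccos)
      show ?thesis
        unfolding z T_def P_def N_def truncated_collision_integrand_def prod.case c_def[symmetric] iff
          cut_kernel_def collision_kernel_def
        using c by (simp add: algebra_simps)
    qed
    have nnN: "(\<integral>\<^sup>+z. ennreal (N z) \<partial>?M) < \<infinity>"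
      and le: "(\<integral>\<^sup>+z. ennreal (N z) \<partial>?M) \<le> (\<integral>\<^sup>+z. ennreal (P z) \<partial>?M) + ennreal (C * a * japanese v powr (- q))"
      using collision_loss_le_gain[OF F mass energy ME q a \<epsilon> lower eq \<kappa>]
      by (simp_all add: N_def P_def C_def cut_loss_def cut_gain_def case_prod_beta')
    have "N \<in> borel_measurable ?M"
      unfolding N_def cos_deviation_def by (rule measurable_sphere_lborel) (simp flip: borel_prod)
    then have intN: "integrable ?M N" using nnN NP0 by (intro integrableI_nonneg) auto
    have intT: "integrable ?M T" using Q \<theta> by (simp add: has_collision_value_def T_def)
    \<comment> \<open>Integrability of the gain is not known in advance. It follows from that of the
      truncated integrand, which is part of the definition of the collision value, and of the
      loss.\<close>
    have intP: "integrable ?M P"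
      using Bochner_Integration.integrable_add[OF intT intN] by (subst Bochner_Integration.integrable_cong[OF refl TPN]) simp_all
    have "integral\<^sup>L ?M P = integral\<^sup>L ?M (\<lambda>z. T z + N z)"
      by (rule Bochner_Integration.integral_cong[OF refl TPN])
    then have eqint: "integral\<^sup>L ?M P = integral\<^sup>L ?M T + integral\<^sup>L ?M N"
      using intT intN by simp
    have pos: "0 \<le> C * a * japanese v powr (- q)" "0 \<le> integral\<^sup>L ?M P"
      using C a NP0 by simp_all
    have "ennreal (integral\<^sup>L ?M N) \<le> ennreal (integral\<^sup>L ?M P + C * a * japanese v powr (- q))"
      using le nn_integral_eq_integral[OF intN] nn_integral_eq_integral[OF intP] NP0 pos by simp
    then have "integral\<^sup>L ?M N \<le> integral\<^sup>L ?M P + C * a * japanese v powr (- q)"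
      using pos by (subst (asm) ennreal_le_iff) simp_all
    then show ?thesis using eqint by (simp add: T_def)
  qed
  have "- (C * a * japanese v powr (- q)) \<le> Q"
  proof (rule tendsto_lowerbound)
    show "((\<lambda>\<epsilon>. integral\<^sup>L ?M (truncated_collision_integrand \<gamma> s bt \<epsilon> F v)) \<longlongrightarrow> Q) (at_right 0)"
      using Q by (simp add: has_collision_value_def)
    show "\<forall>\<^sub>F \<epsilon> in at_right 0. - (C * a * japanese v powr (- q)) \<le> integral\<^sup>L ?M (truncated_collision_integrand \<gamma> s bt \<epsilon> F v)"
      unfolding eventually_at_right_field using bound pi_gt_zero by (intro exI[of _ pi]) auto
  qed simp
  then show ?thesis by (simp add: C_def)
qed

end

section \<open>A minimum principle with outflow\<close>

text \<open>This turns the one-sided inequalities delivered by the minimum principle into bounds for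
  the derivatives in the equation.\<close>

lemma one_sided_derivative_ge:
  fixes \<phi> :: "real \<Rightarrow> real"
  assumes "(\<phi> has_real_derivative D) (at 0)"
    and "\<forall>\<^sub>F \<tau> in at_right 0. \<phi> 0 - c * \<tau> \<le> \<phi> \<tau>"
  shows "- c \<le> D"
proof (rule tendsto_lowerbound)
  show "((\<lambda>\<tau>. (\<phi> \<tau> - \<phi> 0) / \<tau>) \<longlongrightarrow> D) (at_right 0)"
    using assms(1) by (auto simp: has_field_derivative_iff intro: filterlim_mono at_le)
  show "\<forall>\<^sub>F \<tau> in at_right 0. - c \<le> (\<phi> \<tau> - \<phi> 0) / \<tau>"
    using assms(2) eventually_at_right_less[of "0::real"]
    by eventually_elim (simp add: le_divide_eq algebra_simps)
qed simp

lemma GDERIV_along_line: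
  assumes "GDERIV F x :> G"
  shows "((\<lambda>\<tau>. F (x - \<tau> *\<^sub>R v)) has_real_derivative - (v \<bullet> G)) (at 0)"
proof -
  have "(F has_derivative (\<lambda>h. h \<bullet> G)) (at (x - 0 *\<^sub>R v))" using assms by (simp add: gderiv_def)
  moreover have "((\<lambda>\<tau>::real. x - \<tau> *\<^sub>R v) has_derivative (\<lambda>\<tau>. - (\<tau> *\<^sub>R v))) (at 0)"
    by (auto intro!: derivative_eq_intros)
  ultimately have "((\<lambda>\<tau>. F (x - \<tau> *\<^sub>R v)) has_derivative (\<lambda>\<tau>. (- (\<tau> *\<^sub>R v)) \<bullet> G)) (at 0)"
    by (rule has_derivative_compose[rotated])
  moreover have "(\<lambda>\<tau>. (- (\<tau> *\<^sub>R v)) \<bullet> G) = (*) (- (v \<bullet> G))" by auto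
  ultimately show ?thesis by (simp add: has_field_derivative_def)
qed

text \<open>The equation is available inside \<open>\<Omega>\<close> only. A negative minimum of \<open>h\<close> at an outgoing boundary point
  \<open>x\<^sub>0\<close> is moved to the compact set \<open>\<rho> \<le> - \<eta>\<close> by a small quadratic perturbation centred at \<open>x\<^sub>0\<close>.
  Minimality is tested along the backward characteristic direction \<open>- v\<close> only, in which \<open>\<rho>\<close> decreases.\<close>
lemma outflow_minimum_principle:
  fixes h :: "real \<Rightarrow> real^'n \<Rightarrow> real^'n \<Rightarrow> real" and \<Omega> :: "(real^'n) set"
  assumes \<Omega>: "open \<Omega>" "bounded \<Omega>" and n: "\<And>x. x \<in> frontier \<Omega> \<Longrightarrow> outward_unit_normal \<Omega> x (n x)"
    and cont: "continuous_on ({0..T} \<times> closure \<Omega> \<times> UNIV) (\<lambda>(t, x, v). h t x v)"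
    and lower: "\<And>t x v. t \<in> {0..T} \<Longrightarrow> x \<in> closure \<Omega> \<Longrightarrow> - W v \<le> h t x v"
    and W: "\<And>\<eta>. \<eta> > 0 \<Longrightarrow> \<exists>R. \<forall>v. R < norm v \<longrightarrow> W v < \<eta>"
    and w: "continuous_on UNIV w" "\<And>v. 0 < w v"
    and initial: "\<And>x v. x \<in> closure \<Omega> \<Longrightarrow> 0 \<le> h 0 x v"
    and incoming: "\<And>t x v. t \<in> {0..T} \<Longrightarrow> x \<in> frontier \<Omega> \<Longrightarrow> v \<bullet> n x \<le> 0 \<Longrightarrow> 0 \<le> h t x v"
    and touching: "\<And>t x v c\<^sub>1 c\<^sub>2. t \<in> {0<..<T} \<Longrightarrow> x \<in> \<Omega> \<Longrightarrow> h t x v < 0 \<Longrightarrow> \<forall>v'. h t x v \<le> h t x v' \<Longrightarrow>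
        \<forall>\<^sub>F \<tau> in at_right 0. h t x v - c\<^sub>1 * \<tau> \<le> h (t - \<tau>) x v \<Longrightarrow>
        \<forall>\<^sub>F \<tau> in at_right 0. h t x v - c\<^sub>2 * \<tau> \<le> h t (x - \<tau> *\<^sub>R v) v \<Longrightarrow> w v \<le> c\<^sub>1 + c\<^sub>2"
    and tx: "t \<in> {0..T}" "x \<in> \<Omega>"
  shows "0 \<le> h t x v"
proof (rule ccontr)
  assume "\<not> 0 \<le> h t x v"
  then have neg: "h t x v < 0" by simp
  have T: "0 < T"
  proof (rule ccontr)
    assume "\<not> 0 < T"
    then have "t = 0" using tx by simp
    then show False using initial[of x v] tx neg closure_subset by auto
  qed
  have cont_comp: "continuous_on S (\<lambda>z. h (\<alpha> z) (\<xi> z) (\<zeta> z))"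
    if "continuous_on S \<alpha>" "continuous_on S \<xi>" "continuous_on S \<zeta>" "\<And>z. z \<in> S \<Longrightarrow> \<alpha> z \<in> {0..T} \<and> \<xi> z \<in> closure \<Omega>"
    for S :: "'z::topological_space set" and \<alpha> \<xi> \<zeta>
  proof -
    have "continuous_on S (\<lambda>z. (\<lambda>(t, x, v). h t x v) (\<alpha> z, \<xi> z, \<zeta> z))"
      by (rule continuous_on_compose2[OF cont]) (use that in \<open>auto intro!: continuous_on_Pair\<close>)
    then show ?thesis by simp
  qed
  obtain t\<^sub>1 where t\<^sub>1: "t\<^sub>1 \<in> {0..<T}" "h t\<^sub>1 x v < 0"
  proof (cases "t < T")
    case True
    then show ?thesis using tx neg that by auto
  next
    case False
    then have t: "t = T" using tx by simp
    have "continuous_on {0..T} (\<lambda>s. h s x v)"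
      using tx closure_subset by (intro cont_comp continuous_intros) auto
    then have "((\<lambda>s. h s x v) \<longlongrightarrow> h T x v) (at T within {0..T})"
      using T by (simp add: continuous_on)
    then have "((\<lambda>s. h s x v) \<longlongrightarrow> h T x v) (at_left T)"
      using T by (simp add: at_within_Icc_at_left)
    then have "\<forall>\<^sub>F s in at_left T. h s x v < 0" using neg t by (auto intro: order_tendstoD)
    moreover have "\<forall>\<^sub>F s in at_left T. s \<in> {0<..<T}" using T by (rule eventually_at_left_real)
    ultimately have "\<forall>\<^sub>F s in at_left T. h s x v < 0 \<and> s \<in> {0<..<T}" by eventually_elim simp
    then obtain s where "h s x v < 0" "s \<in> {0<..<T}"
      using eventually_happens'[OF trivial_limit_at_left_real] by blast
    then show ?thesis using that[of s] by auto
  qed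
  define \<eta>\<^sub>0 where "\<eta>\<^sub>0 = - h t\<^sub>1 x v"
  have \<eta>\<^sub>0: "\<eta>\<^sub>0 > 0" using t\<^sub>1 by (simp add: \<eta>\<^sub>0_def)
  obtain R\<^sub>0 where R\<^sub>0: "\<And>v. R\<^sub>0 < norm v \<Longrightarrow> W v < \<eta>\<^sub>0 / 2" using W[of "\<eta>\<^sub>0 / 2"] \<eta>\<^sub>0 by auto
  define R where "R = max (max R\<^sub>0 (norm v)) 1"
  \<comment> \<open>Beyond \<open>R\<close> the function exceeds half of the negative value found,
    so a minimum over the compact velocity ball is global in the velocity.\<close>
  have R: "R \<ge> 1" "norm v \<le> R" "\<And>v. R < norm v \<Longrightarrow> W v < \<eta>\<^sub>0 / 2" using R\<^sub>0 by (auto simp: R_def)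
  have compact_cl: "compact (closure \<Omega>)" using \<Omega> by (simp add: compact_closure)
  define Z where "Z = {0..t\<^sub>1} \<times> closure \<Omega> \<times> cball (0 :: real^'n) R"
  have "compact Z" unfolding Z_def using compact_cl by (intro compact_Times) auto
  moreover have z1: "(t\<^sub>1, x, v) \<in> Z" using t\<^sub>1 tx R closure_subset by (auto simp: Z_def)
  moreover have "continuous_on Z (\<lambda>(t, x, v). h t x v)"
    by (rule continuous_on_subset[OF cont]) (use t\<^sub>1 in \<open>auto simp: Z_def\<close>)
  ultimately obtain z where z: "z \<in> Z" "\<And>y. y \<in> Z \<Longrightarrow> (\<lambda>(t, x, v). h t x v) z \<le> (\<lambda>(t, x, v). h t x v) y"
    using continuous_attains_inf[of Z "\<lambda>(t, x, v). h t x v"] by blast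
  obtain t\<^sub>0 x\<^sub>0 v\<^sub>0 where z0: "z = (t\<^sub>0, x\<^sub>0, v\<^sub>0)" by (cases z)
  define m where "m = h t\<^sub>0 x\<^sub>0 v\<^sub>0"
  have m: "m \<le> - \<eta>\<^sub>0" using z(2)[OF z1] by (simp add: z0 m_def \<eta>\<^sub>0_def)
  have t\<^sub>0: "t\<^sub>0 \<in> {0..t\<^sub>1}" and x\<^sub>0: "x\<^sub>0 \<in> closure \<Omega>" and v\<^sub>0: "norm v\<^sub>0 \<le> R"
    using z(1) by (auto simp: Z_def z0)
  have far: "- \<eta>\<^sub>0 / 2 < h t x v" if "t \<in> {0..t\<^sub>1}" "x \<in> closure \<Omega>" "R < norm v" for t x v
    using lower[of t x v] R(3)[OF that(3)] that t\<^sub>1 by auto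
  have min: "m \<le> h t x v" if "t \<in> {0..t\<^sub>1}" "x \<in> closure \<Omega>" for t x v
  proof (cases "norm v \<le> R")
    case True
    then show ?thesis using z(2)[of "(t, x, v)"] that by (simp add: Z_def z0 m_def)
  next
    case False
    then show ?thesis using far[OF that, of v] m \<eta>\<^sub>0 by simp
  qed
  have "t\<^sub>0 \<noteq> 0" using initial[OF x\<^sub>0, of v\<^sub>0] m \<eta>\<^sub>0 by (auto simp: m_def)
  then have t\<^sub>0_pos: "0 < t\<^sub>0" "t\<^sub>0 < T" using t\<^sub>0 t\<^sub>1 by auto
  show False
  proof (cases "x\<^sub>0 \<in> \<Omega>")
    case True
    have "w v\<^sub>0 \<le> 0 + 0"
    proof (rule touching)
      show "t\<^sub>0 \<in> {0<..<T}" "x\<^sub>0 \<in> \<Omega>" "h t\<^sub>0 x\<^sub>0 v\<^sub>0 < 0" "\<forall>v'. h t\<^sub>0 x\<^sub>0 v\<^sub>0 \<le> h t\<^sub>0 x\<^sub>0 v'"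
        using t\<^sub>0_pos True m \<eta>\<^sub>0 min[OF t\<^sub>0 x\<^sub>0] by (auto simp: m_def)
      show "\<forall>\<^sub>F \<tau> in at_right 0. h t\<^sub>0 x\<^sub>0 v\<^sub>0 - 0 * \<tau> \<le> h (t\<^sub>0 - \<tau>) x\<^sub>0 v\<^sub>0"
        using eventually_at_right_real[OF t\<^sub>0_pos(1)]
      proof eventually_elim
        case (elim \<tau>)
        then show ?case using min[of "t\<^sub>0 - \<tau>" x\<^sub>0 v\<^sub>0] t\<^sub>0 x\<^sub>0 by (auto simp: m_def)
      qed
      have "((\<lambda>\<tau>::real. x\<^sub>0 - \<tau> *\<^sub>R v\<^sub>0) \<longlongrightarrow> x\<^sub>0 - 0 *\<^sub>R v\<^sub>0) (at_right 0)" by (intro tendsto_intros)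
      then have "\<forall>\<^sub>F \<tau> in at_right 0. x\<^sub>0 - \<tau> *\<^sub>R v\<^sub>0 \<in> \<Omega>"
        using \<Omega>(1) True by (intro topological_tendstoD) auto
      then show "\<forall>\<^sub>F \<tau> in at_right 0. h t\<^sub>0 x\<^sub>0 v\<^sub>0 - 0 * \<tau> \<le> h t\<^sub>0 (x\<^sub>0 - \<tau> *\<^sub>R v\<^sub>0) v\<^sub>0"
      proof eventually_elim
        case (elim \<tau>)
        then show ?case using min[of t\<^sub>0 "x\<^sub>0 - \<tau> *\<^sub>R v\<^sub>0" v\<^sub>0] t\<^sub>0 closure_subset by (auto simp: m_def)
      qed
    qed
    then show False using w(2)[of v\<^sub>0] by simp
  next
    case False
    then have fr: "x\<^sub>0 \<in> frontier \<Omega>" using x\<^sub>0 \<Omega>(1) by (simp add: frontier_def interior_open)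
    obtain U \<rho> G where U: "x\<^sub>0 \<in> U" and def: "C1_defining_function \<Omega> U \<rho> G" and nx: "n x\<^sub>0 = G x\<^sub>0 /\<^sub>R norm (G x\<^sub>0)"
      using n[OF fr] unfolding outward_unit_normal_def by blast
    have U_open: "open U" and \<rho>: "\<And>x. x \<in> U \<Longrightarrow> GDERIV \<rho> x :> G x" and G: "continuous_on U G"
      and G0: "\<And>x. x \<in> U \<Longrightarrow> G x \<noteq> 0" and \<Omega>U: "\<Omega> \<inter> U = {x \<in> U. \<rho> x < 0}"
      using def unfolding C1_defining_function_def by blast+
    have \<rho>_cont: "continuous_on U \<rho>"
      unfolding continuous_on_eq_continuous_at[OF U_open]
      using \<rho> by (auto simp: gderiv_def intro: has_derivative_continuous)
    obtain r\<^sub>1 where r\<^sub>1: "r\<^sub>1 > 0" "cball x\<^sub>0 r\<^sub>1 \<subseteq> U" using U_open U open_contains_cball by blast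
    \<comment> \<open>The perturbed minimizer will have a velocity different from
      \<open>v\<^sub>0\<close>, so a positive lower bound of \<open>w\<close> on the whole ball is
      required.\<close>
    obtain c\<^sub>0 where c\<^sub>0: "c\<^sub>0 > 0" "\<And>v. norm v \<le> R \<Longrightarrow> c\<^sub>0 \<le> w v"
    proof -
      have "\<exists>y\<in>cball 0 R. \<forall>v\<in>cball (0 :: real^'n) R. w y \<le> w v"
        using R(1) by (intro continuous_attains_inf continuous_on_subset[OF w(1)]) auto
      then obtain y where "\<forall>v\<in>cball (0 :: real^'n) R. w y \<le> w v" by blast
      then show ?thesis using that[of "w y"] w(2) by auto
    qed
    \<comment> \<open>The low values at incoming or tangential velocities. The projection to time
      and position is compact and misses \<open>(t\<^sub>0, x\<^sub>0)\<close> by the boundary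
      condition; hence near this point every low value has a strictly outgoing velocity.\<close>
    define B where "B = {z \<in> {0..t\<^sub>1} \<times> (closure \<Omega> \<inter> cball x\<^sub>0 r\<^sub>1) \<times> cball (0 :: real^'n) R.
       h (fst z) (fst (snd z)) (snd (snd z)) \<le> m / 2 \<and> snd (snd z) \<bullet> G (fst (snd z)) \<le> 0}"
    have "compact B"
    proof -
      let ?S = "{0..t\<^sub>1} \<times> (closure \<Omega> \<inter> cball x\<^sub>0 r\<^sub>1) \<times> cball (0 :: real^'n) R"
      have S: "compact ?S" using compact_cl by (intro compact_Times compact_Int_closed) auto
      have "closed {z \<in> ?S. h (fst z) (fst (snd z)) (snd (snd z)) \<le> m / 2}"
        using t\<^sub>1 by (intro continuous_on_closed_Collect_le cont_comp compact_imp_closed[OF S] continuous_intros) auto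
      moreover have "closed {z \<in> ?S. snd (snd z) \<bullet> G (fst (snd z)) \<le> 0}"
        using r\<^sub>1 by (intro continuous_on_closed_Collect_le compact_imp_closed[OF S] continuous_intros
            continuous_on_compose2[OF G]) auto
      ultimately have "closed ({z \<in> ?S. h (fst z) (fst (snd z)) (snd (snd z)) \<le> m / 2} \<inter> {z \<in> ?S. snd (snd z) \<bullet> G (fst (snd z)) \<le> 0})"
        by (rule closed_Int)
      also have "\<dots> = B" by (auto simp: B_def)
      finally show ?thesis using compact_Int_closed[OF S, of B] by (simp add: B_def Int_absorb1 Collect_conj_eq Int_assoc[symmetric])
    qed
    then have "compact ((\<lambda>z. (fst z, fst (snd z))) ` B)"
      by (intro compact_continuous_image continuous_intros)
    then have "closed ((\<lambda>z. (fst z, fst (snd z))) ` B)" by (rule compact_imp_closed)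
    moreover have "(t\<^sub>0, x\<^sub>0) \<notin> (\<lambda>z. (fst z, fst (snd z))) ` B"
    proof
      assume "(t\<^sub>0, x\<^sub>0) \<in> (\<lambda>z. (fst z, fst (snd z))) ` B"
      then obtain v' where "h t\<^sub>0 x\<^sub>0 v' \<le> m / 2" "v' \<bullet> G x\<^sub>0 \<le> 0" by (auto simp: B_def)
      then have "v' \<bullet> n x\<^sub>0 \<le> 0" by (simp add: nx mult_le_0_iff)
      then have "0 \<le> h t\<^sub>0 x\<^sub>0 v'" using t\<^sub>0_pos by (intro incoming fr) auto
      then show False using \<open>h t\<^sub>0 x\<^sub>0 v' \<le> m / 2\<close> m \<eta>\<^sub>0 by simp
    qed
    ultimately have "open (- (\<lambda>z. (fst z, fst (snd z))) ` B)" "(t\<^sub>0, x\<^sub>0) \<in> - (\<lambda>z. (fst z, fst (snd z))) ` B"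
      by auto
    then obtain r\<^sub>2 where r\<^sub>2: "r\<^sub>2 > 0" "ball (t\<^sub>0, x\<^sub>0) r\<^sub>2 \<subseteq> - (\<lambda>z. (fst z, fst (snd z))) ` B"
      using open_contains_ball by blast
    \<comment> \<open>The factor 3 makes points with both coordinates closer than \<open>r\<close>
      lie in the ball of radius \<open>r\<^sub>2\<close> of the product.\<close>
    define r where "r = min r\<^sub>1 (r\<^sub>2 / 3)"
    have r: "r > 0" "r \<le> r\<^sub>1" "2 * r < r\<^sub>2" using r\<^sub>1 r\<^sub>2 by (auto simp: r_def)
    \<comment> \<open>Chosen so that the slopes caused by the perturbation,
      \<open>3 * \<kappa> * r\<close> in time and \<open>3 * \<kappa> * R * r\<close> along the
      characteristic, add up to \<open>c\<^sub>0 / 2\<close>.\<close>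
    define \<kappa> where "\<kappa> = c\<^sub>0 / (6 * r * (1 + R))"
    have \<kappa>: "\<kappa> > 0" using c\<^sub>0 r R by (simp add: \<kappa>_def)
    \<comment> \<open>The first bound keeps the perturbed minimizer within distance \<open>r\<close>
      of \<open>(t\<^sub>0, x\<^sub>0)\<close>, the second keeps \<open>h\<close> below
      \<open>m / 2\<close> there.\<close>
    define \<delta> where "\<delta> = min (\<kappa> * r\<^sup>2 / 2) (- m / 2)"
    have \<delta>: "\<delta> > 0" using \<kappa> r m \<eta>\<^sub>0 by (simp add: \<delta>_def)
    define H where "H t x v = h t x v + \<kappa> * ((norm (x - x\<^sub>0))\<^sup>2 + (t - t\<^sub>0)\<^sup>2)" for t x v
    \<comment> \<open>A competitor inside the domain with almost the minimal value. The depth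
      \<open>\<eta>\<close> of the set \<open>A\<close> is chosen so that \<open>A\<close> contains
      it.\<close>
    obtain y where y: "y \<in> \<Omega>" "norm (y - x\<^sub>0) \<le> r" "H t\<^sub>0 y v\<^sub>0 < m + \<delta>"
    proof -
      have "continuous_on (closure \<Omega>) (\<lambda>x. H t\<^sub>0 x v\<^sub>0)"
        unfolding H_def using t\<^sub>0_pos by (intro continuous_intros cont_comp) auto
      then have "((\<lambda>x. H t\<^sub>0 x v\<^sub>0) \<longlongrightarrow> H t\<^sub>0 x\<^sub>0 v\<^sub>0) (at x\<^sub>0 within closure \<Omega>)"
        using x\<^sub>0 by (simp add: continuous_on)
      then have "((\<lambda>x. H t\<^sub>0 x v\<^sub>0) \<longlongrightarrow> H t\<^sub>0 x\<^sub>0 v\<^sub>0) (at x\<^sub>0 within \<Omega>)"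
        by (rule tendsto_within_subset) (rule closure_subset)
      then have "\<forall>\<^sub>F x in at x\<^sub>0 within \<Omega>. H t\<^sub>0 x v\<^sub>0 < m + \<delta>"
        using \<delta> by (intro order_tendstoD) (auto simp: H_def m_def)
      moreover have "\<forall>\<^sub>F x in at x\<^sub>0 within \<Omega>. x \<in> \<Omega> \<and> norm (x - x\<^sub>0) \<le> r"
        unfolding eventually_at using r(1) by (intro exI[of _ r]) (auto simp: dist_norm)
      ultimately have ev: "\<forall>\<^sub>F x in at x\<^sub>0 within \<Omega>. H t\<^sub>0 x v\<^sub>0 < m + \<delta> \<and> x \<in> \<Omega> \<and> norm (x - x\<^sub>0) \<le> r"
        by eventually_elim simp
      have "at x\<^sub>0 within \<Omega> \<noteq> bot"
        using x\<^sub>0 False by (simp add: trivial_limit_within closure_def)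
      then show ?thesis using eventually_happens'[OF _ ev] that by blast
    qed
    define \<eta> where "\<eta> = - \<rho> y"
    have yU: "y \<in> U" using y(2) r r\<^sub>1 by (auto simp: dist_norm norm_minus_commute subset_iff)
    then have \<eta>: "\<eta> > 0" using \<Omega>U y(1) by (auto simp: \<eta>_def)
    define A where "A = {x \<in> cball x\<^sub>0 r. \<rho> x \<le> - \<eta>}"
    have ball_U: "cball x\<^sub>0 r \<subseteq> U" using r r\<^sub>1 by (auto simp: subset_iff)
    have A_sub: "A \<subseteq> \<Omega>" using ball_U \<Omega>U \<eta> by (force simp: A_def)
    have A_cl: "A \<subseteq> closure \<Omega>" using A_sub closure_subset by blast
    have "closed A" unfolding A_def
      by (intro continuous_on_closed_Collect_le continuous_on_subset[OF \<rho>_cont ball_U] continuous_intros) auto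
    moreover have "cball x\<^sub>0 r \<inter> A = A" by (auto simp: A_def)
    ultimately have "compact A" using compact_Int_closed[OF compact_cball[of x\<^sub>0 r], of A] by simp
    define S where "S = ({0..t\<^sub>1} \<inter> cball t\<^sub>0 r) \<times> A \<times> cball (0 :: real^'n) R"
    have "compact S" unfolding S_def using \<open>compact A\<close> by (intro compact_Times compact_Int_closed) auto
    moreover have yS: "(t\<^sub>0, y, v\<^sub>0) \<in> S"
      using t\<^sub>0 r y v\<^sub>0 by (auto simp: S_def A_def \<eta>_def dist_norm norm_minus_commute)
    moreover have "continuous_on S (\<lambda>z. H (fst z) (fst (snd z)) (snd (snd z)))"
      unfolding H_def using t\<^sub>1 A_cl by (intro continuous_intros cont_comp) (auto simp: S_def)
    ultimately obtain z' where z': "z' \<in> S" "\<And>y. y \<in> S \<Longrightarrow> H (fst z') (fst (snd z')) (snd (snd z')) \<le> H (fst y) (fst (snd y)) (snd (snd y))"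
      using continuous_attains_inf[of S "\<lambda>z. H (fst z) (fst (snd z)) (snd (snd z))"] by blast
    obtain t x v where tv: "z' = (t, x, v)" by (cases z')
    have Hmin: "H t x v \<le> H t' x' v'" if "t' \<in> {0..t\<^sub>1}" "\<bar>t' - t\<^sub>0\<bar> \<le> r" "x' \<in> A" "norm v' \<le> R" for t' x' v'
      using z'(2)[of "(t', x', v')"] that by (auto simp: tv S_def dist_norm abs_minus_commute)
    have t: "t \<in> {0..t\<^sub>1}" and xA: "x \<in> A" and v: "norm v \<le> R" using z'(1) by (auto simp: tv S_def)
    have x: "x \<in> \<Omega>" "x \<in> closure \<Omega>" using xA A_sub closure_subset by auto
    have "H t x v < m + \<delta>" using z'(2)[OF yS] y(3) by (simp add: tv)
    moreover have "m \<le> h t x v" by (rule min[OF t x(2)])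
    ultimately have close: "\<kappa> * ((norm (x - x\<^sub>0))\<^sup>2 + (t - t\<^sub>0)\<^sup>2) < \<delta>" by (simp add: H_def)
    have "\<kappa> * ((norm (x - x\<^sub>0))\<^sup>2 + (t - t\<^sub>0)\<^sup>2) < \<kappa> * r\<^sup>2"
      using close \<kappa> r by (simp add: \<delta>_def) (smt (verit) mult_nonneg_nonneg zero_le_power2)
    then have "(norm (x - x\<^sub>0))\<^sup>2 + (t - t\<^sub>0)\<^sup>2 < r\<^sup>2" using \<kappa> by simp
    then have "(norm (x - x\<^sub>0))\<^sup>2 < r\<^sup>2" "(t - t\<^sub>0)\<^sup>2 < r\<^sup>2"
      using zero_le_power2[of "norm (x - x\<^sub>0)"] zero_le_power2[of "t - t\<^sub>0"] by linarith+
    then have xr: "norm (x - x\<^sub>0) < r" and tr: "\<bar>t - t\<^sub>0\<bar> < r"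
      using r(1) power2_less_imp_less[of "norm (x - x\<^sub>0)" r] power2_less_imp_less[of "\<bar>t - t\<^sub>0\<bar>" r] by simp_all
    have "0 \<le> \<kappa> * ((norm (x - x\<^sub>0))\<^sup>2 + (t - t\<^sub>0)\<^sup>2)" using \<kappa> by simp
    then have hm: "h t x v \<le> m / 2" using \<open>H t x v < m + \<delta>\<close> by (simp add: H_def \<delta>_def)
    then have hneg: "h t x v < 0" using m \<eta>\<^sub>0 by simp
    have "t \<noteq> 0" using initial[OF x(2), of v] hneg by auto
    then have tT: "t \<in> {0<..<T}" using t t\<^sub>1 by auto
    \<comment> \<open>A minimizer with another velocity would belong to \<open>B\<close>, whose
      projection avoids the small ball.\<close>
    have vG: "v \<bullet> G x > 0"
    proof (rule ccontr)
      assume "\<not> v \<bullet> G x > 0"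
      then have "(t, x, v) \<in> B" using t x v xr r hm by (auto simp: B_def dist_norm norm_minus_commute)
      then have "(t, x) \<in> (\<lambda>z. (fst z, fst (snd z))) ` B" by force
      then have "(t, x) \<notin> ball (t\<^sub>0, x\<^sub>0) r\<^sub>2" using r\<^sub>2(2) by blast
      then have "r\<^sub>2 \<le> dist (t\<^sub>0, x\<^sub>0) (t, x)" by simp
      also have "\<dots> \<le> dist t\<^sub>0 t + dist x\<^sub>0 x" unfolding dist_Pair_Pair by (rule sqrt_sum_squares_le_sum) auto
      also have "\<dots> < 2 * r" using xr tr by (simp add: dist_norm norm_minus_commute abs_minus_commute)
      finally show False using r by simp
    qed
    have "w v \<le> 3 * \<kappa> * r + 3 * \<kappa> * R * r"
    proof (rule touching[OF tT x(1) hneg])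
      show "\<forall>v'. h t x v \<le> h t x v'"
      proof
        fix v'
        show "h t x v \<le> h t x v'"
        proof (cases "norm v' \<le> R")
          case True
          then show ?thesis using Hmin[OF t _ xA True] tr by (simp add: H_def)
        next
          case False
          then show ?thesis using far[OF t x(2), of v'] hm m by simp
        qed
      qed
      define d\<^sub>1 where "d\<^sub>1 = min t (min r (r - \<bar>t - t\<^sub>0\<bar>))"
      have d\<^sub>1: "d\<^sub>1 > 0" using tT tr r by (simp add: d\<^sub>1_def)
      show "\<forall>\<^sub>F \<tau> in at_right 0. h t x v - 3 * \<kappa> * r * \<tau> \<le> h (t - \<tau>) x v"
        using eventually_at_right_real[OF d\<^sub>1]
      proof eventually_elim
        case (elim \<tau>)
        then have \<tau>: "0 < \<tau>" "\<tau> < t" "\<tau> < r" "\<tau> < r - \<bar>t - t\<^sub>0\<bar>" by (auto simp: d\<^sub>1_def)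
        then have "H t x v \<le> H (t - \<tau>) x v" using t xA v by (intro Hmin) auto
        then have "h t x v + \<kappa> * ((t - t\<^sub>0)\<^sup>2 - (t - \<tau> - t\<^sub>0)\<^sup>2) \<le> h (t - \<tau>) x v" by (simp add: H_def algebra_simps)
        moreover have "(t - t\<^sub>0)\<^sup>2 - (t - \<tau> - t\<^sub>0)\<^sup>2 = \<tau> * (2 * (t - t\<^sub>0) - \<tau>)" by (simp add: power2_eq_square algebra_simps)
        moreover have "\<kappa> * (\<tau> * (- 3 * r)) \<le> \<kappa> * (\<tau> * (2 * (t - t\<^sub>0) - \<tau>))"
          using \<kappa> \<tau> tr by (intro mult_left_mono) auto
        ultimately show ?case by (simp add: mult_ac)
      qed
      \<comment> \<open>For an outgoing velocity \<open>\<rho>\<close> decreases along the backward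
        characteristic. This keeps it in \<open>A\<close> even when the minimizer lies on the level
        \<open>- \<eta>\<close>.\<close>
      have dec: "\<forall>\<^sub>F \<tau> in at_right 0. \<rho> (x - \<tau> *\<^sub>R v) < \<rho> x"
      proof -
        have "((\<lambda>\<tau>. \<rho> (x - \<tau> *\<^sub>R v)) has_real_derivative - (v \<bullet> G x)) (at 0)"
          using xA ball_U by (intro GDERIV_along_line \<rho>) (auto simp: A_def)
        from has_real_derivative_neg_dec_right[OF this] vG
        obtain d where "d > 0" "\<And>\<tau>. 0 < \<tau> \<Longrightarrow> \<tau> < d \<Longrightarrow> \<rho> (x - \<tau> *\<^sub>R v) < \<rho> x" by auto
        then show ?thesis unfolding eventually_at_right_field by (intro exI[of _ d]) auto
      qed
      define d\<^sub>2 where "d\<^sub>2 = (r - norm (x - x\<^sub>0)) / R"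
      have d\<^sub>2: "d\<^sub>2 > 0" using xr R by (simp add: d\<^sub>2_def)
      show "\<forall>\<^sub>F \<tau> in at_right 0. h t x v - 3 * \<kappa> * R * r * \<tau> \<le> h t (x - \<tau> *\<^sub>R v) v"
        using dec eventually_at_right_real[OF d\<^sub>2]
      proof eventually_elim
        case (elim \<tau>)
        then have \<tau>: "0 < \<tau>" "\<tau> * R < r - norm (x - x\<^sub>0)" using R(1) by (auto simp: d\<^sub>2_def less_divide_eq)
        have \<tau>v: "norm (\<tau> *\<^sub>R v) \<le> \<tau> * R" using \<tau> v by (simp add: mult_left_mono)
        have "norm (x - \<tau> *\<^sub>R v - x\<^sub>0) \<le> norm (x - x\<^sub>0) + norm (\<tau> *\<^sub>R v)"
          using norm_triangle_ineq4[of "x - x\<^sub>0" "\<tau> *\<^sub>R v"] by (simp add: algebra_simps)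
        then have "norm (x - \<tau> *\<^sub>R v - x\<^sub>0) \<le> r" using \<tau>v \<tau> by linarith
        then have "x - \<tau> *\<^sub>R v \<in> A" using elim xA by (simp add: A_def dist_norm norm_minus_commute)
        then have "H t x v \<le> H t (x - \<tau> *\<^sub>R v) v" using t tr v by (intro Hmin) auto
        then have "h t x v + \<kappa> * ((norm (x - x\<^sub>0))\<^sup>2 - (norm (x - \<tau> *\<^sub>R v - x\<^sub>0))\<^sup>2) \<le> h t (x - \<tau> *\<^sub>R v) v"
          by (simp add: H_def algebra_simps)
        moreover have "(norm (x - x\<^sub>0))\<^sup>2 - (norm (x - \<tau> *\<^sub>R v - x\<^sub>0))\<^sup>2 = \<tau> * (2 * ((x - x\<^sub>0) \<bullet> v) - \<tau> * (norm v)\<^sup>2)"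
          unfolding power2_norm_eq_inner
          by (simp add: inner_diff_left inner_diff_right inner_commute algebra_simps)
        moreover have "\<kappa> * (\<tau> * (- (3 * R * r))) \<le> \<kappa> * (\<tau> * (2 * ((x - x\<^sub>0) \<bullet> v) - \<tau> * (norm v)\<^sup>2))"
        proof -
          have "\<bar>(x - x\<^sub>0) \<bullet> v\<bar> \<le> norm (x - x\<^sub>0) * norm v" by (rule Cauchy_Schwarz_ineq2)
          also have "\<dots> \<le> r * R" using xr v r by (intro mult_mono) auto
          finally have 1: "- (r * R) \<le> (x - x\<^sub>0) \<bullet> v" by linarith
          have "\<tau> * (norm v)\<^sup>2 \<le> \<tau> * (R * R)"
            using v \<tau> R(1) by (intro mult_left_mono) (auto simp: power2_eq_square intro!: mult_mono)
          also have "\<tau> * (R * R) = (\<tau> * R) * R" by simp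
          also have "\<dots> \<le> r * R"
          proof (rule mult_right_mono)
            show "\<tau> * R \<le> r" using \<tau>(2) norm_ge_zero[of "x - x\<^sub>0"] by linarith
          qed (use R(1) in simp)
          finally have "- (3 * R * r) \<le> 2 * ((x - x\<^sub>0) \<bullet> v) - \<tau> * (norm v)\<^sup>2" using 1 by (simp add: mult_ac)
          then show ?thesis using \<kappa> \<tau> by (intro mult_left_mono) auto
        qed
        ultimately show ?case by (simp add: mult_ac)
      qed
    qed
    also have "3 * \<kappa> * r + 3 * \<kappa> * R * r = c\<^sub>0 / 2"
    proof -
      have "3 * \<kappa> * r + 3 * \<kappa> * R * r = \<kappa> * (6 * r * (1 + R)) / 2" by (simp add: algebra_simps)
      also have "\<dots> = c\<^sub>0 / 2" using r R by (simp add: \<kappa>_def)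
      finally show ?thesis .
    qed
    finally show False using c\<^sub>0(1) c\<^sub>0(2)[OF v] by simp
  qed
qed

section \<open>The lower bound\<close>

lemma AE_lborel_open_witness:
  fixes W :: "'a::euclidean_space set"
  assumes "AE z in lborel. P z" "open W" "W \<noteq> {}"
  obtains z where "z \<in> W" "P z"
proof (rule ccontr)
  assume "\<not> thesis"
  then have "\<And>z. z \<in> W \<Longrightarrow> \<not> P z" using that by blast
  then have "AE z in lborel. z \<notin> W" using assms(1) by (auto elim: eventually_mono)
  then have "W \<in> null_sets lborel" using assms(2) by (subst AE_iff_null_sets) auto
  then have "negligible W"
    by (simp add: negligible_iff_null_sets null_sets_completionI)
  then show False using open_not_negligible assms(2,3) by blast
qed

text \<open>Points of the good set are dense, and Fatou's lemma along a sequence of them carries the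
  bound to every point. The moments have to be bounded at the touching point itself, which could
  otherwise fall into the exceptional null set.\<close>

lemma nn_integral_le_of_AE:
  fixes f :: "'a::euclidean_space \<Rightarrow> real^'n \<Rightarrow> real"
  assumes W: "open W" "z \<in> W" and cont: "\<And>v. continuous_on W (\<lambda>z. f z v)"
    and meas: "\<And>z. z \<in> W \<Longrightarrow> f z \<in> borel_measurable borel"
    and bound: "AE z in lborel. z \<in> W \<longrightarrow> (\<integral>\<^sup>+v. ennreal (f z v) \<partial>lborel) \<le> c"
  shows "(\<integral>\<^sup>+v. ennreal (f z v) \<partial>lborel) \<le> c"
proof -
  have "\<exists>y. y \<in> W \<and> dist y z < inverse (real (Suc k)) \<and> (\<integral>\<^sup>+v. ennreal (f y v) \<partial>lborel) \<le> c" for k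
  proof -
    have "open (W \<inter> ball z (inverse (real (Suc k))))" "W \<inter> ball z (inverse (real (Suc k))) \<noteq> {}"
      using W by auto
    then obtain y where "y \<in> W \<inter> ball z (inverse (real (Suc k)))" "y \<in> W \<longrightarrow> (\<integral>\<^sup>+v. ennreal (f y v) \<partial>lborel) \<le> c"
      using AE_lborel_open_witness[OF bound] by blast
    then show ?thesis by (auto simp: dist_commute)
  qed
  then obtain y where y: "\<And>k. y k \<in> W" "\<And>k. dist (y k) z < inverse (real (Suc k))"
    "\<And>k. (\<integral>\<^sup>+v. ennreal (f (y k) v) \<partial>lborel) \<le> c"
    by metis
  have "(\<lambda>k. dist (y k) z) \<longlonglongrightarrow> 0"
    by (rule tendsto_sandwich[OF _ _ tendsto_const LIMSEQ_inverse_real_of_nat])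
      (auto intro!: always_eventually less_imp_le y(2) simp del: of_nat_Suc)
  then have "y \<longlonglongrightarrow> z" by (rule tendsto_dist_iff[THEN iffD2])
  then have lim: "(\<lambda>k. f (y k) v) \<longlonglongrightarrow> f z v" for v
    by (rule continuous_on_tendsto_compose[OF cont[of v] _ W(2)]) (simp add: y(1))
  have "(\<integral>\<^sup>+v. ennreal (f z v) \<partial>lborel) = (\<integral>\<^sup>+v. liminf (\<lambda>k. ennreal (f (y k) v)) \<partial>lborel)"
    by (intro nn_integral_cong lim_imp_Liminf[symmetric] tendsto_ennrealI lim) simp
  also have "\<dots> \<le> liminf (\<lambda>k. \<integral>\<^sup>+v. ennreal (f (y k) v) \<partial>lborel)"
    using meas y(1) by (intro nn_integral_liminf) auto
  also have "\<dots> \<le> c" by (intro Liminf_le always_eventually allI y(3)) simp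
  finally show ?thesis .
qed

lemma hydrodynamic_bounds_nn:
  assumes "hydrodynamic_bounds m\<^sub>0 M\<^sub>0 E\<^sub>0 H\<^sub>0 g" and "\<And>v. 0 \<le> g v"
  shows "(\<integral>\<^sup>+v. ennreal (g v) \<partial>lborel) \<le> ennreal M\<^sub>0"
    and "(\<integral>\<^sup>+v. ennreal (g v * (norm v)\<^sup>2) \<partial>lborel) \<le> ennreal E\<^sub>0"
  using assms unfolding hydrodynamic_bounds_def by (simp_all add: nn_integral_eq_integral ennreal_leI)

theorem theorem1p11:
  fixes s \<gamma> b_lo b_hi T m\<^sub>0 M\<^sub>0 E\<^sub>0 H\<^sub>0 q a\<^sub>0 a\<^sub>b :: real
    and bt :: "real \<Rightarrow> real"
    and \<Omega> :: "(real^'n) set"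
    and n :: "real^'n \<Rightarrow> real^'n"
    and f f\<^sub>b :: "real \<Rightarrow> real^'n \<Rightarrow> real^'n \<Rightarrow> real"
    and f\<^sub>i\<^sub>n :: "real^'n \<Rightarrow> real^'n \<Rightarrow> real"
  assumes "2 \<le> CARD('n)"
    and "0 < s" and "s < 1"
    and "- real CARD('n) < \<gamma>" and "\<gamma> \<le> 0"
    and "0 < \<gamma> + 2 * s" and "\<gamma> + 2 * s \<le> 1"
    and "bt \<in> borel_measurable (restrict_space borel {-1..1})"
    and "0 < b_lo" and "\<And>c. c \<in> {-1..1} \<Longrightarrow> b_lo \<le> bt c \<and> bt c \<le> b_hi"
    and "C1_domain \<Omega>" and "bounded \<Omega>"
    and "\<And>x. x \<in> frontier \<Omega> \<Longrightarrow> outward_unit_normal \<Omega> x (n x)"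
    and "0 < T"
    and "classical_inflow_solution \<gamma> s bt \<Omega> n T f\<^sub>i\<^sub>n f\<^sub>b f"
    and "\<And>t x v. t \<in> {0..T} \<Longrightarrow> x \<in> \<Omega> \<Longrightarrow> 0 \<le> f t x v"
    and "\<And>x v. x \<in> \<Omega> \<Longrightarrow> 0 \<le> f\<^sub>i\<^sub>n x v"
    and "\<And>t x v. t \<in> {0..T} \<Longrightarrow> x \<in> frontier \<Omega> \<Longrightarrow> 0 \<le> f\<^sub>b t x v"
    and "0 < m\<^sub>0" and "0 < M\<^sub>0" and "0 < E\<^sub>0" and "0 < H\<^sub>0"
    and "AE (t, x) in lborel. t \<in> {0<..<T} \<and> x \<in> \<Omega> \<longrightarrow>
           hydrodynamic_bounds m\<^sub>0 M\<^sub>0 E\<^sub>0 H\<^sub>0 (f t x)"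
    and "real CARD('n) + 2 < q"
    and "0 < a\<^sub>0" and "0 < a\<^sub>b"
    and "\<And>x v. x \<in> \<Omega> \<Longrightarrow> a\<^sub>0 * japanese v powr (- q) \<le> f\<^sub>i\<^sub>n x v"
    and "\<And>t x v. t \<in> {0..T} \<Longrightarrow> x \<in> frontier \<Omega> \<Longrightarrow> a\<^sub>b * japanese v powr (- q) \<le> f\<^sub>b t x v"
  shows "\<exists>a\<^sub>1>0. \<exists>\<beta>>0. \<forall>t\<in>{0..T}. \<forall>x\<in>\<Omega>. \<forall>v.
           a\<^sub>1 * exp (- \<beta> * t) * japanese v powr (- q) \<le> f t x v"
proof -
  define g where "g v = japanese v powr (- q)" for v :: "real^'n"
  have g_pos: "0 < g v" for v using japanese_pos[of v] by (simp add: g_def)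
  have g_cont: "continuous_on UNIV g"
  proof -
    have "1 + (norm v)\<^sup>2 \<noteq> 0" for v :: "real^'n" by (smt (verit) zero_le_power2)
    then show ?thesis unfolding g_def japanese_powr_eq by (intro continuous_intros) auto
  qed
  define a where "a = min a\<^sub>0 a\<^sub>b"
  have a: "0 < a" "a \<le> a\<^sub>0" "a \<le> a\<^sub>b" using \<open>0 < a\<^sub>0\<close> \<open>0 < a\<^sub>b\<close> by (auto simp: a_def)
  have q: "2 \<le> q" using \<open>real CARD('n) + 2 < q\<close> by linarith
  have \<Omega>: "open \<Omega>" using \<open>C1_domain \<Omega>\<close> by (simp add: C1_domain_def)
  note sol = \<open>classical_inflow_solution \<gamma> s bt \<Omega> n T f\<^sub>i\<^sub>n f\<^sub>b f\<close>[unfolded classical_inflow_solution_def]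
  have cont: "continuous_on ({0..T} \<times> closure \<Omega> \<times> UNIV) (\<lambda>(t, x, v). f t x v)"
    and eqn: "\<And>t x v. t \<in> {0<..<T} \<Longrightarrow> x \<in> \<Omega> \<Longrightarrow> boltzmann_equation_at \<gamma> s bt f t x v"
    and init: "\<And>x v. x \<in> \<Omega> \<Longrightarrow> f 0 x v = f\<^sub>i\<^sub>n x v"
    and bdry: "\<And>t x v. t \<in> {0..T} \<Longrightarrow> x \<in> frontier \<Omega> \<Longrightarrow> v \<bullet> n x < 0 \<Longrightarrow> f t x v = f\<^sub>b t x v"
    using sol by blast+
  have cont_comp: "continuous_on S (\<lambda>z. f (\<alpha> z) (\<xi> z) (\<zeta> z))"
    if "continuous_on S \<alpha>" "continuous_on S \<xi>" "continuous_on S \<zeta>" "\<And>z. z \<in> S \<Longrightarrow> \<alpha> z \<in> {0..T} \<and> \<xi> z \<in> closure \<Omega>"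
    for S :: "'z::topological_space set" and \<alpha> \<xi> \<zeta>
  proof -
    have "continuous_on S (\<lambda>z. (\<lambda>(t, x, v). f t x v) (\<alpha> z, \<xi> z, \<zeta> z))"
      by (rule continuous_on_compose2[OF cont]) (use that in \<open>auto intro!: continuous_on_Pair\<close>)
    then show ?thesis by simp
  qed
  \<comment> \<open>Nonnegativity is assumed inside only and reaches the boundary by
    continuity.\<close>
  have nonneg: "0 \<le> f t x v" if "t \<in> {0..T}" "x \<in> closure \<Omega>" for t x v
    by (rule continuous_ge_on_closure[of \<Omega> "\<lambda>x. f t x v"])
      (use that assms(16) in \<open>auto intro!: cont_comp continuous_intros\<close>)
  have fv_cont: "continuous_on UNIV (f t x)" if "t \<in> {0..T}" "x \<in> \<Omega>" for t x
    using cont_comp[of UNIV "\<lambda>_. t" "\<lambda>_. x" "\<lambda>v. v"] that closure_subset[of \<Omega>] by (auto simp: continuous_on_id)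
  define W where "W = {0<..<T} \<times> \<Omega>"
  have W: "open W" using \<Omega> by (simp add: W_def open_Times)
  have W_cont: "continuous_on W (\<lambda>z. f (fst z) (snd z) v)" for v
    using closure_subset[of \<Omega>] by (intro cont_comp continuous_intros) (auto simp: W_def)
  have hydro: "AE z in lborel. z \<in> W \<longrightarrow> hydrodynamic_bounds m\<^sub>0 M\<^sub>0 E\<^sub>0 H\<^sub>0 (f (fst z) (snd z))"
    using assms(23) by (auto simp: W_def case_prod_beta elim: eventually_mono)
  have mass: "(\<integral>\<^sup>+v. ennreal (f t x v) \<partial>lborel) \<le> ennreal M\<^sub>0"
    and energy: "(\<integral>\<^sup>+v. ennreal (f t x v * (norm v)\<^sup>2) \<partial>lborel) \<le> ennreal E\<^sub>0"
    if "t \<in> {0<..<T}" "x \<in> \<Omega>" for t x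
  proof -
    have z: "(t, x) \<in> W" using that by (simp add: W_def)
    have W0: "0 \<le> f (fst z) (snd z) v" if "z \<in> W" for z v
      using that closure_subset[of \<Omega>] by (intro nonneg) (auto simp: W_def)
    have [measurable]: "f (fst z) (snd z) \<in> borel_measurable borel" if "z \<in> W" for z
      using that by (intro borel_measurable_continuous_onI fv_cont) (auto simp: W_def)
    have "AE z in lborel. z \<in> W \<longrightarrow> (\<integral>\<^sup>+v. ennreal (f (fst z) (snd z) v) \<partial>lborel) \<le> ennreal M\<^sub>0"
      using hydro by eventually_elim (use hydrodynamic_bounds_nn(1) W0 in blast)
    from nn_integral_le_of_AE[OF W z W_cont _ this] show "(\<integral>\<^sup>+v. ennreal (f t x v) \<partial>lborel) \<le> ennreal M\<^sub>0"
      by simp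
    have "AE z in lborel. z \<in> W \<longrightarrow> (\<integral>\<^sup>+v. ennreal (f (fst z) (snd z) v * (norm v)\<^sup>2) \<partial>lborel) \<le> ennreal E\<^sub>0"
      using hydro by eventually_elim (use hydrodynamic_bounds_nn(2) W0 in blast)
    from nn_integral_le_of_AE[OF W z _ _ this] show "(\<integral>\<^sup>+v. ennreal (f t x v * (norm v)\<^sup>2) \<partial>lborel) \<le> ennreal E\<^sub>0"
      using W_cont by (simp add: continuous_intros)
  qed
  have MX: "0 \<le> M\<^sub>0" "0 \<le> E\<^sub>0" using \<open>0 < M\<^sub>0\<close> \<open>0 < E\<^sub>0\<close> by simp_all
  have bt0: "0 \<le> bt c \<and> bt c \<le> b_hi" if "c \<in> {-1..1}" for c using assms(10)[OF that] \<open>0 < b_lo\<close> by linarith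
  define C where "C = q * cut_constant TYPE('n) s b_hi * (M\<^sub>0 + E\<^sub>0)"
  have C: "C \<ge> 0"
    using q MX cut_constant_nonneg[OF assms(1-8) bt0] by (simp add: C_def)
  \<comment> \<open>The decay rate exceeds the constant \<open>C\<close> of the collision estimate
    by 1; this surplus yields the strict contradiction.\<close>
  define \<beta> where "\<beta> = C + 1"
  have \<beta>: "0 < \<beta>" using C by (simp add: \<beta>_def)
  define h where "h t x v = f t x v - a * exp (- \<beta> * t) * g v" for t x v
  have exp_le: "a * exp (- \<beta> * t) * g v \<le> a * g v" if "0 \<le> t" for t v
    using that \<beta> a(1) g_pos[of v] by simp
  have data: "0 \<le> h t x v" if "0 \<le> t" "c * g v \<le> f t x v" "a \<le> c" for t x v c
  proof -
    have "a * g v \<le> c * g v" using that(3) g_pos[of v] by simp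
    then show ?thesis using exp_le[OF that(1), of v] that(2) unfolding h_def by linarith
  qed
  have "0 \<le> h t x v" if "t \<in> {0..T}" "x \<in> \<Omega>" for t x v
  \<comment> \<open>Since f is nonnegative, \<open>h\<close> is at least minus the initial barrier,
    whence \<open>W\<close>. The choice of \<open>w\<close> is the smallest value over
    \<open>{0..T}\<close> of the surplus of \<open>\<beta>\<close> times the barrier.\<close>
  proof (rule outflow_minimum_principle[where h = h and n = n and T = T and \<Omega> = \<Omega> and W = "\<lambda>v. a * g v" and w = "\<lambda>v. a * exp (- \<beta> * T) * g v"])
    show "open \<Omega>" "bounded \<Omega>" "\<And>x. x \<in> frontier \<Omega> \<Longrightarrow> outward_unit_normal \<Omega> x (n x)" by fact+
    show "t \<in> {0..T}" "x \<in> \<Omega>" by fact+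
    show "continuous_on ({0..T} \<times> closure \<Omega> \<times> UNIV) (\<lambda>(t, x, v). h t x v)"
      unfolding h_def case_prod_beta
      by (intro continuous_intros cont_comp continuous_on_compose2[OF g_cont]) auto
    show "- (a * g v) \<le> h t x v" if "t \<in> {0..T}" "x \<in> closure \<Omega>" for t x v
      using nonneg[OF that, of v] exp_le[of t v] that by (simp add: h_def)
    show "\<exists>R. \<forall>v. R < norm v \<longrightarrow> a * g v < \<eta>" if "\<eta> > 0" for \<eta>
    proof (intro exI allI impI)
      \<comment> \<open>The radius \<open>a / \<eta>\<close> suffices because \<open>g v\<close> is
        at most 1/<v>, hence at most 1/|v|.\<close>
      fix v :: "real^'n" assume v: "a / \<eta> < norm v"
      have v0: "0 < norm v" using v a(1) that by (meson divide_pos_pos less_trans)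
      have "g v \<le> japanese v powr (- 1)"
        unfolding g_def using q japanese_ge_1[of v] by (intro powr_mono) auto
      also have "\<dots> = 1 / japanese v" using japanese_pos[of v] by (simp add: powr_minus_divide)
      also have "\<dots> \<le> 1 / norm v" by (rule frac_le) (use v0 norm_le_japanese[of v] in simp_all)
      finally have "a * g v \<le> a * (1 / norm v)" using a(1) by (intro mult_left_mono) auto
      also have "\<dots> < \<eta>" using v v0 that by (simp add: field_simps)
      finally show "a * g v < \<eta>" .
    qed
    show "continuous_on UNIV (\<lambda>v. a * exp (- \<beta> * T) * g v)" by (intro continuous_intros g_cont)
    show "0 < a * exp (- \<beta> * T) * g v" for v using a(1) g_pos[of v] by simp
    show "0 \<le> h 0 x v" if "x \<in> closure \<Omega>" for x v
    proof (rule data[of _ a\<^sub>0])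
      have "0 \<le> f 0 x v - a\<^sub>0 * g v"
      proof (rule continuous_ge_on_closure[OF _ that])
        show "continuous_on (closure \<Omega>) (\<lambda>x. f 0 x v - a\<^sub>0 * g v)"
          using \<open>0 < T\<close> by (intro continuous_intros cont_comp) auto
      qed (use init assms(27) in \<open>simp add: g_def\<close>)
      then show "a\<^sub>0 * g v \<le> f 0 x v" by simp
    qed (use a in simp_all)
    show "0 \<le> h t x v" if t: "t \<in> {0..T}" and x: "x \<in> frontier \<Omega>" and v: "v \<bullet> n x \<le> 0" for t x v
    proof (rule data[of _ a\<^sub>b])
      have xc: "x \<in> closure \<Omega>" using x by (simp add: frontier_def)
      have nn: "n x \<bullet> n x > 0"
        using assms(13)[OF x] by (auto simp: outward_unit_normal_def C1_defining_function_def)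
      \<comment> \<open>The boundary condition covers strictly incoming velocities only. A
        tangential velocity is the limit of the incoming ones obtained by subtracting small
        multiples of the normal.\<close>
      have "continuous_on UNIV (\<lambda>\<tau>::real. f t x (v - \<tau> *\<^sub>R n x) - a\<^sub>b * g (v - \<tau> *\<^sub>R n x))"
        using t xc by (intro continuous_intros cont_comp continuous_on_compose2[OF g_cont]) auto
      then have "isCont (\<lambda>\<tau>::real. f t x (v - \<tau> *\<^sub>R n x) - a\<^sub>b * g (v - \<tau> *\<^sub>R n x)) 0"
        by (simp add: continuous_on_eq_continuous_at)
      from tendsto_mono[OF at_le[OF subset_UNIV] isContD[OF this]]
      have "((\<lambda>\<tau>. f t x (v - \<tau> *\<^sub>R n x) - a\<^sub>b * g (v - \<tau> *\<^sub>R n x)) \<longlongrightarrow>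
          f t x (v - 0 *\<^sub>R n x) - a\<^sub>b * g (v - 0 *\<^sub>R n x)) (at_right 0)" .
      moreover have "\<forall>\<^sub>F \<tau> in at_right 0. 0 \<le> f t x (v - \<tau> *\<^sub>R n x) - a\<^sub>b * g (v - \<tau> *\<^sub>R n x)"
        using eventually_at_right_less[of "0::real"]
      proof eventually_elim
        case (elim \<tau>)
        have "(v - \<tau> *\<^sub>R n x) \<bullet> n x < 0"
          using v mult_pos_pos[OF elim nn] by (simp add: inner_diff_left)
        then show ?case using bdry[OF t x] assms(28)[OF t x, of "v - \<tau> *\<^sub>R n x"] by (simp add: g_def)
      qed
      ultimately have "0 \<le> f t x (v - 0 *\<^sub>R n x) - a\<^sub>b * g (v - 0 *\<^sub>R n x)"
        by (rule tendsto_lowerbound) simp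
      then show "a\<^sub>b * g v \<le> f t x v" by simp
    qed (use a t in simp_all)
    show "a * exp (- \<beta> * T) * g v \<le> c\<^sub>1 + c\<^sub>2"
      if t: "t \<in> {0<..<T}" and x: "x \<in> \<Omega>" and neg: "h t x v < 0" and min: "\<forall>v'. h t x v \<le> h t x v'"
        and back_t: "\<forall>\<^sub>F \<tau> in at_right 0. h t x v - c\<^sub>1 * \<tau> \<le> h (t - \<tau>) x v"
        and back_x: "\<forall>\<^sub>F \<tau> in at_right 0. h t x v - c\<^sub>2 * \<tau> \<le> h t (x - \<tau> *\<^sub>R v) v"
      for t x v c\<^sub>1 c\<^sub>2
    proof -
      define b where "b = a * exp (- \<beta> * t)"
      have b: "b \<ge> 0" using a(1) by (simp add: b_def)
      have t': "t \<in> {0..T}" and x': "x \<in> closure \<Omega>" using t x closure_subset[of \<Omega>] by auto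
      obtain f\<^sub>t f\<^sub>x Q where ft: "((\<lambda>\<tau>. f \<tau> x v) has_real_derivative f\<^sub>t) (at t)"
        and fx: "GDERIV (\<lambda>y. f t y v) x :> f\<^sub>x" and Q: "has_collision_value \<gamma> s bt (f t x) v Q" "f\<^sub>t + v \<bullet> f\<^sub>x = Q"
        using eqn[OF t x, of v] unfolding boltzmann_equation_at_def by blast
      have "((\<lambda>\<tau>. f (t - \<tau>) x v) has_real_derivative f\<^sub>t * (- 1)) (at 0)"
        by (rule DERIV_chain2[where f = "\<lambda>\<tau>. f \<tau> x v"]) (use ft in \<open>auto intro!: derivative_eq_intros\<close>)
      then have "((\<lambda>\<tau>. h (t - \<tau>) x v) has_real_derivative - f\<^sub>t - \<beta> * b * g v) (at 0)"
        unfolding h_def b_def by (auto intro!: derivative_eq_intros)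
      from one_sided_derivative_ge[OF this, of c\<^sub>1] back_t have 1: "f\<^sub>t + \<beta> * b * g v \<le> c\<^sub>1" by simp
      have "((\<lambda>\<tau>. h t (x - \<tau> *\<^sub>R v) v) has_real_derivative - (v \<bullet> f\<^sub>x)) (at 0)"
        unfolding h_def using GDERIV_along_line[OF fx, of v] by (auto intro!: derivative_eq_intros)
      from one_sided_derivative_ge[OF this, of c\<^sub>2] back_x have 2: "v \<bullet> f\<^sub>x \<le> c\<^sub>2" by simp
      have "- (C * b * japanese v powr (- q)) \<le> Q"
        unfolding C_def
      \<comment> \<open>With \<open>\<epsilon>\<close> equal to minus the minimum, f is the barrier
        minus \<open>\<epsilon>\<close> at \<open>v\<close>, and minimality in the velocity is the
        required lower bound elsewhere.\<close>
      proof (rule has_collision_value_lower_bound[OF assms(1-8) bt0, where F = "f t x" and \<epsilon> = "- h t x v"])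
        show "(\<integral>\<^sup>+w. ennreal (f t x w) * ennreal ((norm w)\<^sup>2) \<partial>lborel) \<le> ennreal E\<^sub>0"
          using energy[OF t x] nonneg[OF t' x'] by (simp add: ennreal_mult)
        show "b * japanese v' powr (- q) - - h t x v \<le> f t x v'" for v'
          using min[rule_format, of v'] by (simp add: h_def[of t x v'] b_def g_def)
      qed (use MX q fv_cont[OF t' x] nonneg[OF t' x'] mass[OF t x] b neg Q(1) in \<open>simp_all add: h_def b_def g_def\<close>)
      then have 3: "- (C * b * g v) \<le> Q" by (simp add: g_def)
      \<comment> \<open>Adding the two slope bounds and inserting the equation leaves
        \<open>c\<^sub>1 + c\<^sub>2\<close> at least (beta - C) b g(v).\<close>
      have "\<beta> * b * g v = C * b * g v + b * g v" by (simp add: \<beta>_def algebra_simps)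
      with 1 2 3 Q(2) have "b * g v \<le> c\<^sub>1 + c\<^sub>2" by linarith
      moreover have "a * exp (- \<beta> * T) * g v \<le> b * g v"
        unfolding b_def using t \<beta> a(1) g_pos[of v] by simp
      ultimately show ?thesis by linarith
    qed
  qed
  then show ?thesis
    using a(1) \<beta> by (intro exI[of _ a] exI[of _ \<beta>]) (auto simp: h_def g_def)
qed

end
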